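(* Let $f:X\to Y$ be a smooth map between manifolds, with $X-\operatorname{int}C$ compact for some closed subset $C\subset X$ with a neighborhood $W_C$ in $X$. Suppose that $\omega_Y$ is a symplectic form on $Y$, and $J$ is a continuous, $(\omega_Y,f)$-tame almost-complex structure on $X$. Fix a class $c\in H^2_{\mathrm{dR}}(X)$. Suppose that for each $y\in Y$, $f^{-1}(y)$ has a neighborhood $W_y$ in $X$ containing $W_C$, with the restriction $H^1_{\mathrm{dR}}(W_y)\to H^1_{\mathrm{dR}}(W_C)$ surjective, and with a closed 2-form $\eta_y$ on $W_y$ such that $[\eta_y]=c|W_y\in H^2_{\mathrm{dR}}(W_y)$ and such that $\eta_y$ tames $J$ on each of the complex subspaces $\ker df_x$, $x\in W_y$. Suppose that these forms $\eta_y$ all agree on $W_C$, and that the resulting form $\eta_C$ on $W_C$ tames $J$ on $TX|C$. Then there is a closed 2-form $\eta$ on $X$ agreeing with $\eta_C$ near $C$, with $[\eta]=c\in H^2_{\mathrm{dR}}(X)$, and such that for all sufficiently small $t>0$ the form $\omega_t=t\eta+f^*\omega_Y$ on $X$ tames $J$ (and hence is symplectic).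
   Context: An almost-complex structure on $X$ is a bundle map $J:TX\to TX$ covering $\mathrm{id}_X$ with $J\circ J=-\mathrm{id}$ (here only continuous). $J$ is $(\omega_Y,f)$-tame if $f^*\omega_Y(v,Jv)>0$ for every $x\in X$ and every $v\in T_xX-\ker df_x$; each $\ker df_x$ is then a $J$-complex subspace. A 2-form $\eta$ tames $J$ on a $J$-complex subspace $V\subset T_xX$ if $\eta(v,Jv)>0$ for all nonzero $v\in V$; it tames $J$ on $X$ (or on $TX|C$) if it does so on $T_xX$ for all $x\in X$ (resp. $x\in C$). *)

theory Defs
  imports "HOL-Analysis.Analysis" "HOL-Library.Function_Algebras"
begin

section \<open>Pointwise vector space structure on functions\<close>

instantiation "fun" :: (type, real_vector) real_vector
begin

definition scaleR_fun :: "real \<Rightarrow> ('a \<Rightarrow> 'b) \<Rightarrow> 'a \<Rightarrow> 'b"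
  where "scaleR_fun r f = (\<lambda>x. r *\<^sub>R f x)"

instance
  by standard (auto simp: scaleR_fun_def fun_eq_iff scaleR_add_right scaleR_add_left)

end

section \<open>Smooth maps between open subsets of the model spaces\<close>

text \<open>
  Model spaces have sort \<open>{real_inner, heine_borel}\<close>. These are exactly the finite-dimensional real
  inner product spaces (one direction is the lemma below). The class \<open>euclidean_space\<close> would exclude
  dimension 0, and hence the case where \<open>Y\<close> is a point.
\<close>

lemma heine_borel_finite_dimensional:
  "\<exists>B :: 'e::{real_inner, heine_borel} set. finite B \<and> span B = UNIV"
proof -
  define ON :: "'e set set"
    where "ON = {B. (\<forall>b\<in>B. norm b = 1) \<and> (\<forall>a\<in>B. \<forall>b\<in>B. a \<noteq> b \<longrightarrow> a \<bullet> b = 0)}"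
  have "\<exists>M\<in>ON. \<forall>X\<in>ON. M \<subseteq> X \<longrightarrow> X = M"
  proof (rule subset_Zorn')
    fix \<C> assume "subset.chain ON \<C>"
    then have sub: "\<C> \<subseteq> ON" and ch: "\<And>X Y. X \<in> \<C> \<Longrightarrow> Y \<in> \<C> \<Longrightarrow> X \<subseteq> Y \<or> Y \<subseteq> X"
      by (auto simp: subset_chain_def)
    have "a \<bullet> b = 0" if ab: "a \<in> \<Union>\<C>" "b \<in> \<Union>\<C>" "a \<noteq> b" for a b
    proof -
      obtain X Y where "X \<in> \<C>" "Y \<in> \<C>" "a \<in> X" "b \<in> Y" using ab by blast
      then obtain Z where "Z \<in> \<C>" "a \<in> Z" "b \<in> Z" using ch by blast
      then show ?thesis using sub ab unfolding ON_def by blast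
    qed
    moreover have "norm b = 1" if "b \<in> \<Union>\<C>" for b
      using that sub unfolding ON_def by blast
    ultimately show "\<Union>\<C> \<in> ON" unfolding ON_def by blast
  qed
  then obtain B where B: "B \<in> ON" and max: "\<And>X. X \<in> ON \<Longrightarrow> B \<subseteq> X \<Longrightarrow> X = B"
    by blast
  have n1: "norm b = 1" if "b \<in> B" for b using B that unfolding ON_def by blast
  have orth: "a \<bullet> b = 0" if "a \<in> B" "b \<in> B" "a \<noteq> b" for a b
    using B that unfolding ON_def by blast
  have fin: "finite B"
  proof (rule ccontr)
    assume "infinite B"
    then obtain s :: "nat \<Rightarrow> 'e" where inj: "inj s" and ran: "range s \<subseteq> B"
      using infinite_countable_subset by blast
    have "bounded (range s)"
      using ran n1 by (intro boundedI[of _ 1]) auto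
    then obtain l r where r: "strict_mono (r :: nat \<Rightarrow> nat)" and "(s \<circ> r) \<longlonglongrightarrow> l"
      using bounded_imp_convergent_subsequence by blast
    then have "Cauchy (s \<circ> r)" by (simp add: LIMSEQ_imp_Cauchy)
    then obtain N where N: "\<And>m n. m \<ge> N \<Longrightarrow> n \<ge> N \<Longrightarrow> dist ((s \<circ> r) m) ((s \<circ> r) n) < 1"
      unfolding Cauchy_def by (meson zero_less_one)
    define a b where "a = s (r N)" and "b = s (r (Suc N))"
    have "r N \<noteq> r (Suc N)" using r by (metis n_not_Suc_n strict_mono_eq)
    then have "a \<noteq> b" using inj by (simp add: a_def b_def inj_eq)
    moreover have ab: "a \<in> B" "b \<in> B" using ran by (auto simp: a_def b_def)
    ultimately have "a \<bullet> b = 0" using orth by blast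
    then have "(norm (a - b))\<^sup>2 = 2"
      using n1[OF ab(1)] n1[OF ab(2)]
      by (simp add: power2_norm_eq_inner inner_diff_left inner_diff_right inner_commute norm_eq_1)
    moreover have "norm (a - b) < 1"
      using N[of N "Suc N"] by (simp add: a_def b_def dist_norm)
    then have "(norm (a - b))\<^sup>2 \<le> 1"
      by (simp add: power_le_one)
    ultimately show False by simp
  qed
  have "x \<in> span B" for x
  proof (rule ccontr)
    assume x: "x \<notin> span B"
    define p where "p = (\<Sum>b\<in>B. (x \<bullet> b) *\<^sub>R b)"
    define y where "y = x - p"
    have p: "p \<in> span B"
      unfolding p_def by (intro span_sum span_scale span_base)
    then have y0: "y \<noteq> 0" using x by (auto simp: y_def)
    have yb: "y \<bullet> b = 0" if "b \<in> B" for b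
    proof -
      have "p \<bullet> b = (\<Sum>a\<in>B. (x \<bullet> a) * (a \<bullet> b))"
        by (simp add: p_def inner_sum_left)
      also have "\<dots> = (\<Sum>a\<in>B. if a = b then x \<bullet> b else 0)"
        using that n1 orth by (intro sum.cong refl) (auto simp: norm_eq_1)
      also have "\<dots> = x \<bullet> b" using that fin by simp
      finally show ?thesis by (simp add: y_def inner_diff_left)
    qed
    define u where "u = y /\<^sub>R norm y"
    have "norm u = 1" using y0 by (simp add: u_def)
    moreover have ub: "u \<bullet> b = 0" if "b \<in> B" for b using yb[OF that] by (simp add: u_def)
    ultimately have "insert u B \<in> ON"
      using n1 orth unfolding ON_def by (auto simp: inner_commute)
    then have "u \<in> B" using max by blast
    then have "u \<bullet> u = 0" using ub by blast
    then show False using \<open>norm u = 1\<close> by simp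
  qed
  then show ?thesis using fin by blast
qed

text \<open>\<open>C\<^sup>k\<close> on an open set \<open>S\<close>, by iterated directional derivatives.\<close>

primrec ck_on :: "nat \<Rightarrow> 'e::real_normed_vector set \<Rightarrow> ('e \<Rightarrow> 'f::real_normed_vector) \<Rightarrow> bool" where
  "ck_on 0 S f \<longleftrightarrow> continuous_on S f"
| "ck_on (Suc k) S f \<longleftrightarrow>
     (\<forall>x\<in>S. f differentiable (at x)) \<and> (\<forall>v. ck_on k S (\<lambda>x. frechet_derivative f (at x) v))"

definition smooth_on :: "'e::real_normed_vector set \<Rightarrow> ('e \<Rightarrow> 'f::real_normed_vector) \<Rightarrow> bool" where
  "smooth_on S f \<longleftrightarrow> (\<forall>k. ck_on k S f)"

section \<open>Smooth manifolds\<close>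

text \<open>
  A chart is a pair of its domain and its coordinate map (whose values outside the domain are
  irrelevant). A manifold without boundary is a Hausdorff, second countable type with a smooth
  atlas, which need not be maximal.
\<close>

type_synonym ('a, 'e) chart = "'a set \<times> ('a \<Rightarrow> 'e)"
type_synonym ('a, 'e) atlas = "('a, 'e) chart set"

definition chart_inv :: "('a, 'e) chart \<Rightarrow> 'e \<Rightarrow> 'a" where
  "chart_inv c = inv_into (fst c) (snd c)"

definition is_chart :: "('a::topological_space, 'e::topological_space) chart \<Rightarrow> bool" where
  "is_chart c \<longleftrightarrow> open (fst c) \<and> open (snd c ` fst c) \<and>
     homeomorphism (fst c) (snd c ` fst c) (snd c) (chart_inv c)"

definition transition :: "('a, 'e) chart \<Rightarrow> ('a, 'e) chart \<Rightarrow> 'e \<Rightarrow> 'e" where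
  "transition c d = snd d \<circ> chart_inv c"

definition smooth_atlas ::
  "('a::{t2_space, second_countable_topology}, 'e::{real_inner, heine_borel}) atlas \<Rightarrow> bool" where
  "smooth_atlas A \<longleftrightarrow> (\<forall>c\<in>A. is_chart c) \<and> (\<Union>c\<in>A. fst c) = UNIV \<and>
     (\<forall>c\<in>A. \<forall>d\<in>A. smooth_on (snd c ` (fst c \<inter> fst d)) (transition c d))"

definition charts_at :: "('a, 'e) atlas \<Rightarrow> 'a \<Rightarrow> ('a, 'e) chart set" where
  "charts_at A x = {c \<in> A. x \<in> fst c}"

definition smooth_map ::
  "('a::topological_space, 'e::real_normed_vector) atlas \<Rightarrow>
   ('b::topological_space, 'h::real_normed_vector) atlas \<Rightarrow> ('a \<Rightarrow> 'b) \<Rightarrow> bool" where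
  "smooth_map A B f \<longleftrightarrow> continuous_on UNIV f \<and>
     (\<forall>c\<in>A. \<forall>d\<in>B. smooth_on (snd c ` (fst c \<inter> f -` fst d)) (snd d \<circ> f \<circ> chart_inv c))"

section \<open>Tangent vectors and the differential\<close>

text \<open>
  A tangent vector at \<open>x\<close> assigns to each chart around \<open>x\<close> a coordinate vector, compatibly with the
  derivatives of the transition maps (and 0 to all other pairs, so that equality is equality of
  tangent vectors).
\<close>

type_synonym ('a, 'e) tvec = "('a, 'e) chart \<Rightarrow> 'e"

definition tangent_space ::
  "('a, 'e::real_normed_vector) atlas \<Rightarrow> 'a \<Rightarrow> ('a, 'e) tvec set" where
  "tangent_space A x = {v.
     (\<forall>c. c \<notin> charts_at A x \<longrightarrow> v c = 0) \<and>
     (\<forall>c\<in>charts_at A x. \<forall>d\<in>charts_at A x.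
        v d = frechet_derivative (transition c d) (at (snd c x)) (v c))}"

text \<open>The tangent vector at \<open>x\<close> with coordinates \<open>e\<close> in the chart \<open>c\<close>.\<close>

definition coord_vec ::
  "('a, 'e::real_normed_vector) atlas \<Rightarrow> ('a, 'e) chart \<Rightarrow> 'a \<Rightarrow> 'e \<Rightarrow> ('a, 'e) tvec" where
  "coord_vec A c x e = (\<lambda>d. if d \<in> charts_at A x
     then frechet_derivative (transition c d) (at (snd c x)) e else 0)"

text \<open>The result does not depend on the chart chosen around \<open>x\<close>.\<close>

definition differential ::
  "('a, 'e::real_normed_vector) atlas \<Rightarrow> ('b, 'h::real_normed_vector) atlas \<Rightarrow>
   ('a \<Rightarrow> 'b) \<Rightarrow> 'a \<Rightarrow> ('a, 'e) tvec \<Rightarrow> ('b, 'h) tvec" where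
  "differential A B f x v = (let c = (SOME c. c \<in> charts_at A x) in
     (\<lambda>d. if d \<in> charts_at B (f x)
       then frechet_derivative (snd d \<circ> f \<circ> chart_inv c) (at (snd c x)) (v c) else 0))"

definition ker_differential ::
  "('a, 'e::real_normed_vector) atlas \<Rightarrow> ('b, 'h::real_normed_vector) atlas \<Rightarrow>
   ('a \<Rightarrow> 'b) \<Rightarrow> 'a \<Rightarrow> ('a, 'e) tvec set" where
  "ker_differential A B f x = {v \<in> tangent_space A x. differential A B f x v = 0}"

section \<open>Differential forms\<close>

text \<open>
  A \<open>k\<close>-form evaluates at a point \<open>x\<close> on lists of \<open>k\<close> tangent vectors at \<open>x\<close>. A form on an open
  set \<open>W\<close> is constrained only at points of \<open>W\<close> and on such lists; all other values are irrelevant,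
  so that a form on \<open>W\<close> is literally also a form on every smaller open set.
\<close>

type_synonym ('a, 'e) dform = "'a \<Rightarrow> ('a, 'e) tvec list \<Rightarrow> real"

definition tvecs :: "('a, 'e::real_normed_vector) atlas \<Rightarrow> nat \<Rightarrow> 'a \<Rightarrow> ('a, 'e) tvec list set" where
  "tvecs A k x = {vs. length vs = k \<and> set vs \<subseteq> tangent_space A x}"

definition alternating_at ::
  "('a, 'e::real_normed_vector) atlas \<Rightarrow> nat \<Rightarrow> 'a \<Rightarrow> (('a, 'e) tvec list \<Rightarrow> real) \<Rightarrow> bool" where
  "alternating_at A k x \<alpha> \<longleftrightarrow>
     (\<forall>vs\<in>tvecs A k x. \<forall>i<k. \<forall>v\<in>tangent_space A x. \<forall>w\<in>tangent_space A x. \<forall>r.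
        \<alpha> (vs[i := v + w]) = \<alpha> (vs[i := v]) + \<alpha> (vs[i := w]) \<and>
        \<alpha> (vs[i := r *\<^sub>R v]) = r * \<alpha> (vs[i := v])) \<and>
     (\<forall>vs\<in>tvecs A k x. \<forall>i<k. \<forall>j<k. i \<noteq> j \<and> vs ! i = vs ! j \<longrightarrow> \<alpha> vs = 0)"

text \<open>The coordinate expression of a form in a chart.\<close>

definition local_rep ::
  "('a, 'e::real_normed_vector) atlas \<Rightarrow> ('a, 'e) chart \<Rightarrow> ('a, 'e) dform \<Rightarrow>
   'e \<Rightarrow> 'e list \<Rightarrow> real" where
  "local_rep A c \<omega> u es = \<omega> (chart_inv c u) (map (coord_vec A c (chart_inv c u)) es)"

definition smooth_form ::
  "('a, 'e::real_normed_vector) atlas \<Rightarrow> nat \<Rightarrow> 'a set \<Rightarrow> ('a, 'e) dform \<Rightarrow> bool" where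
  "smooth_form A k W \<omega> \<longleftrightarrow> (\<forall>x\<in>W. alternating_at A k x (\<omega> x)) \<and>
     (\<forall>c\<in>A. \<forall>es. length es = k \<longrightarrow> smooth_on (snd c ` (fst c \<inter> W)) (\<lambda>u. local_rep A c \<omega> u es))"

definition forms_agree ::
  "('a, 'e::real_normed_vector) atlas \<Rightarrow> nat \<Rightarrow> 'a set \<Rightarrow> ('a, 'e) dform \<Rightarrow> ('a, 'e) dform \<Rightarrow> bool" where
  "forms_agree A k W \<omega> \<theta> \<longleftrightarrow> (\<forall>x\<in>W. \<forall>vs\<in>tvecs A k x. \<omega> x vs = \<theta> x vs)"

definition euclidean_ext_deriv ::
  "('e::real_normed_vector \<Rightarrow> 'e list \<Rightarrow> real) \<Rightarrow> 'e \<Rightarrow> 'e list \<Rightarrow> real" where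
  "euclidean_ext_deriv \<alpha> u es = (\<Sum>i<length es.
     (-1) ^ i * frechet_derivative (\<lambda>y. \<alpha> y (take i es @ drop (Suc i) es)) (at u) (es ! i))"

text \<open>As for the differential, the result does not depend on the chart chosen around \<open>x\<close>.\<close>

definition ext_deriv ::
  "('a, 'e::real_normed_vector) atlas \<Rightarrow> ('a, 'e) dform \<Rightarrow> ('a, 'e) dform" where
  "ext_deriv A \<omega> = (\<lambda>x vs. let c = (SOME c. c \<in> charts_at A x) in
     euclidean_ext_deriv (local_rep A c \<omega>) (snd c x) (map (\<lambda>v. v c) vs))"

definition closed_form ::
  "('a, 'e::real_normed_vector) atlas \<Rightarrow> nat \<Rightarrow> 'a set \<Rightarrow> ('a, 'e) dform \<Rightarrow> bool" where
  "closed_form A k W \<omega> \<longleftrightarrow>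
     smooth_form A k W \<omega> \<and> forms_agree A (Suc k) W (ext_deriv A \<omega>) (\<lambda>x vs. 0)"

definition exact_form ::
  "('a, 'e::real_normed_vector) atlas \<Rightarrow> nat \<Rightarrow> 'a set \<Rightarrow> ('a, 'e) dform \<Rightarrow> bool" where
  "exact_form A k W \<omega> \<longleftrightarrow> (case k of
     0 \<Rightarrow> forms_agree A 0 W \<omega> (\<lambda>x vs. 0)
   | Suc j \<Rightarrow> (\<exists>\<alpha>. smooth_form A j W \<alpha> \<and> forms_agree A k W \<omega> (ext_deriv A \<alpha>)))"

definition pullback ::
  "('a, 'e::real_normed_vector) atlas \<Rightarrow> ('b, 'h::real_normed_vector) atlas \<Rightarrow>
   ('a \<Rightarrow> 'b) \<Rightarrow> ('b, 'h) dform \<Rightarrow> ('a, 'e) dform" where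
  "pullback A B f \<omega> = (\<lambda>x vs. \<omega> (f x) (map (differential A B f x) vs))"

section \<open>De Rham cohomology of open subsets\<close>

definition cohomologous ::
  "('a, 'e::real_normed_vector) atlas \<Rightarrow> nat \<Rightarrow> 'a set \<Rightarrow> (('a, 'e) dform \<times> ('a, 'e) dform) set" where
  "cohomologous A k W = {(\<omega>, \<theta>). closed_form A k W \<omega> \<and> closed_form A k W \<theta> \<and>
     exact_form A k W (\<lambda>x vs. \<omega> x vs - \<theta> x vs)}"

definition de_rham ::
  "('a, 'e::real_normed_vector) atlas \<Rightarrow> nat \<Rightarrow> 'a set \<Rightarrow> ('a, 'e) dform set set" where
  "de_rham A k W = {\<omega>. closed_form A k W \<omega>} // cohomologous A k W"

definition de_rham_class ::
  "('a, 'e::real_normed_vector) atlas \<Rightarrow> nat \<Rightarrow> 'a set \<Rightarrow> ('a, 'e) dform \<Rightarrow> ('a, 'e) dform set" where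
  "de_rham_class A k W \<omega> = cohomologous A k W `` {\<omega>}"

text \<open>
  Restriction to an open subset \<open>V\<close> of the set on which the class \<open>c\<close> lives: the elements of \<open>c\<close>
  are also closed forms on \<open>V\<close>, and they all lie in a single class over \<open>V\<close>.
\<close>

definition de_rham_restrict ::
  "('a, 'e::real_normed_vector) atlas \<Rightarrow> nat \<Rightarrow> 'a set \<Rightarrow> ('a, 'e) dform set \<Rightarrow> ('a, 'e) dform set" where
  "de_rham_restrict A k V c = cohomologous A k V `` c"

section \<open>Symplectic forms, almost-complex structures and tameness\<close>

definition symplectic_form ::
  "('a, 'e::real_normed_vector) atlas \<Rightarrow> ('a, 'e) dform \<Rightarrow> bool" where
  "symplectic_form A \<omega> \<longleftrightarrow> closed_form A 2 UNIV \<omega> \<and>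
     (\<forall>x. \<forall>v\<in>tangent_space A x. v \<noteq> 0 \<longrightarrow> (\<exists>w\<in>tangent_space A x. \<omega> x [v, w] \<noteq> 0))"

text \<open>Continuity of \<open>J\<close> is continuity on the total space of the tangent bundle, read in charts.\<close>

definition almost_complex ::
  "('a, 'e::real_normed_vector) atlas \<Rightarrow> ('a \<Rightarrow> ('a, 'e) tvec \<Rightarrow> ('a, 'e) tvec) \<Rightarrow> bool" where
  "almost_complex A J \<longleftrightarrow>
     (\<forall>x. \<forall>v\<in>tangent_space A x. J x v \<in> tangent_space A x \<and> J x (J x v) = - v \<and>
        (\<forall>w\<in>tangent_space A x. J x (v + w) = J x v + J x w) \<and>
        (\<forall>r. J x (r *\<^sub>R v) = r *\<^sub>R J x v)) \<and>
     (\<forall>c\<in>A. continuous_on (snd c ` fst c \<times> UNIV)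
        (\<lambda>(u, e). J (chart_inv c u) (coord_vec A c (chart_inv c u) e) c))"

definition tame_along ::
  "('a, 'e::real_normed_vector) atlas \<Rightarrow> ('b, 'h::real_normed_vector) atlas \<Rightarrow> ('a \<Rightarrow> 'b) \<Rightarrow>
   ('b, 'h) dform \<Rightarrow> ('a \<Rightarrow> ('a, 'e) tvec \<Rightarrow> ('a, 'e) tvec) \<Rightarrow> bool" where
  "tame_along A B f \<omega> J \<longleftrightarrow>
     (\<forall>x. \<forall>v \<in> tangent_space A x - ker_differential A B f x. pullback A B f \<omega> x [v, J x v] > 0)"

definition tames_at ::
  "('a, 'e::zero) dform \<Rightarrow> ('a \<Rightarrow> ('a, 'e) tvec \<Rightarrow> ('a, 'e) tvec) \<Rightarrow>
   'a \<Rightarrow> ('a, 'e) tvec set \<Rightarrow> bool" where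
  "tames_at \<eta> J x V \<longleftrightarrow> (\<forall>v\<in>V. v \<noteq> 0 \<longrightarrow> \<eta> x [v, J x v] > 0)"

definition tames_over ::
  "('a, 'e::real_normed_vector) atlas \<Rightarrow> ('a, 'e) dform \<Rightarrow>
   ('a \<Rightarrow> ('a, 'e) tvec \<Rightarrow> ('a, 'e) tvec) \<Rightarrow> 'a set \<Rightarrow> bool" where
  "tames_over A \<eta> J S \<longleftrightarrow> (\<forall>x\<in>S. tames_at \<eta> J x (tangent_space A x))"

end

theory Submission
  imports Defs
begin

text \<open>
  Fix a closed form \<open>\<zeta>\<close> representing \<open>c\<close>. Over \<open>W\<^sub>y\<close> one has \<open>\<eta>\<^sub>y = \<zeta> + d\<alpha>\<^sub>y\<close>. The surjectivity on
  \<open>H\<^sup>1\<close> and a cutoff function allow one to change the primitives \<open>\<alpha>\<^sub>y\<close>, without changing \<open>d\<alpha>\<^sub>y\<close>, so that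
  they all agree near \<open>C\<close>. Since \<open>X - int C\<close> is compact, each \<open>y\<close> has a neighborhood whose preimage
  lies in \<open>W\<^sub>y\<close>, and finitely many such neighborhoods cover the image of \<open>X - int C\<close>. The primitives are
  glued by bump functions pulled back from \<open>Y\<close>: their differentials vanish on \<open>ker df\<close>, so there the
  glued form \<open>\<eta> = \<zeta> + d\<gamma>\<close> is a convex combination of the \<open>\<eta>\<^sub>y\<close> and tames \<open>J\<close>. Finally, where
  \<open>\<eta>(v, Jv) \<le> 0\<close> on the unit sphere bundle over \<open>X - int C\<close>, \<open>f\<^sup>*\<omega>\<^sub>Y(v, Jv)\<close> has a positive
  minimum, which bounds the admissible \<open>t\<close>.
\<close>

section \<open>Smooth maps between open subsets of the model spaces\<close>

text \<open>The forms \<open>\<eta>\<^sub>y\<close> cannot be averaged directly, since nonconstant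
  coefficients destroy closedness. Averaging primitives keeps closedness and the class, at the price
  of terms \<open>d(b \<circ> f) \<and> (\<alpha> - \<beta>)\<close>. These are invisible on
  \<open>ker df\<close> but not on all of \<open>TX\<close>. Near \<open>C\<close>, where
  \<open>\<eta>\<close> has to equal \<open>\<eta>\<^sub>C\<close> on all vectors, they can only be
  removed by making the primitives themselves coincide; equal differentials do not suffice. Two
  primitives with equal differentials differ by a closed 1-form, and it is this form that
  \<open>H\<^sup>1\<close> has to absorb. Nothing about \<open>J\<close> beyond continuity may be
  used, so its values enter only through pointwise positivity and compactness. Forms of degree at
  most 2 are enough: naturality of \<open>d\<close> is proved on forms of degree 0, 1 and 2 (the
  last makes \<open>f\<^sup>*\<omega>\<^sub>Y\<close> closed), and \<open>d \<circ> d = 0\<close> in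
  degrees 0 and 1. This accounts for the bounds \<open>k \<le> 2\<close> and
  \<open>k \<le> 1\<close>, under which each degree is computed by hand on explicit argument
  lists.\<close>

lemma orthogonal_expansion_exists:
  "\<exists>B :: 'e::{real_inner, heine_borel} set. finite B \<and>
     (\<forall>x. x = (\<Sum>b\<in>B. ((x \<bullet> b) / (b \<bullet> b)) *\<^sub>R b))"
proof -
  obtain B0 :: "'e set" where B0: "finite B0" "span B0 = UNIV"
    using heine_borel_finite_dimensional by blast
  obtain B :: "'e set" where B: "finite B" "span B = UNIV" "pairwise orthogonal B"
    using basis_orthogonal[OF B0(1)] B0(2) by metis
  have "x = (\<Sum>b\<in>B. ((x \<bullet> b) / (b \<bullet> b)) *\<^sub>R b)" for x
  proof -
    define y where "y = x - (\<Sum>b\<in>B. ((x \<bullet> b) / (b \<bullet> b)) *\<^sub>R b)"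
    have "orthogonal y a" if "a \<in> B" for a
    proof -
      have "(\<Sum>b\<in>B. ((x \<bullet> b) / (b \<bullet> b)) *\<^sub>R b) \<bullet> a = (\<Sum>b\<in>B. ((x \<bullet> b) / (b \<bullet> b)) * (b \<bullet> a))"
        by (simp add: inner_sum_left)
      also have "\<dots> = (\<Sum>b\<in>B. if b = a then x \<bullet> a else 0)"
        using B(3) that by (intro sum.cong) (auto simp: pairwise_def orthogonal_def)
      also have "\<dots> = x \<bullet> a" using that B(1) by simp
      finally show ?thesis by (simp add: y_def orthogonal_def inner_diff_left)
    qed
    then have "orthogonal y y"
      using orthogonal_to_span[of y B y] B(2) by (simp add: orthogonal_commute)
    then show ?thesis by (simp add: y_def orthogonal_def)
  qed
  then show ?thesis using B(1) by blast
qed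

text \<open>Only the expansion is recorded: its coefficients are linear functionals, which is what
  the later sums over coordinates use. A zero vector in the set is harmless, because its coefficient
  is 0 / 0 = 0.\<close>

definition basis_set :: "'e::{real_inner, heine_borel} set" where
  "basis_set = (SOME B. finite B \<and> (\<forall>x. x = (\<Sum>b\<in>B. ((x \<bullet> b) / (b \<bullet> b)) *\<^sub>R b)))"

definition coef :: "'e::real_inner \<Rightarrow> 'e \<Rightarrow> real" where
  "coef b x = (x \<bullet> b) / (b \<bullet> b)"

lemma finite_basis_set [simp]: "finite (basis_set :: 'e::{real_inner, heine_borel} set)"
  and basis_expansion: "(\<Sum>b\<in>basis_set. coef b x *\<^sub>R b) = (x :: 'e::{real_inner, heine_borel})"
proof -
  have "finite (basis_set :: 'e set) \<and> (\<forall>x::'e. x = (\<Sum>b\<in>basis_set. ((x \<bullet> b) / (b \<bullet> b)) *\<^sub>R b))"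
    unfolding basis_set_def by (rule someI_ex[OF orthogonal_expansion_exists])
  then show "finite (basis_set :: 'e set)" "(\<Sum>b\<in>basis_set. coef b x *\<^sub>R b) = x"
    by (auto simp: coef_def)
qed

lemma bounded_linear_coef: "bounded_linear (coef b)"
  unfolding coef_def
  by (intro bounded_linear_compose[OF bounded_linear_divide] bounded_linear_inner_left)

lemma linear_basis_expansion:
  assumes "linear (L :: 'e::{real_inner, heine_borel} \<Rightarrow> 'f::real_vector)"
  shows "L x = (\<Sum>b\<in>basis_set. coef b x *\<^sub>R L b)"
  by (metis (no_types, lifting) assms basis_expansion linear_cmul linear_sum sum.cong)

text \<open>Both sides are choices from the same set of candidate derivatives, so the equation also
  covers points where neither function is differentiable. This makes \<open>d\<close> local even for
  forms with arbitrary values.\<close>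

lemma frechet_derivative_cong_open:
  assumes "open S" "x \<in> S" "\<And>y. y \<in> S \<Longrightarrow> f y = g y"
  shows "frechet_derivative f (at x) = frechet_derivative g (at x)"
  unfolding frechet_derivative_def
  using has_derivative_transform_within_open[OF _ assms(1,2)] assms(3)
  by (metis (no_types, opaque_lifting))

lemma differentiable_cong_open:
  assumes "open S" "x \<in> S" "\<And>y. y \<in> S \<Longrightarrow> f y = g y" "f differentiable (at x)"
  shows "g differentiable (at x)"
  using has_derivative_transform_within_open[OF _ assms(1,2)] assms(3,4)
  by (metis differentiable_def)

lemma has_frechet_derivative:
  "f differentiable (at x) \<Longrightarrow> (f has_derivative frechet_derivative f (at x)) (at x)"
  by (rule iffD1[OF frechet_derivative_works])

lemma has_derivative_imp_eq:
  "(f has_derivative D) (at x) \<Longrightarrow> frechet_derivative f (at x) = D"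
  by (metis frechet_derivative_at)

section \<open>Closure properties of \<open>C^k\<close> and smooth maps\<close>

lemma ck_on_cong:
  assumes "open S" "\<And>x. x \<in> S \<Longrightarrow> f x = g x" "ck_on k S f"
  shows "ck_on k S g"
  using assms(2,3)
proof (induction k arbitrary: f g)
  case 0
  then show ?case by (simp cong: continuous_on_cong)
next
  case (Suc k)
  have "g differentiable (at x)" if "x \<in> S" for x
    using differentiable_cong_open[OF assms(1) that Suc.prems(1)] Suc.prems(2) that by auto
  moreover have "ck_on k S (\<lambda>x. frechet_derivative g (at x) v)" for v
  proof (rule Suc.IH)
    show "ck_on k S (\<lambda>x. frechet_derivative f (at x) v)" using Suc.prems by simp
    show "frechet_derivative f (at x) v = frechet_derivative g (at x) v" if "x \<in> S" for x
      using frechet_derivative_cong_open[OF assms(1) that Suc.prems(1)] by auto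
  qed
  ultimately show ?case by simp
qed

lemma ck_on_subset: "ck_on k S f \<Longrightarrow> T \<subseteq> S \<Longrightarrow> ck_on k T f"
  by (induction k arbitrary: f) (auto intro: continuous_on_subset)

lemma ck_on_local:
  assumes "\<And>x. x \<in> S \<Longrightarrow> \<exists>U. open U \<and> x \<in> U \<and> ck_on k U f"
  shows "ck_on k S f"
  using assms
proof (induction k arbitrary: f)
  case 0
  then show ?case
    unfolding ck_on.simps
    by (metis continuous_at_imp_continuous_on continuous_on_eq_continuous_at)
next
  case (Suc k)
  have "\<forall>x\<in>S. f differentiable (at x)"
    using Suc.prems by fastforce
  moreover have "ck_on k S (\<lambda>x. frechet_derivative f (at x) v)" for v
    using Suc.prems by (intro Suc.IH) fastforce
  ultimately show ?case by simp
qed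

lemma ck_on_Suc_imp: "ck_on (Suc k) S f \<Longrightarrow> ck_on k S f"
proof (induction k arbitrary: f)
  case 0
  then show ?case
    by (auto intro!: continuous_at_imp_continuous_on differentiable_imp_continuous_within)
next
  case (Suc k)
  then show ?case by (metis ck_on.simps(2))
qed

lemma ck_on_const: "ck_on k S (\<lambda>x. c)"
  by (induction k arbitrary: c) auto

lemma ck_on_bounded_linear: "bounded_linear f \<Longrightarrow> ck_on k S f"
proof (induction k)
  case 0
  then show ?case by (simp add: linear_continuous_on)
next
  case (Suc k)
  have "frechet_derivative f (at x) = f" for x
    using Suc.prems by (simp add: has_derivative_imp_eq bounded_linear_imp_has_derivative)
  then show ?case using Suc.prems
    by (auto simp: ck_on_const bounded_linear_imp_differentiable)
qed

lemma ck_on_add: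
  "open S \<Longrightarrow> ck_on k S f \<Longrightarrow> ck_on k S g \<Longrightarrow> ck_on k S (\<lambda>x. f x + g x)"
proof (induction k arbitrary: f g)
  case 0
  then show ?case by (auto intro: continuous_on_add)
next
  case (Suc k)
  have "ck_on k S (\<lambda>x. frechet_derivative (\<lambda>x. f x + g x) (at x) v)" for v
  proof (rule ck_on_cong)
    show "ck_on k S (\<lambda>x. frechet_derivative f (at x) v + frechet_derivative g (at x) v)"
      using Suc by simp
    show "frechet_derivative f (at x) v + frechet_derivative g (at x) v =
        frechet_derivative (\<lambda>x. f x + g x) (at x) v" if "x \<in> S" for x
      using Suc.prems that
      by (simp add: has_derivative_imp_eq[OF has_derivative_add[OF has_frechet_derivative has_frechet_derivative]])
  qed (use Suc in auto)
  then show ?case using Suc.prems by simp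
qed

lemma ck_on_sum:
  "open S \<Longrightarrow> (\<And>i. i \<in> I \<Longrightarrow> ck_on k S (f i)) \<Longrightarrow> ck_on k S (\<lambda>x. \<Sum>i\<in>I. f i x)"
  by (induction I rule: infinite_finite_induct) (auto simp: ck_on_const ck_on_add)

lemma ck_on_bilinear:
  assumes "bounded_bilinear p" "open S"
  shows "ck_on k S f \<Longrightarrow> ck_on k S g \<Longrightarrow> ck_on k S (\<lambda>x. p (f x) (g x))"
proof (induction k arbitrary: f g)
  case 0
  then show ?case by (auto intro: bounded_bilinear.continuous_on[OF assms(1)])
next
  case (Suc k)
  have d: "((\<lambda>x. p (f x) (g x)) has_derivative
      (\<lambda>h. p (f x) (frechet_derivative g (at x) h) + p (frechet_derivative f (at x) h) (g x))) (at x)"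
    if "x \<in> S" for x
    using Suc.prems that by (intro bounded_bilinear.FDERIV[OF assms(1)] has_frechet_derivative) auto
  have "ck_on k S (\<lambda>x. frechet_derivative (\<lambda>x. p (f x) (g x)) (at x) v)" for v
  proof (rule ck_on_cong)
    show "ck_on k S (\<lambda>x. p (f x) (frechet_derivative g (at x) v) +
        p (frechet_derivative f (at x) v) (g x))"
      using Suc.prems ck_on_Suc_imp[OF Suc.prems(1)] ck_on_Suc_imp[OF Suc.prems(2)]
      by (intro ck_on_add assms(2) Suc.IH) auto
    show "p (f x) (frechet_derivative g (at x) v) + p (frechet_derivative f (at x) v) (g x) =
        frechet_derivative (\<lambda>x. p (f x) (g x)) (at x) v" if "x \<in> S" for x
      using has_derivative_imp_eq[OF d[OF that]] by simp
  qed (use assms in auto)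
  then show ?case using d unfolding ck_on.simps differentiable_def by blast
qed

text \<open>In the chain rule the direction in which \<open>f\<close> is differentiated varies with
  \<open>x\<close>, whereas the induction hypothesis concerns fixed directions. Expanding that
  direction in \<open>basis_set\<close> leaves a finite sum of products; this is why the middle
  space must be finite-dimensional.\<close>

lemma ck_on_compose:
  fixes g :: "'e::real_normed_vector \<Rightarrow> 'h::{real_inner, heine_borel}"
  assumes "open S" "open T" "g ` S \<subseteq> T"
  shows "ck_on k T f \<Longrightarrow> ck_on k S g \<Longrightarrow> ck_on k S (\<lambda>x. f (g x))"
proof (induction k arbitrary: f)
  case 0
  then show ?case using assms by (auto intro: continuous_on_compose2)
next
  case (Suc k)
  have dg: "(g has_derivative frechet_derivative g (at x)) (at x)"
    and df: "(f has_derivative frechet_derivative f (at (g x))) (at (g x))" if "x \<in> S" for x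
    using Suc.prems that assms by (auto intro!: has_frechet_derivative)
  have d: "((\<lambda>x. f (g x)) has_derivative
      (\<lambda>h. frechet_derivative f (at (g x)) (frechet_derivative g (at x) h))) (at x)"
    if "x \<in> S" for x
    using has_derivative_compose[OF dg[OF that] df[OF that]] .
  have "ck_on k S (\<lambda>x. frechet_derivative (\<lambda>x. f (g x)) (at x) v)" for v
  proof (rule ck_on_cong)
    show "ck_on k S (\<lambda>x. \<Sum>b\<in>basis_set. coef b (frechet_derivative g (at x) v) *\<^sub>R
        frechet_derivative f (at (g x)) b)"
    proof (intro ck_on_sum ck_on_bilinear[OF bounded_bilinear_scaleR] assms)
      fix b :: 'h
      show "ck_on k S (\<lambda>x. frechet_derivative f (at (g x)) b)"
        using Suc.prems ck_on_Suc_imp[OF Suc.prems(2)] by (intro Suc.IH) auto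
      have c: "coef b y = (1 / (b \<bullet> b)) * (y \<bullet> b)" for y by (simp add: coef_def)
      show "ck_on k S (\<lambda>x. coef b (frechet_derivative g (at x) v))"
        unfolding c
        by (intro ck_on_bilinear[OF bounded_bilinear_mult] ck_on_const assms
            ck_on_bilinear[OF bounded_bilinear_inner]) (use Suc.prems in auto)
    qed
    show "(\<Sum>b\<in>basis_set. coef b (frechet_derivative g (at x) v) *\<^sub>R
        frechet_derivative f (at (g x)) b) = frechet_derivative (\<lambda>x. f (g x)) (at x) v"
      if "x \<in> S" for x
      unfolding has_derivative_imp_eq[OF d[OF that]]
      by (rule linear_basis_expansion[OF has_derivative_linear[OF df[OF that]], symmetric])
  qed (use assms in auto)
  then show ?case using d unfolding ck_on.simps differentiable_def by blast
qed

lemma smooth_on_cong: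
  "open S \<Longrightarrow> smooth_on S f \<Longrightarrow> (\<And>x. x \<in> S \<Longrightarrow> f x = g x) \<Longrightarrow> smooth_on S g"
  unfolding smooth_on_def by (metis ck_on_cong)

lemma smooth_on_subset: "smooth_on S f \<Longrightarrow> T \<subseteq> S \<Longrightarrow> smooth_on T f"
  unfolding smooth_on_def by (metis ck_on_subset)

lemma smooth_on_local:
  "(\<And>x. x \<in> S \<Longrightarrow> \<exists>U. open U \<and> x \<in> U \<and> smooth_on U f) \<Longrightarrow> smooth_on S f"
  unfolding smooth_on_def by (metis ck_on_local)

lemma smooth_on_const [simp]: "smooth_on S (\<lambda>x. c)"
  by (simp add: smooth_on_def ck_on_const)

lemma smooth_on_bounded_linear: "bounded_linear f \<Longrightarrow> smooth_on S f"
  by (simp add: smooth_on_def ck_on_bounded_linear)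

lemma smooth_on_add:
  "open S \<Longrightarrow> smooth_on S f \<Longrightarrow> smooth_on S g \<Longrightarrow> smooth_on S (\<lambda>x. f x + g x)"
  by (simp add: smooth_on_def ck_on_add)

lemma smooth_on_sum:
  "open S \<Longrightarrow> (\<And>i. i \<in> I \<Longrightarrow> smooth_on S (f i)) \<Longrightarrow> smooth_on S (\<lambda>x. \<Sum>i\<in>I. f i x)"
  by (simp add: smooth_on_def ck_on_sum)

lemma smooth_on_bilinear:
  "bounded_bilinear p \<Longrightarrow> open S \<Longrightarrow> smooth_on S f \<Longrightarrow> smooth_on S g \<Longrightarrow>
   smooth_on S (\<lambda>x. p (f x) (g x))"
  by (simp add: smooth_on_def ck_on_bilinear)

lemmas smooth_on_mult = smooth_on_bilinear[OF bounded_bilinear_mult]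

lemma smooth_on_diff:
  fixes f g :: "'e::real_normed_vector \<Rightarrow> real"
  assumes "open S" "smooth_on S f" "smooth_on S g"
  shows "smooth_on S (\<lambda>x. f x - g x)"
  using smooth_on_add[OF assms(1,2) smooth_on_mult[OF assms(1) smooth_on_const assms(3), of "-1"]]
  by simp

lemma smooth_on_compose:
  fixes g :: "'e::real_normed_vector \<Rightarrow> 'h::{real_inner, heine_borel}"
  shows "open S \<Longrightarrow> open T \<Longrightarrow> smooth_on T f \<Longrightarrow> smooth_on S g \<Longrightarrow> g ` S \<subseteq> T \<Longrightarrow>
   smooth_on S (\<lambda>x. f (g x))"
  by (simp add: smooth_on_def ck_on_compose)

lemma smooth_on_frechet_derivative:
  "smooth_on S f \<Longrightarrow> smooth_on S (\<lambda>x. frechet_derivative f (at x) v)"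
  unfolding smooth_on_def by (metis ck_on.simps(2))

lemma smooth_on_differentiable: "smooth_on S f \<Longrightarrow> x \<in> S \<Longrightarrow> f differentiable (at x)"
  unfolding smooth_on_def by (metis ck_on.simps(2))

lemma smooth_on_continuous_on: "smooth_on S f \<Longrightarrow> continuous_on S f"
  unfolding smooth_on_def by (metis ck_on.simps(1))

lemma smooth_on_has_derivative:
  "smooth_on S f \<Longrightarrow> x \<in> S \<Longrightarrow> (f has_derivative frechet_derivative f (at x)) (at x)"
  by (simp add: has_frechet_derivative smooth_on_differentiable)

lemma smooth_on_linear_derivative:
  "smooth_on S f \<Longrightarrow> x \<in> S \<Longrightarrow> linear (frechet_derivative f (at x))"
  by (metis smooth_on_has_derivative has_derivative_linear)

lemma smooth_on_coef:
  "open S \<Longrightarrow> smooth_on S f \<Longrightarrow> smooth_on S (\<lambda>x. coef b (f x))"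
proof -
  assume a: "open S" "smooth_on S f"
  have "smooth_on S (\<lambda>x. (1 / (b \<bullet> b)) * (f x \<bullet> b))"
    by (intro smooth_on_mult smooth_on_bilinear[OF bounded_bilinear_inner] a smooth_on_const)
  then show ?thesis by (simp add: coef_def)
qed

subsection \<open>Symmetry of the second derivative\<close>

text \<open>The mean value theorem is applied twice: in direction \<open>v\<close> to the difference
  of \<open>f\<close> across \<open>s *\<^sub>R w\<close>, then in direction \<open>w\<close> to the
  derivative of \<open>f\<close> along \<open>v\<close>.\<close>

lemma second_difference_mean_value:
  fixes f :: "'e::real_normed_vector \<Rightarrow> real"
  assumes "smooth_on S f" "0 < s"
    and S: "\<And>a b. 0 \<le> a \<Longrightarrow> a \<le> s \<Longrightarrow> 0 \<le> b \<Longrightarrow> b \<le> s \<Longrightarrow> u + a *\<^sub>R v + b *\<^sub>R w \<in> S"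
  shows "\<exists>a b. 0 < a \<and> a < s \<and> 0 < b \<and> b < s \<and>
    f (u + s *\<^sub>R v + s *\<^sub>R w) - f (u + s *\<^sub>R v) - f (u + s *\<^sub>R w) + f u =
    s * s * frechet_derivative (\<lambda>x. frechet_derivative f (at x) v) (at (u + a *\<^sub>R v + b *\<^sub>R w)) w"
proof -
  define g where "g a = f (u + a *\<^sub>R v + s *\<^sub>R w) - f (u + a *\<^sub>R v + 0 *\<^sub>R w)" for a
  have df: "((\<lambda>a. f (u + a *\<^sub>R v + b *\<^sub>R w)) has_real_derivative
      frechet_derivative f (at (u + a *\<^sub>R v + b *\<^sub>R w)) v) (at a)"
    if "0 \<le> a" "a \<le> s" "0 \<le> b" "b \<le> s" for a b
  proof -
    have "((\<lambda>a. u + a *\<^sub>R v + b *\<^sub>R w) has_derivative (\<lambda>h. h *\<^sub>R v)) (at a)"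
      by (auto intro!: derivative_eq_intros)
    from has_derivative_compose[OF this smooth_on_has_derivative[OF assms(1) S[OF that]]]
    show ?thesis unfolding has_field_derivative_def
      by (rule has_derivative_eq_rhs)
        (simp add: fun_eq_iff linear_cmul[OF smooth_on_linear_derivative[OF assms(1) S[OF that]]] mult.commute)
  qed
  have dg: "(g has_real_derivative (frechet_derivative f (at (u + a *\<^sub>R v + s *\<^sub>R w)) v -
      frechet_derivative f (at (u + a *\<^sub>R v + 0 *\<^sub>R w)) v)) (at a)"
    if "0 \<le> a" "a \<le> s" for a
    unfolding g_def by (intro DERIV_diff df that) (use assms in auto)
  obtain a where a: "0 < a" "a < s" "g s - g 0 =
     (s - 0) * (frechet_derivative f (at (u + a *\<^sub>R v + s *\<^sub>R w)) v -
      frechet_derivative f (at (u + a *\<^sub>R v + 0 *\<^sub>R w)) v)"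
    using MVT2[OF assms(2) dg] by auto
  define F where "F x = frechet_derivative f (at x) v" for x
  have sF: "smooth_on S F" unfolding F_def using assms(1) by (rule smooth_on_frechet_derivative)
  have dF: "((\<lambda>b. F (u + a *\<^sub>R v + b *\<^sub>R w)) has_real_derivative
      frechet_derivative F (at (u + a *\<^sub>R v + b *\<^sub>R w)) w) (at b)"
    if "0 \<le> b" "b \<le> s" for b
  proof -
    have m: "u + a *\<^sub>R v + b *\<^sub>R w \<in> S" using S that a by auto
    have "((\<lambda>b. u + a *\<^sub>R v + b *\<^sub>R w) has_derivative (\<lambda>h. h *\<^sub>R w)) (at b)"
      by (auto intro!: derivative_eq_intros)
    from has_derivative_compose[OF this smooth_on_has_derivative[OF sF m]]
    show ?thesis unfolding has_field_derivative_def
      by (rule has_derivative_eq_rhs)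
        (simp add: fun_eq_iff linear_cmul[OF smooth_on_linear_derivative[OF sF m]] mult.commute)
  qed
  obtain b where b: "0 < b" "b < s" "F (u + a *\<^sub>R v + s *\<^sub>R w) - F (u + a *\<^sub>R v + 0 *\<^sub>R w) =
     (s - 0) * frechet_derivative F (at (u + a *\<^sub>R v + b *\<^sub>R w)) w"
    using MVT2[OF assms(2) dF] by auto
  show ?thesis
    using a b unfolding F_def g_def
    by (intro exI[of _ a] exI[of _ b]) (simp add: algebra_simps)
qed

text \<open>The second difference is symmetric in \<open>v\<close> and \<open>w\<close>. Hence each
  small parallelogram contains points at which the two mixed derivatives take equal values, and
  continuity passes to the limit at \<open>u\<close>.\<close>

lemma symmetric_second_derivative_real:
  fixes f :: "'e::real_normed_vector \<Rightarrow> real"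
  assumes S: "open S" "u \<in> S" and f: "smooth_on S f"
  shows "frechet_derivative (\<lambda>x. frechet_derivative f (at x) v) (at u) w =
    frechet_derivative (\<lambda>x. frechet_derivative f (at x) w) (at u) v"
proof -
  define P where "P = (\<lambda>v w x. frechet_derivative (\<lambda>x. frechet_derivative f (at x) v) (at x) w)"
  have cP: "isCont (P v w) u" for v w
    unfolding P_def using S smooth_on_continuous_on[OF
        smooth_on_frechet_derivative[OF smooth_on_frechet_derivative[OF f]]]
    by (simp add: continuous_on_eq_continuous_at)
  obtain r where r: "r > 0" "ball u r \<subseteq> S" using S openE by blast
  \<comment> \<open>The first factor keeps the parallelogram of side \<open>s n\<close> inside the
    ball of radius \<open>r\<close>, with the 1 covering the case \<open>v = w = 0\<close>; the
    second makes it shrink to \<open>u\<close>.\<close>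
  define s where "s n = r / (norm v + norm w + 1) * (1 / (real n + 2))" for n :: nat
  have nn: "norm v + norm w + 1 > 0" by (smt (verit) norm_ge_zero)
  have s0: "s n > 0" for n unfolding s_def using r nn by simp
  have sl: "s n * (norm v + norm w) < r * (1 / (real n + 2))" for n
  proof -
    have "s n * (norm v + norm w) < s n * (norm v + norm w + 1)"
      using s0[of n] by (simp add: algebra_simps)
    then show ?thesis using nn by (simp add: s_def)
  qed
  have near: "norm (a *\<^sub>R v + b *\<^sub>R w) < r * (1 / (real n + 2))"
    if "0 \<le> a" "a \<le> s n" "0 \<le> b" "b \<le> s n" for a b n
  proof -
    have "norm (a *\<^sub>R v + b *\<^sub>R w) \<le> a * norm v + b * norm w"
      using norm_triangle_ineq[of "a *\<^sub>R v" "b *\<^sub>R w"] that by simp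
    also have "\<dots> \<le> s n * (norm v + norm w)"
      using that by (simp add: distrib_left add_mono mult_right_mono)
    finally show ?thesis using sl[of n] by linarith
  qed
  have inS: "u + a *\<^sub>R v + b *\<^sub>R w \<in> S" if "0 \<le> a" "a \<le> s n" "0 \<le> b" "b \<le> s n" for a b n
  proof -
    have "r * (1 / (real n + 2)) \<le> r" using r(1) by (simp add: field_simps)
    moreover have "dist u (u + a *\<^sub>R v + b *\<^sub>R w) = norm (a *\<^sub>R v + b *\<^sub>R w)"
      by (metis add.assoc add_diff_cancel_left' dist_commute dist_norm)
    ultimately have "dist u (u + a *\<^sub>R v + b *\<^sub>R w) < r"
      using near[OF that] by linarith
    then show ?thesis using r by auto
  qed
  have inS': "u + a *\<^sub>R w + b *\<^sub>R v \<in> S" if "0 \<le> a" "a \<le> s n" "0 \<le> b" "b \<le> s n" for a b n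
    using inS[OF that(3,4,1,2)] by (simp add: add.assoc add.commute[of "a *\<^sub>R w"])
  have ex: "\<exists>p. (0 < fst p \<and> fst p < s n \<and> 0 < snd p \<and> snd p < s n) \<and>
      f (u + s n *\<^sub>R v + s n *\<^sub>R w) - f (u + s n *\<^sub>R v) - f (u + s n *\<^sub>R w) + f u =
      s n * s n * P v w (u + fst p *\<^sub>R v + snd p *\<^sub>R w)" for n
    using second_difference_mean_value[OF f s0 inS, of n] unfolding P_def by force
  then obtain p where p: "\<And>n. (0 < fst (p n) \<and> fst (p n) < s n \<and> 0 < snd (p n) \<and> snd (p n) < s n) \<and>
      f (u + s n *\<^sub>R v + s n *\<^sub>R w) - f (u + s n *\<^sub>R v) - f (u + s n *\<^sub>R w) + f u =
      s n * s n * P v w (u + fst (p n) *\<^sub>R v + snd (p n) *\<^sub>R w)" by metis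
  have "\<exists>p. (0 < fst p \<and> fst p < s n \<and> 0 < snd p \<and> snd p < s n) \<and>
      f (u + s n *\<^sub>R w + s n *\<^sub>R v) - f (u + s n *\<^sub>R w) - f (u + s n *\<^sub>R v) + f u =
      s n * s n * P w v (u + fst p *\<^sub>R w + snd p *\<^sub>R v)" for n
    using second_difference_mean_value[OF f s0 inS', of n] unfolding P_def by force
  then obtain q where q: "\<And>n. (0 < fst (q n) \<and> fst (q n) < s n \<and> 0 < snd (q n) \<and> snd (q n) < s n) \<and>
      f (u + s n *\<^sub>R w + s n *\<^sub>R v) - f (u + s n *\<^sub>R w) - f (u + s n *\<^sub>R v) + f u =
      s n * s n * P w v (u + fst (q n) *\<^sub>R w + snd (q n) *\<^sub>R v)" by metis
  have eq: "P v w (u + fst (p n) *\<^sub>R v + snd (p n) *\<^sub>R w) = P w v (u + fst (q n) *\<^sub>R w + snd (q n) *\<^sub>R v)" for n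
  proof -
    have "s n * s n * P v w (u + fst (p n) *\<^sub>R v + snd (p n) *\<^sub>R w) =
      s n * s n * P w v (u + fst (q n) *\<^sub>R w + snd (q n) *\<^sub>R v)"
    proof -
      have "u + s n *\<^sub>R w + s n *\<^sub>R v = u + s n *\<^sub>R v + s n *\<^sub>R w" by simp
      then show ?thesis
        using p[of n, THEN conjunct2] q[of n, THEN conjunct2] by (simp only:)
    qed
    then show ?thesis using s0[of n] by simp
  qed
  have z: "(\<lambda>n. r * (1 / (real n + 2))) \<longlonglongrightarrow> 0" by real_asymp
  have lim: "(\<lambda>n. u + a n) \<longlonglongrightarrow> u" if "\<And>n. norm (a n) \<le> r * (1 / (real n + 2))" for a
  proof -
    have "a \<longlonglongrightarrow> 0"
      by (rule Lim_null_comparison[OF _ z]) (simp only: that eventually_True)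
    then show ?thesis using tendsto_add[OF tendsto_const, of a 0 sequentially u] by simp
  qed
  have "(\<lambda>n. u + (fst (p n) *\<^sub>R v + snd (p n) *\<^sub>R w)) \<longlonglongrightarrow> u"
    using near p by (intro lim) (metis less_imp_le)
  then have lp: "(\<lambda>n. P v w (u + fst (p n) *\<^sub>R v + snd (p n) *\<^sub>R w)) \<longlonglongrightarrow> P v w u"
    using isCont_tendsto_compose[OF cP] by (simp add: add.assoc)
  have "(\<lambda>n. u + (snd (q n) *\<^sub>R v + fst (q n) *\<^sub>R w)) \<longlonglongrightarrow> u"
    using near q by (intro lim) (metis less_imp_le)
  then have "(\<lambda>n. P w v (u + (snd (q n) *\<^sub>R v + fst (q n) *\<^sub>R w))) \<longlonglongrightarrow> P w v u"
    using isCont_tendsto_compose[OF cP] by blast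
  then have lq: "(\<lambda>n. P w v (u + fst (q n) *\<^sub>R w + snd (q n) *\<^sub>R v)) \<longlonglongrightarrow> P w v u"
    by (simp add: add.commute add.left_commute)
  have "P v w u = P w v u"
    using LIMSEQ_unique[OF lp] lq eq by auto
  then show ?thesis by (simp add: P_def)
qed

text \<open>The functionals \<open>coef b\<close> are bounded and linear, so they commute with both
  differentiations and reduce the claim to real-valued functions.\<close>

lemma symmetric_second_derivative:
  fixes f :: "'e::real_normed_vector \<Rightarrow> 'h::{real_inner, heine_borel}"
  assumes S: "open S" "u \<in> S" and f: "smooth_on S f"
  shows "frechet_derivative (\<lambda>x. frechet_derivative f (at x) v) (at u) w =
    frechet_derivative (\<lambda>x. frechet_derivative f (at x) w) (at u) v"
proof -
  have c: "coef b (frechet_derivative (\<lambda>x. frechet_derivative f (at x) v) (at u) w) =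
    frechet_derivative (\<lambda>x. frechet_derivative (\<lambda>x. coef b (f x)) (at x) v) (at u) w" for b v w
  proof -
    have 1: "frechet_derivative (\<lambda>x. coef b (f x)) (at x) v = coef b (frechet_derivative f (at x) v)"
      if "x \<in> S" for x v
      using has_derivative_imp_eq[OF bounded_linear.has_derivative[OF bounded_linear_coef
          smooth_on_has_derivative[OF f that]]] by simp
    have "frechet_derivative (\<lambda>x. frechet_derivative (\<lambda>x. coef b (f x)) (at x) v) (at u) =
      frechet_derivative (\<lambda>x. coef b (frechet_derivative f (at x) v)) (at u)"
      using 1 by (intro frechet_derivative_cong_open[OF S]) auto
    moreover have "frechet_derivative (\<lambda>x. coef b (frechet_derivative f (at x) v)) (at u) w = coef b (frechet_derivative (\<lambda>x. frechet_derivative f (at x) v) (at u) w)"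
      using has_derivative_imp_eq[OF bounded_linear.has_derivative[OF bounded_linear_coef
          smooth_on_has_derivative[OF smooth_on_frechet_derivative[OF f] S(2)]]] by simp
    ultimately show ?thesis by simp
  qed
  have "coef b (frechet_derivative (\<lambda>x. frechet_derivative f (at x) v) (at u) w) =
    coef b (frechet_derivative (\<lambda>x. frechet_derivative f (at x) w) (at u) v)" for b
    unfolding c by (intro symmetric_second_derivative_real[OF S] smooth_on_coef S f)
  then show ?thesis by (metis (no_types, lifting) basis_expansion sum.cong)
qed

subsection \<open>A smooth cutoff function on the real line\<close>

text \<open>The polynomial factor is carried along so that the family is closed under
  differentiation; smoothness of all members then follows by one induction.\<close>

definition flat_exp :: "real poly \<Rightarrow> real \<Rightarrow> real" where
  "flat_exp p x = (if x > 0 then poly p (1 / x) * exp (- 1 / x) else 0)"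

text \<open>Under the substitution of \<open>1 / x\<close>, which tends to infinity, this says that
  the exponential outgrows every polynomial.\<close>

lemma flat_exp_tendsto_0: "((\<lambda>x. poly p (1 / x) * exp (- 1 / x)) \<longlongrightarrow> 0) (at_right (0::real))"
proof -
  have "((\<lambda>x::real. poly p x / exp x) \<longlongrightarrow> 0) at_top"
  proof (induction p)
    case 0
    then show ?case by simp
  next
    case (pCons a p)
    have pw: "((\<lambda>x::real. x ^ k / exp x) \<longlongrightarrow> 0) at_top" for k
      by (rule tendsto_power_div_exp_0)
    have "((\<lambda>x::real. (\<Sum>i\<le>degree (pCons a p). coeff (pCons a p) i * (x ^ i / exp x))) \<longlongrightarrow>
        (\<Sum>i\<le>degree (pCons a p). coeff (pCons a p) i * 0)) at_top"
      by (intro tendsto_intros pw)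
    then show ?case by (simp add: poly_altdef sum_divide_distrib)
  qed
  from filterlim_compose[OF this filterlim_inverse_at_top_right]
  show ?thesis by (simp add: exp_minus field_simps)
qed

text \<open>For \<open>x > 0\<close> the factor \<open>[:0,0,1:]\<close> is the
  \<open>1 / x\<^sup>2\<close> that comes from differentiating \<open>1 / x\<close>, both inside
  \<open>p\<close> and inside the exponential.\<close>

lemma flat_exp_has_derivative:
  "(flat_exp p has_real_derivative flat_exp ([:0,0,1:] * (p - pderiv p)) x) (at x)"
proof -
  consider "x > 0" | "x < 0" | "x = 0" by linarith
  then show ?thesis
  proof cases
    case 1
    have d: "((\<lambda>x. poly p (1 / x) * exp (- 1 / x)) has_real_derivative
        flat_exp ([:0,0,1:] * (p - pderiv p)) x) (at x)"
      using 1
      by (auto intro!: derivative_eq_intros poly_DERIV DERIV_chain2[where f="poly p"]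
          simp: flat_exp_def field_simps power2_eq_square)
    have e: "eventually (\<lambda>y. poly p (1 / y) * exp (- 1 / y) = flat_exp p y) (nhds x)"
      using 1 by (intro eventually_mono[OF eventually_nhds_in_open[of "{0<..}"]])
        (auto simp: flat_exp_def)
    show ?thesis using DERIV_cong_ev[OF refl e refl] d by blast
  next
    case 2
    have e: "eventually (\<lambda>y. 0 = flat_exp p y) (nhds x)"
      using 2 by (intro eventually_mono[OF eventually_nhds_in_open[of "{..<0}"]])
        (auto simp: flat_exp_def)
    have "flat_exp ([:0,0,1:] * (p - pderiv p)) x = 0" using 2 by (simp add: flat_exp_def)
    then show ?thesis using DERIV_cong_ev[OF refl e refl, of 0] by simp
  next
    case 3
    have "((\<lambda>h. flat_exp p h / h) \<longlongrightarrow> 0) (at_left 0)"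
      by (rule tendsto_eventually) (auto simp: flat_exp_def eventually_at_filter)
    \<comment> \<open>Division by \<open>h\<close> multiplies the polynomial in \<open>1 / h\<close>
      by its variable, hence the instance \<open>[:0,1:] * p\<close>.\<close>
    moreover have "((\<lambda>h. flat_exp p h / h) \<longlongrightarrow> 0) (at_right 0)"
      using flat_exp_tendsto_0[of "[:0,1:] * p"]
      by (rule Lim_transform_eventually) (auto simp: flat_exp_def eventually_at_filter)
    ultimately have "((\<lambda>h. flat_exp p h / h) \<longlongrightarrow> 0) (at 0)"
      by (simp add: filterlim_split_at)
    then show ?thesis using 3 by (simp add: DERIV_def flat_exp_def)
  qed
qed

lemma smooth_on_flat_exp: "smooth_on S (flat_exp p)"
proof -
  have "ck_on k UNIV (flat_exp p)" for k
  proof (induction k arbitrary: p)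
    case 0
    show ?case
      unfolding ck_on.simps
      by (intro continuous_at_imp_continuous_on ballI DERIV_isCont[OF flat_exp_has_derivative])
  next
    case (Suc k)
    have fd: "frechet_derivative (flat_exp p) (at x) v = flat_exp ([:0,0,1:] * (p - pderiv p)) x * v" for x v
      by (simp only: has_derivative_imp_eq[OF flat_exp_has_derivative[unfolded has_field_derivative_def]])
    have "ck_on k UNIV (\<lambda>x. flat_exp ([:0,0,1:] * (p - pderiv p)) x * v)" for v
      by (intro ck_on_bilinear[OF bounded_bilinear_mult] ck_on_const Suc.IH) simp
    moreover have "flat_exp p differentiable (at x)" for x
      using flat_exp_has_derivative[of p x] unfolding has_field_derivative_def differentiable_def
      by blast
    ultimately show ?case unfolding ck_on.simps fd by blast
  qed
  then show ?thesis by (auto simp: smooth_on_def intro: ck_on_subset)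
qed

lemma ck_on_inverse: "0 \<notin> S \<Longrightarrow> open S \<Longrightarrow> ck_on k S (inverse :: real \<Rightarrow> real)"
proof (induction k)
  case 0
  then show ?case by (auto intro!: continuous_intros)
next
  case (Suc k)
  have d: "(inverse has_derivative (\<lambda>h. - (inverse x * h * inverse x))) (at x)" if "x \<in> S" for x :: real
    using has_derivative_inverse'[of x UNIV] that Suc.prems by auto
  have "ck_on k S (\<lambda>x. frechet_derivative inverse (at x) v)" for v :: real
  proof (rule ck_on_cong)
    show "ck_on k S (\<lambda>x. (- v) * (inverse x * inverse x))"
      using Suc by (intro ck_on_bilinear[OF bounded_bilinear_mult] ck_on_const) auto
    show "(- v) * (inverse x * inverse x) = frechet_derivative inverse (at x) v" if "x \<in> S" for x
      by (simp add: has_derivative_imp_eq[OF d[OF that]])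
  qed (use Suc in auto)
  then show ?case using d by (auto simp: differentiable_def)
qed

text \<open>The values are 1 up to \<open>s = 1\<close> and 0 from \<open>s = 2\<close> on. The
  denominator never vanishes, since \<open>2 - s\<close> and \<open>s - 1\<close> are never both
  nonpositive.\<close>

definition cutoff :: "real \<Rightarrow> real" where
  "cutoff s = flat_exp 1 (2 - s) * inverse (flat_exp 1 (2 - s) + flat_exp 1 (s - 1))"

lemma flat_exp_1_nonneg: "flat_exp 1 x \<ge> 0" and flat_exp_1_pos: "flat_exp 1 x > 0 \<longleftrightarrow> x > 0"
  by (auto simp: flat_exp_def)

lemma cutoff_denominator_pos: "flat_exp 1 (2 - s) + flat_exp 1 (s - 1) > 0"
  using flat_exp_1_nonneg[of "2 - s"] flat_exp_1_nonneg[of "s - 1"]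
    flat_exp_1_pos[of "2 - s"] flat_exp_1_pos[of "s - 1"]
  by (cases "s < 2") auto

lemma cutoff_bounds: "0 \<le> cutoff s" "cutoff s \<le> 1"
  using cutoff_denominator_pos[of s] flat_exp_1_nonneg[of "2 - s"] flat_exp_1_nonneg[of "s - 1"]
  by (auto simp: cutoff_def divide_inverse[symmetric])

lemma cutoff_eq_1: "s \<le> 1 \<Longrightarrow> cutoff s = 1"
  using cutoff_denominator_pos[of s] by (simp add: cutoff_def flat_exp_def)

lemma cutoff_eq_0: "s \<ge> 2 \<Longrightarrow> cutoff s = 0"
  by (simp add: cutoff_def flat_exp_def)

lemma smooth_on_cutoff: "open S \<Longrightarrow> smooth_on S cutoff"
proof -
  assume S: "open S"
  have l: "smooth_on S (\<lambda>s. flat_exp 1 (2 - s))"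
    by (rule smooth_on_compose[OF S open_UNIV smooth_on_flat_exp])
      (auto intro!: smooth_on_diff S smooth_on_bounded_linear[OF bounded_linear_ident])
  have r: "smooth_on S (\<lambda>s. flat_exp 1 (s - 1))"
    by (rule smooth_on_compose[OF S open_UNIV smooth_on_flat_exp])
      (auto intro!: smooth_on_diff S smooth_on_bounded_linear[OF bounded_linear_ident])
  have "smooth_on {0<..} (inverse :: real \<Rightarrow> real)"
    by (simp add: smooth_on_def ck_on_inverse)
  then have "smooth_on S (\<lambda>s. inverse (flat_exp 1 (2 - s) + flat_exp 1 (s - 1)))"
    using cutoff_denominator_pos
    by (intro smooth_on_compose[OF S open_greaterThan[of 0], of inverse]) (auto intro!: smooth_on_add l r S)
  with l S show ?thesis unfolding cutoff_def[abs_def] by (intro smooth_on_mult)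
qed

section \<open>Differential forms on open subsets of the model spaces\<close>

text \<open>The coordinate counterpart of \<open>smooth_form\<close>. Smoothness is asked for
  constant arguments only; multilinearity extends it to arguments that vary with the point.\<close>

definition eform ::
  "nat \<Rightarrow> 'e::real_normed_vector set \<Rightarrow> ('e \<Rightarrow> 'e list \<Rightarrow> real) \<Rightarrow> bool" where
  "eform k S \<alpha> \<longleftrightarrow>
     (\<forall>es. length es = k \<longrightarrow> smooth_on S (\<lambda>u. \<alpha> u es)) \<and>
     (\<forall>u\<in>S. \<forall>es. length es = k \<longrightarrow> (\<forall>i<k. \<forall>v w r.
        \<alpha> u (es[i := v + w]) = \<alpha> u (es[i := v]) + \<alpha> u (es[i := w]) \<and>
        \<alpha> u (es[i := r *\<^sub>R v]) = r * \<alpha> u (es[i := v]))) \<and>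
     (\<forall>u\<in>S. \<forall>es. length es = k \<longrightarrow> (\<forall>i<k. \<forall>j<k. i \<noteq> j \<and> es ! i = es ! j \<longrightarrow> \<alpha> u es = 0))"

definition epull ::
  "('e::real_normed_vector \<Rightarrow> 'h::real_normed_vector) \<Rightarrow> ('h \<Rightarrow> 'h list \<Rightarrow> real) \<Rightarrow>
   'e \<Rightarrow> 'e list \<Rightarrow> real" where
  "epull \<phi> \<alpha> u es = \<alpha> (\<phi> u) (map (frechet_derivative \<phi> (at u)) es)"

lemma length_1_conv: "length xs = Suc 0 \<longleftrightarrow> (\<exists>a. xs = [a])"
  by (auto simp: length_Suc_conv)

lemma length_2_conv: "length xs = Suc (Suc 0) \<longleftrightarrow> (\<exists>a b. xs = [a, b])"
  by (auto simp: length_Suc_conv)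

lemma length_3_conv: "length xs = Suc (Suc (Suc 0)) \<longleftrightarrow> (\<exists>a b c. xs = [a, b, c])"
  by (auto simp: length_Suc_conv)

lemma all_length_1: "(\<forall>es. length es = Suc 0 \<longrightarrow> P es) \<longleftrightarrow> (\<forall>a. P [a])"
  by (auto simp: length_1_conv)

lemma all_length_2: "(\<forall>es. length es = Suc (Suc 0) \<longrightarrow> P es) \<longleftrightarrow> (\<forall>a b. P [a, b])"
  by (auto simp: length_2_conv)

lemma eform_smooth: "eform k S \<alpha> \<Longrightarrow> length es = k \<Longrightarrow> smooth_on S (\<lambda>u. \<alpha> u es)"
  by (simp add: eform_def)

lemma eform_0: "eform 0 S \<alpha> \<longleftrightarrow> smooth_on S (\<lambda>u. \<alpha> u [])"
  by (auto simp: eform_def)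

lemma eform_1: "eform (Suc 0) S \<alpha> \<longleftrightarrow>
    (\<forall>e. smooth_on S (\<lambda>u. \<alpha> u [e])) \<and> (\<forall>u\<in>S. linear (\<lambda>e. \<alpha> u [e]))"
  unfolding eform_def all_length_1 by (simp add: linear_iff) blast

lemma eform_2: "eform (Suc (Suc 0)) S \<alpha> \<longleftrightarrow>
    (\<forall>e f. smooth_on S (\<lambda>u. \<alpha> u [e, f])) \<and>
    (\<forall>u\<in>S. (\<forall>f. linear (\<lambda>e. \<alpha> u [e, f])) \<and> (\<forall>e. linear (\<lambda>f. \<alpha> u [e, f])) \<and> (\<forall>e. \<alpha> u [e, e] = 0))"
  unfolding eform_def all_length_2 by (simp add: linear_iff All_less_Suc) blast

lemma eform_2_antisym:
  assumes "eform (Suc (Suc 0)) S \<alpha>" "u \<in> S"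
  shows "\<alpha> u [e, f] = - \<alpha> u [f, e]"
proof -
  have l: "linear (\<lambda>e. \<alpha> u [e, f])" "linear (\<lambda>f. \<alpha> u [e, f])" "\<alpha> u [e, e] = 0" for e f
    using assms by (auto simp: eform_2)
  have "\<alpha> u [e + f, e + f] = \<alpha> u [e, e] + \<alpha> u [e, f] + (\<alpha> u [f, e] + \<alpha> u [f, f])"
    using linear_add[OF l(1)] linear_add[OF l(2)] by simp
  then show ?thesis using l(3) by simp
qed

lemma eform_subset: "eform k S \<alpha> \<Longrightarrow> T \<subseteq> S \<Longrightarrow> eform k T \<alpha>"
  unfolding eform_def using smooth_on_subset[of S _ T] by blast

lemma eform_cong:
  assumes "open S" "eform k S \<alpha>" "\<And>u es. u \<in> S \<Longrightarrow> length es = k \<Longrightarrow> \<alpha> u es = \<beta> u es"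
  shows "eform k S \<beta>"
  using assms(2) unfolding eform_def
  by (auto simp: assms(3)[symmetric] intro: smooth_on_cong[OF assms(1) _ assms(3)])

lemma eform_local:
  assumes "\<And>u. u \<in> S \<Longrightarrow> \<exists>U. open U \<and> u \<in> U \<and> eform k U \<alpha>"
  shows "eform k S \<alpha>"
proof -
  have "smooth_on S (\<lambda>u. \<alpha> u es)" if "length es = k" for es
    using assms eform_smooth[OF _ that] by (intro smooth_on_local) blast
  moreover have "eform k {u} \<alpha>" if "u \<in> S" for u
    using assms[OF that] eform_subset by blast
  ultimately show ?thesis unfolding eform_def by blast
qed

lemma eform_add:
  assumes "open S" "eform k S \<alpha>" "eform k S \<beta>"
  shows "eform k S (\<lambda>u es. \<alpha> u es + \<beta> u es)"
  using assms unfolding eform_def by (auto simp: distrib_left intro: smooth_on_add)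

lemma eform_mult:
  assumes "open S" "smooth_on S g" "eform k S \<alpha>"
  shows "eform k S (\<lambda>u es. g u * \<alpha> u es)"
  using assms unfolding eform_def by (auto simp: algebra_simps intro: smooth_on_mult)

section \<open>The exterior derivative in coordinates\<close>

lemma euclidean_ext_deriv_0:
  "euclidean_ext_deriv \<alpha> u [e] = frechet_derivative (\<lambda>y. \<alpha> y []) (at u) e"
  by (simp add: euclidean_ext_deriv_def)

lemma euclidean_ext_deriv_1:
  "euclidean_ext_deriv \<alpha> u [e1, e2] =
     frechet_derivative (\<lambda>y. \<alpha> y [e2]) (at u) e1 - frechet_derivative (\<lambda>y. \<alpha> y [e1]) (at u) e2"
  by (simp add: euclidean_ext_deriv_def numeral_2_eq_2)

lemma euclidean_ext_deriv_2:
  "euclidean_ext_deriv \<alpha> u [e1, e2, e3] =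
     frechet_derivative (\<lambda>y. \<alpha> y [e2, e3]) (at u) e1 - frechet_derivative (\<lambda>y. \<alpha> y [e1, e3]) (at u) e2
     + frechet_derivative (\<lambda>y. \<alpha> y [e1, e2]) (at u) e3"
  by (simp add: euclidean_ext_deriv_def numeral_3_eq_3)

lemma euclidean_ext_deriv_cong:
  assumes "open S" "u \<in> S" "length es = Suc k"
    "\<And>y es. y \<in> S \<Longrightarrow> length es = k \<Longrightarrow> \<alpha> y es = \<beta> y es"
  shows "euclidean_ext_deriv \<alpha> u es = euclidean_ext_deriv \<beta> u es"
  unfolding euclidean_ext_deriv_def
  by (intro sum.cong refl arg_cong2[of _ _ _ _ "(*)"] frechet_derivative_cong_open[OF assms(1,2), THEN fun_cong]
      assms(4)) (use assms(3) in auto)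

lemma euclidean_ext_deriv_add:
  assumes "eform k S \<alpha>" "eform k S \<beta>" "u \<in> S" "length es = Suc k"
  shows "euclidean_ext_deriv (\<lambda>u es. \<alpha> u es + \<beta> u es) u es =
    euclidean_ext_deriv \<alpha> u es + euclidean_ext_deriv \<beta> u es"
proof -
  have "frechet_derivative (\<lambda>y. \<alpha> y ds + \<beta> y ds) (at u) e =
      frechet_derivative (\<lambda>y. \<alpha> y ds) (at u) e + frechet_derivative (\<lambda>y. \<beta> y ds) (at u) e"
    if "length ds = k" for ds e
    using has_derivative_imp_eq[OF has_derivative_add[OF
        smooth_on_has_derivative[OF eform_smooth[OF assms(1) that] assms(3)]
        smooth_on_has_derivative[OF eform_smooth[OF assms(2) that] assms(3)]]] by simp
  then show ?thesis
    using assms(4) by (auto simp: euclidean_ext_deriv_def sum.distrib[symmetric] algebra_simps intro!: sum.cong)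
qed

lemma euclidean_ext_deriv_cmult:
  assumes "eform k S \<alpha>" "u \<in> S" "length es = Suc k"
  shows "euclidean_ext_deriv (\<lambda>u es. r * \<alpha> u es) u es = r * euclidean_ext_deriv \<alpha> u es"
proof -
  have "frechet_derivative (\<lambda>y. r * \<alpha> y ds) (at u) e = r * frechet_derivative (\<lambda>y. \<alpha> y ds) (at u) e"
    if "length ds = k" for ds e
    using has_derivative_imp_eq[OF has_derivative_mult_right[OF
        smooth_on_has_derivative[OF eform_smooth[OF assms(1) that] assms(2)]]] by simp
  then show ?thesis
    using assms(3) by (auto simp: euclidean_ext_deriv_def sum_distrib_left algebra_simps intro!: sum.cong)
qed

lemma euclidean_ext_deriv_mult:
  assumes "eform (Suc 0) S \<alpha>" "smooth_on S g" "u \<in> S"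
  shows "euclidean_ext_deriv (\<lambda>u es. g u * \<alpha> u es) u [e, f] =
    frechet_derivative g (at u) e * \<alpha> u [f] - frechet_derivative g (at u) f * \<alpha> u [e]
    + g u * euclidean_ext_deriv \<alpha> u [e, f]"
proof -
  have "frechet_derivative (\<lambda>y. g y * \<alpha> y [f]) (at u) =
      (\<lambda>e. g u * frechet_derivative (\<lambda>y. \<alpha> y [f]) (at u) e + frechet_derivative g (at u) e * \<alpha> u [f])" for f
    by (rule has_derivative_imp_eq, rule has_derivative_mult[OF smooth_on_has_derivative[OF assms(2,3)]
        smooth_on_has_derivative[OF eform_smooth[OF assms(1)] assms(3)]]) simp
  then show ?thesis by (simp add: euclidean_ext_deriv_1 algebra_simps)
qed

text \<open>Linearity of \<open>A y\<close> in its argument survives differentiation in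
  \<open>y\<close>, because derivatives are unique. For a form it makes the derivative of the
  coefficients multilinear again.\<close>

lemma frechet_derivative_linear_family:
  fixes A :: "'e::real_normed_vector \<Rightarrow> 'k::{real_inner, heine_borel} \<Rightarrow> real"
  assumes T: "open T" "u \<in> T" and lin: "\<And>y. y \<in> T \<Longrightarrow> linear (A y)"
    and D: "\<And>w. ((\<lambda>y. A y w) has_derivative D w) (at u)"
  shows "linear (\<lambda>w. D w e)"
proof (rule linearI)
  have "((\<lambda>y. A y (v + w)) has_derivative (\<lambda>e. D v e + D w e)) (at u)" for v w
    using has_derivative_transform_within_open[OF has_derivative_add[OF D[of v] D[of w]] T]
    by (simp add: linear_add[OF lin])
  then show "D (v + w) e = D v e + D w e" for v w
    using has_derivative_unique[OF D] by metis
  have "((\<lambda>y. A y (r *\<^sub>R w)) has_derivative (\<lambda>e. r * D w e)) (at u)" for r w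
    using has_derivative_transform_within_open[OF has_derivative_mult_right[OF D[of w]] T]
    by (simp add: linear_cmul[OF lin])
  then show "D (r *\<^sub>R w) e = r *\<^sub>R D w e" for r w
    using has_derivative_unique[OF D] by (metis real_scaleR_def)
qed

text \<open>A product rule for a form whose argument moves with the point. Differentiability is
  known only for each fixed \<open>w\<close>; the expansion of \<open>g y\<close> in
  \<open>basis_set\<close> reduces it to finitely many ordinary products.\<close>

lemma has_derivative_linear_family:
  fixes A :: "'e::real_normed_vector \<Rightarrow> 'k::{real_inner, heine_borel} \<Rightarrow> real"
  assumes T: "open T" "u \<in> T" and lin: "\<And>y. y \<in> T \<Longrightarrow> linear (A y)"
    and D: "\<And>w. ((\<lambda>y. A y w) has_derivative D w) (at u)"
    and g: "(g has_derivative g') (at u)"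
  shows "((\<lambda>y. A y (g y)) has_derivative (\<lambda>e. D (g u) e + A u (g' e))) (at u)"
proof -
  have ex: "A y w = (\<Sum>b\<in>basis_set. coef b w * A y b)" if "y \<in> T" for y w
    using linear_basis_expansion[OF lin[OF that], of w] by simp
  have Dl: "D w e = (\<Sum>b\<in>basis_set. coef b w * D b e)" for w e
    using linear_basis_expansion[OF frechet_derivative_linear_family[OF T lin D], of w e] by simp
  have "((\<lambda>y. \<Sum>b\<in>basis_set. coef b (g y) * A y b) has_derivative
      (\<lambda>e. \<Sum>b\<in>basis_set. coef b (g u) * D b e + coef b (g' e) * A u b)) (at u)"
    by (intro has_derivative_sum has_derivative_mult D bounded_linear.has_derivative[OF bounded_linear_coef] g)
  then have "((\<lambda>y. A y (g y)) has_derivative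
      (\<lambda>e. \<Sum>b\<in>basis_set. coef b (g u) * D b e + coef b (g' e) * A u b)) (at u)"
    by (rule has_derivative_transform_within_open[OF _ T]) (rule ex[symmetric])
  moreover have "(\<Sum>b\<in>basis_set. coef b (g u) * D b e + coef b (g' e) * A u b) =
      D (g u) e + A u (g' e)" for e
    using Dl[of "g u" e] ex[OF T(2), of "g' e"] by (simp add: sum.distrib)
  ultimately show ?thesis by simp
qed

lemma smooth_on_linear_family:
  fixes A :: "'e::real_normed_vector \<Rightarrow> 'k::{real_inner, heine_borel} \<Rightarrow> real"
  assumes S: "open S" and lin: "\<And>y. y \<in> S \<Longrightarrow> linear (A y)"
    and A: "\<And>w. smooth_on S (\<lambda>y. A y w)" and g: "smooth_on S g"
  shows "smooth_on S (\<lambda>y. A y (g y))"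
proof (rule smooth_on_cong[OF S])
  show "smooth_on S (\<lambda>y. \<Sum>b\<in>basis_set. coef b (g y) * A y b)"
    by (intro smooth_on_sum smooth_on_mult smooth_on_coef S A g)
  show "(\<Sum>b\<in>basis_set. coef b (g y) * A y b) = A y (g y)" if "y \<in> S" for y
    using linear_basis_expansion[OF lin[OF that], of "g y"] by simp
qed

section \<open>Naturality of the exterior derivative, and \<open>d \<circ> d = 0\<close>\<close>

lemma le_2_cases:
  assumes "(k::nat) \<le> 2" obtains "k = 0" | "k = Suc 0" | "k = Suc (Suc 0)"
  using assms by linarith

text \<open>The arguments of the pulled-back form vary with the point through the derivative of
  \<open>\<phi>\<close>, so smoothness comes from \<open>smooth_on_linear_family\<close>, applied to
  one slot at a time.\<close>

lemma eform_epull: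
  fixes \<phi> :: "'e::{real_inner, heine_borel} \<Rightarrow> 'h::{real_inner, heine_borel}"
  assumes "k \<le> 2" "eform k T \<alpha>" "open S" "open T" "smooth_on S \<phi>" "\<phi> ` S \<subseteq> T"
  shows "eform k S (epull \<phi> \<alpha>)"
proof -
  have sm: "smooth_on S (\<lambda>y. \<alpha> (\<phi> y) es)" if "length es = k" for es
    using smooth_on_compose[OF assms(3,4) eform_smooth[OF assms(2) that] assms(5,6)] .
  have sD: "smooth_on S (\<lambda>y. frechet_derivative \<phi> (at y) e)" for e
    using assms by (simp add: smooth_on_frechet_derivative)
  have lD: "linear (frechet_derivative \<phi> (at y))" if "y \<in> S" for y
    using assms that by (simp add: smooth_on_linear_derivative)
  have mem: "\<phi> y \<in> T" if "y \<in> S" for y using assms that by auto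
  show ?thesis
    using assms(1)
  proof (cases rule: le_2_cases)
    case 1
    then show ?thesis using sm by (simp add: eform_0 epull_def)
  next
    case 2
    then have lin: "linear (\<lambda>e. \<alpha> (\<phi> y) [e])" if "y \<in> S" for y
      using assms(2) mem[OF that] by (simp add: eform_1)
    have "smooth_on S (\<lambda>y. \<alpha> (\<phi> y) [frechet_derivative \<phi> (at y) e])" for e
      using smooth_on_linear_family[of S "\<lambda>y e. \<alpha> (\<phi> y) [e]"] assms lin sm sD 2 by simp
    moreover have "linear (\<lambda>e. \<alpha> (\<phi> y) [frechet_derivative \<phi> (at y) e])" if "y \<in> S" for y
      using linear_compose[OF lD[OF that] lin[OF that]] by (simp add: o_def)
    ultimately show ?thesis by (simp add: 2 eform_1 epull_def)
  next
    case 3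
    then have lin: "linear (\<lambda>e. \<alpha> (\<phi> y) [e, f])" "linear (\<lambda>f. \<alpha> (\<phi> y) [e, f])" "\<alpha> (\<phi> y) [e, e] = 0"
      if "y \<in> S" for y e f
      using assms(2) mem[OF that] by (simp_all add: eform_2)
    have 1: "smooth_on S (\<lambda>y. \<alpha> (\<phi> y) [frechet_derivative \<phi> (at y) e, f])" for e f
      using smooth_on_linear_family[of S "\<lambda>y e. \<alpha> (\<phi> y) [e, f]"] assms lin sm sD 3 by simp
    have "smooth_on S (\<lambda>y. \<alpha> (\<phi> y) [frechet_derivative \<phi> (at y) e, frechet_derivative \<phi> (at y) f])" for e f
      using smooth_on_linear_family[of S "\<lambda>y f. \<alpha> (\<phi> y) [frechet_derivative \<phi> (at y) e, f]"]
        assms lin 1 sD 3 by simp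
    moreover have "linear (\<lambda>e. \<alpha> (\<phi> y) [frechet_derivative \<phi> (at y) e, f])"
      "linear (\<lambda>e. \<alpha> (\<phi> y) [f, frechet_derivative \<phi> (at y) e])" if "y \<in> S" for y f
      using linear_compose[OF lD[OF that] lin(1)[OF that]] linear_compose[OF lD[OF that] lin(2)[OF that]]
      by (simp_all add: o_def)
    ultimately show ?thesis by (simp add: 3 eform_2 epull_def lin)
  qed
qed

text \<open>Differentiating the pulled-back form also hits the arguments and produces second
  derivatives of \<open>\<phi>\<close>. These are symmetric, whereas \<open>d\<close> and the form
  are alternating, so they cancel.\<close>

theorem euclidean_ext_deriv_epull:
  fixes \<phi> :: "'e::{real_inner, heine_borel} \<Rightarrow> 'h::{real_inner, heine_borel}"
  assumes "k \<le> 2" "eform k T \<alpha>" "open S" "open T" "smooth_on S \<phi>" "\<phi> ` S \<subseteq> T"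
    and u: "u \<in> S" and len: "length es = Suc k"
  shows "euclidean_ext_deriv (epull \<phi> \<alpha>) u es =
    euclidean_ext_deriv \<alpha> (\<phi> u) (map (frechet_derivative \<phi> (at u)) es)"
proof -
  define D where "D = frechet_derivative \<phi> (at u)"
  define D2 where "D2 e f = frechet_derivative (\<lambda>y. frechet_derivative \<phi> (at y) f) (at u) e" for e f
  have sym: "D2 e f = D2 f e" for e f
    unfolding D2_def using symmetric_second_derivative[OF assms(3) u assms(5)] .
  have D2: "((\<lambda>y. frechet_derivative \<phi> (at y) f) has_derivative (\<lambda>e. D2 e f)) (at u)" for f
    unfolding D2_def
    using smooth_on_has_derivative[OF smooth_on_frechet_derivative[OF assms(5)] u] .
  have mem: "\<phi> y \<in> T" if "y \<in> S" for y using assms that by auto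
  have ch: "((\<lambda>y. \<alpha> (\<phi> y) ds) has_derivative
      (\<lambda>e. frechet_derivative (\<lambda>q. \<alpha> q ds) (at (\<phi> u)) (D e))) (at u)" if "length ds = k" for ds
    unfolding D_def
    using has_derivative_compose[OF smooth_on_has_derivative[OF assms(5) u]
        smooth_on_has_derivative[OF eform_smooth[OF assms(2) that] mem[OF u]]] .
  show ?thesis
    using assms(1)
  proof (cases rule: le_2_cases)
    case 1
    then obtain e where es: "es = [e]" using len by (auto simp: length_1_conv)
    show ?thesis
      using has_derivative_imp_eq[OF ch] 1
      by (simp add: es euclidean_ext_deriv_0 epull_def D_def)
  next
    case 2
    then obtain e1 e2 where es: "es = [e1, e2]" using len by (auto simp: length_2_conv)
    have lin: "linear (\<lambda>e. \<alpha> (\<phi> y) [e])" if "y \<in> S" for y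
      using assms(2) mem[OF that] 2 by (simp add: eform_1)
    have "((\<lambda>y. \<alpha> (\<phi> y) [frechet_derivative \<phi> (at y) f]) has_derivative
      (\<lambda>e. frechet_derivative (\<lambda>q. \<alpha> q [D f]) (at (\<phi> u)) (D e) + \<alpha> (\<phi> u) [D2 e f])) (at u)" for f
      using has_derivative_linear_family[OF assms(3) u lin ch D2] 2 by (simp add: D_def)
    note fd = has_derivative_imp_eq[OF this]
    show ?thesis
      unfolding es euclidean_ext_deriv_1 epull_def list.map fd D_def[symmetric]
      by (simp add: sym[of e1 e2])
  next
    case 3
    then obtain e1 e2 e3 where es: "es = [e1, e2, e3]" using len by (auto simp: length_3_conv)
    have lin: "linear (\<lambda>e. \<alpha> (\<phi> y) [e, f])" "linear (\<lambda>f. \<alpha> (\<phi> y) [e, f])" if "y \<in> S" for y e f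
      using assms(2) mem[OF that] 3 by (simp_all add: eform_2)
    \<comment> \<open>The product rule is applied slot by slot: here the second argument is frozen
      at \<open>w\<close>, and the next claim lets it move as well.\<close>
    have 1: "((\<lambda>y. \<alpha> (\<phi> y) [frechet_derivative \<phi> (at y) f, w]) has_derivative
      (\<lambda>e. frechet_derivative (\<lambda>q. \<alpha> q [D f, w]) (at (\<phi> u)) (D e) + \<alpha> (\<phi> u) [D2 e f, w])) (at u)" for f w
      using has_derivative_linear_family[OF assms(3) u, of "\<lambda>y e. \<alpha> (\<phi> y) [e, w]", OF lin(1) ch D2] 3
      by (simp add: D_def)
    have "((\<lambda>y. \<alpha> (\<phi> y) [frechet_derivative \<phi> (at y) f, frechet_derivative \<phi> (at y) g]) has_derivative
      (\<lambda>e. frechet_derivative (\<lambda>q. \<alpha> q [D f, D g]) (at (\<phi> u)) (D e) + \<alpha> (\<phi> u) [D2 e f, D g] +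
        \<alpha> (\<phi> u) [D f, D2 e g])) (at u)" for f g
      unfolding D_def
      by (rule has_derivative_linear_family[OF assms(3) u,
          of "\<lambda>y e. \<alpha> (\<phi> y) [frechet_derivative \<phi> (at y) f, e]", OF lin(2) 1[unfolded D_def] D2])
    note fd = has_derivative_imp_eq[OF this]
    have anti: "\<alpha> (\<phi> u) [v, w] = - \<alpha> (\<phi> u) [w, v]" for v w
      by (rule eform_2_antisym[OF _ mem[OF u]]) (use assms(2) 3 in simp)
    have pe: "epull \<phi> \<alpha> y [f, g] = \<alpha> (\<phi> y) [frechet_derivative \<phi> (at y) f, frechet_derivative \<phi> (at y) g]"
      for y f g by (simp add: epull_def)
    have "euclidean_ext_deriv (epull \<phi> \<alpha>) u es - euclidean_ext_deriv \<alpha> (\<phi> u) (map D es) =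
      (\<alpha> (\<phi> u) [D2 e1 e2, D e3] + \<alpha> (\<phi> u) [D e2, D2 e1 e3]) -
      (\<alpha> (\<phi> u) [D2 e2 e1, D e3] + \<alpha> (\<phi> u) [D e1, D2 e2 e3]) +
      (\<alpha> (\<phi> u) [D2 e3 e1, D e2] + \<alpha> (\<phi> u) [D e1, D2 e3 e2])"
      unfolding es list.map euclidean_ext_deriv_2 pe fd by linarith
    \<comment> \<open>Symmetry of \<open>D2\<close> pairs off four of the six terms. The other two
      contain \<open>D e2\<close> and \<open>D2 e1 e3\<close> in opposite orders and cancel by
      antisymmetry.\<close>
    also have "\<dots> = 0"
      unfolding sym[of e2 e1] sym[of e3 e1] sym[of e3 e2]
      using anti[of "D e2" "D2 e1 e3"] by linarith
    finally show ?thesis by (simp add: D_def)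
  qed
qed

text \<open>In the direction of differentiation linearity is that of a derivative; in the remaining
  argument of a 1-form it is \<open>frechet_derivative_linear_family\<close>.\<close>

lemma eform_ext_deriv:
  fixes \<alpha> :: "'e::{real_inner, heine_borel} \<Rightarrow> 'e list \<Rightarrow> real"
  assumes "k \<le> 1" "open S" "eform k S \<alpha>"
  shows "eform (Suc k) S (euclidean_ext_deriv \<alpha>)"
proof (cases "k = 0")
  case True
  then show ?thesis
    using assms(3)
    by (auto simp: eform_0 eform_1 euclidean_ext_deriv_0 smooth_on_frechet_derivative
        intro: smooth_on_linear_derivative)
next
  case False
  then have k: "k = Suc 0" using assms(1) by simp
  have s: "smooth_on S (\<lambda>u. \<alpha> u [e])" and l: "u \<in> S \<Longrightarrow> linear (\<lambda>e. \<alpha> u [e])" for e u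
    using assms(3) by (auto simp: k eform_1)
  have "smooth_on S (\<lambda>u. euclidean_ext_deriv \<alpha> u [e, f])" for e f
    unfolding euclidean_ext_deriv_1
    by (intro smooth_on_diff smooth_on_frechet_derivative s assms)
  moreover have l1: "linear (frechet_derivative (\<lambda>y. \<alpha> y [e]) (at u))" if "u \<in> S" for u e
    using smooth_on_linear_derivative[OF s that] .
  moreover have l2: "linear (\<lambda>e. frechet_derivative (\<lambda>y. \<alpha> y [e]) (at u) v)" if "u \<in> S" for u v
    using frechet_derivative_linear_family[OF assms(2) that, of "\<lambda>y e. \<alpha> y [e]", OF l
        smooth_on_has_derivative[OF s that]] by simp
  ultimately show ?thesis
    by (simp add: k eform_2 euclidean_ext_deriv_1 linear_compose_sub)
qed

lemma frechet_derivative_diff_smooth: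
  fixes f g :: "'e::real_normed_vector \<Rightarrow> real"
  assumes "smooth_on S f" "smooth_on S g" "u \<in> S"
  shows "frechet_derivative (\<lambda>y. f y - g y) (at u) e =
    frechet_derivative f (at u) e - frechet_derivative g (at u) e"
  using has_derivative_imp_eq[OF has_derivative_diff[OF smooth_on_has_derivative[OF assms(1,3)]
        smooth_on_has_derivative[OF assms(2,3)]]] by simp

text \<open>Every second derivative occurs twice, with the two directions exchanged and with
  opposite signs.\<close>

lemma euclidean_ext_deriv_ext_deriv:
  fixes \<alpha> :: "'e::{real_inner, heine_borel} \<Rightarrow> 'e list \<Rightarrow> real"
  assumes "k \<le> 1" "open S" "eform k S \<alpha>" "u \<in> S" "length es = Suc (Suc k)"
  shows "euclidean_ext_deriv (euclidean_ext_deriv \<alpha>) u es = 0"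
proof (cases "k = 0")
  case True
  then obtain e1 e2 where es: "es = [e1, e2]" using assms by (auto simp: length_2_conv)
  show ?thesis
    using symmetric_second_derivative[OF assms(2,4), of "\<lambda>y. \<alpha> y []"] assms(3) True
    by (simp add: es euclidean_ext_deriv_0 euclidean_ext_deriv_1 eform_0)
next
  case False
  then have k: "k = Suc 0" using assms(1) by simp
  then obtain e1 e2 e3 where es: "es = [e1, e2, e3]" using assms by (auto simp: length_3_conv)
  have s: "smooth_on S (\<lambda>u. \<alpha> u [e])" for e
    using assms(3) by (auto simp: k eform_1)
  show ?thesis
    unfolding es euclidean_ext_deriv_1 euclidean_ext_deriv_2
      frechet_derivative_diff_smooth[OF smooth_on_frechet_derivative[OF s] smooth_on_frechet_derivative[OF s] assms(4)]
    by (simp add: symmetric_second_derivative[OF assms(2,4) s, of _ e2 e1]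
        symmetric_second_derivative[OF assms(2,4) s, of _ e3 e1]
        symmetric_second_derivative[OF assms(2,4) s, of _ e3 e2])
qed

section \<open>Charts and tangent vectors\<close>

lemma scaleR_fun_apply: "(r *\<^sub>R f) x = r *\<^sub>R f x"
  by (simp add: scaleR_fun_def)

text \<open>Functions are treated as 0-forms, so that composition with \<open>f\<close> and the
  differential fall under the general facts on pullback and \<open>ext_deriv\<close>. The open
  \<open>V\<close> and the closed \<open>F\<close> record where \<open>b\<close> is constant on a
  whole neighborhood: 1 around points of \<open>V\<close>, 0 around points outside
  \<open>F\<close>.\<close>

definition bump :: "('a::topological_space, 'e::real_normed_vector) atlas \<Rightarrow> ('a \<Rightarrow> real) \<Rightarrow> 'a set \<Rightarrow> 'a set \<Rightarrow> bool" where
  "bump A b V F \<longleftrightarrow> open V \<and> closed F \<and> V \<subseteq> F \<and> smooth_form A 0 UNIV (\<lambda>x vs. b x) \<and>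
     (\<forall>x\<in>V. b x = 1) \<and> (\<forall>x. x \<notin> F \<longrightarrow> b x = 0) \<and> (\<forall>x. 0 \<le> b x \<and> b x \<le> 1)"

context
  fixes A :: "('a::{t2_space, second_countable_topology}, 'e::{real_inner, heine_borel}) atlas"
  assumes atlas: "smooth_atlas A"
begin

lemma charts_at_iff: "c \<in> charts_at A x \<longleftrightarrow> c \<in> A \<and> x \<in> fst c"
  by (auto simp: charts_at_def)

lemma charts_at_nonempty: "\<exists>c. c \<in> charts_at A x"
proof -
  have "x \<in> (\<Union>c\<in>A. fst c)" using atlas unfolding smooth_atlas_def by blast
  then show ?thesis by (auto simp: charts_at_iff)
qed

lemma some_chart: "(SOME c. c \<in> charts_at A x) \<in> charts_at A x"
  by (rule someI_ex[OF charts_at_nonempty])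

lemma chart_homeomorphism: "c \<in> A \<Longrightarrow> homeomorphism (fst c) (snd c ` fst c) (snd c) (chart_inv c)"
  and open_chart_domain: "c \<in> A \<Longrightarrow> open (fst c)"
  and open_chart_range: "c \<in> A \<Longrightarrow> open (snd c ` fst c)"
  using atlas by (auto simp: smooth_atlas_def is_chart_def)

lemma chart_inv_chart [simp]: "c \<in> A \<Longrightarrow> x \<in> fst c \<Longrightarrow> chart_inv c (snd c x) = x"
  using chart_homeomorphism unfolding homeomorphism_def by blast

lemma chart_image_iff:
  assumes "c \<in> A"
  shows "u \<in> snd c ` (fst c \<inter> W) \<longleftrightarrow> u \<in> snd c ` fst c \<and> chart_inv c u \<in> W"
  using chart_inv_chart[OF assms] by (auto simp: image_iff)

lemma open_chart_image:
  assumes "c \<in> A" "open W"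
  shows "open (snd c ` (fst c \<inter> W))"
proof -
  have "continuous_on (snd c ` fst c) (chart_inv c)"
    using chart_homeomorphism[OF assms(1)] by (simp add: homeomorphism_def)
  moreover have "snd c ` (fst c \<inter> W) = chart_inv c -` W \<inter> snd c ` fst c"
    using chart_image_iff[OF assms(1)] by blast
  ultimately show ?thesis
    using continuous_on_open_vimage[OF open_chart_range[OF assms(1)], of "chart_inv c"] assms(2) by metis
qed

lemma transition_chart: "c \<in> A \<Longrightarrow> x \<in> fst c \<Longrightarrow> transition c d (snd c x) = snd d x"
  by (simp add: transition_def)

lemma smooth_on_transition:
  "c \<in> A \<Longrightarrow> d \<in> A \<Longrightarrow> smooth_on (snd c ` (fst c \<inter> fst d)) (transition c d)"
  using atlas by (auto simp: smooth_atlas_def)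

lemma open_overlap: "c \<in> A \<Longrightarrow> d \<in> A \<Longrightarrow> open (snd c ` (fst c \<inter> fst d))"
  by (intro open_chart_image open_chart_domain)

lemma transition_has_derivative:
  assumes "c \<in> charts_at A x" "d \<in> charts_at A x"
  shows "(transition c d has_derivative frechet_derivative (transition c d) (at (snd c x))) (at (snd c x))"
  using assms by (intro smooth_on_has_derivative[OF smooth_on_transition]) (auto simp: charts_at_iff)

lemma transition_derivative_linear:
  assumes "c \<in> charts_at A x" "d \<in> charts_at A x"
  shows "linear (frechet_derivative (transition c d) (at (snd c x)))"
  using transition_has_derivative[OF assms] has_derivative_linear by blast

lemma transition_derivative_self:
  assumes "c \<in> charts_at A x"
  shows "frechet_derivative (transition c c) (at (snd c x)) e = e"
proof -
  have "frechet_derivative (transition c c) (at (snd c x)) = frechet_derivative (\<lambda>x. x) (at (snd c x))"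
    using assms by (intro frechet_derivative_cong_open[of "snd c ` fst c"] open_chart_range)
      (auto simp: charts_at_iff transition_def)
  then show ?thesis by simp
qed

text \<open>The cocycle identity of the transition maps, differentiated at \<open>x\<close>; near
  \<open>x\<close> the composition is literally the third transition map.\<close>

lemma transition_derivative_compose:
  assumes "c \<in> charts_at A x" "d \<in> charts_at A x" "d' \<in> charts_at A x"
  shows "frechet_derivative (transition d d') (at (snd d x))
      (frechet_derivative (transition c d) (at (snd c x)) e) =
    frechet_derivative (transition c d') (at (snd c x)) e"
proof -
  have A: "c \<in> A" "d \<in> A" "d' \<in> A" "x \<in> fst c" "x \<in> fst d" "x \<in> fst d'"
    using assms by (auto simp: charts_at_iff)
  have dd: "(transition d d' has_derivative frechet_derivative (transition d d') (at (snd d x)))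
      (at (transition c d (snd c x)))"
    using transition_has_derivative[OF assms(2,3)] A by (simp add: transition_chart)
  have "frechet_derivative (transition c d') (at (snd c x)) =
      frechet_derivative (\<lambda>u. transition d d' (transition c d u)) (at (snd c x))"
    by (rule frechet_derivative_cong_open[OF open_overlap[OF A(1,2)]])
      (use A in \<open>auto simp: transition_chart\<close>)
  then show ?thesis
    using has_derivative_imp_eq[OF has_derivative_compose[OF transition_has_derivative[OF assms(1,2)] dd]]
    by simp
qed

lemma coord_vec_in_tangent_space:
  "c \<in> charts_at A x \<Longrightarrow> coord_vec A c x e \<in> tangent_space A x"
  by (auto simp: tangent_space_def coord_vec_def transition_derivative_compose)

lemma coord_vec_apply:
  "d \<in> charts_at A x \<Longrightarrow> coord_vec A c x e d = frechet_derivative (transition c d) (at (snd c x)) e"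
  by (simp add: coord_vec_def)

lemma coord_vec_self: "c \<in> charts_at A x \<Longrightarrow> coord_vec A c x e c = e"
  by (simp add: coord_vec_apply transition_derivative_self)

text \<open>Together with \<open>coord_vec_self\<close>, this identifies the tangent space with the
  model space by evaluation at \<open>c\<close>.\<close>

lemma coord_vec_eta:
  assumes "c \<in> charts_at A x" "v \<in> tangent_space A x"
  shows "coord_vec A c x (v c) = v"
proof
  fix d
  have "d \<in> charts_at A x \<Longrightarrow> v d = frechet_derivative (transition c d) (at (snd c x)) (v c)"
    "d \<notin> charts_at A x \<Longrightarrow> v d = 0"
    using assms unfolding tangent_space_def by blast+
  then show "coord_vec A c x (v c) d = v d" by (simp add: coord_vec_def)
qed

lemma coord_vec_add: "c \<in> charts_at A x \<Longrightarrow> coord_vec A c x (v + w) = coord_vec A c x v + coord_vec A c x w"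
  and coord_vec_scaleR: "c \<in> charts_at A x \<Longrightarrow> coord_vec A c x (r *\<^sub>R v) = r *\<^sub>R coord_vec A c x v"
  using transition_derivative_linear[of c x]
  by (auto simp: coord_vec_def fun_eq_iff scaleR_fun_def linear_add linear_cmul)

lemma coord_vec_change:
  assumes "c \<in> charts_at A x" "d \<in> charts_at A x"
  shows "coord_vec A c x e = coord_vec A d x (frechet_derivative (transition c d) (at (snd c x)) e)"
  using assms by (auto simp: coord_vec_def fun_eq_iff transition_derivative_compose)

lemma coord_vec_zero_iff: "c \<in> charts_at A x \<Longrightarrow> coord_vec A c x e = 0 \<longleftrightarrow> e = 0"
  using coord_vec_self[of c x] coord_vec_scaleR[of c x 0 0]
  by (metis scaleR_zero_left zero_fun_apply)

lemma tangent_space_zero: "0 \<in> tangent_space A x"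
  and tangent_space_add: "v \<in> tangent_space A x \<Longrightarrow> w \<in> tangent_space A x \<Longrightarrow> v + w \<in> tangent_space A x"
  and tangent_space_scaleR: "v \<in> tangent_space A x \<Longrightarrow> r *\<^sub>R v \<in> tangent_space A x"
proof -
  obtain c where c: "c \<in> charts_at A x" using charts_at_nonempty by blast
  note t = coord_vec_in_tangent_space[OF c] and e = coord_vec_eta[OF c]
  show "0 \<in> tangent_space A x" using t[of 0] coord_vec_zero_iff[OF c, of 0] by simp
  show "v + w \<in> tangent_space A x" if "v \<in> tangent_space A x" "w \<in> tangent_space A x"
    using t[of "v c + w c"] coord_vec_add[OF c] e that by metis
  show "r *\<^sub>R v \<in> tangent_space A x" if "v \<in> tangent_space A x"
    using t[of "r *\<^sub>R v c"] coord_vec_scaleR[OF c] e that by metis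
qed

lemma tvecs_map_coord_vec:
  assumes "c \<in> charts_at A x" "length es = k"
  shows "map (coord_vec A c x) es \<in> tvecs A k x"
  using assms by (auto simp: tvecs_def coord_vec_in_tangent_space)

lemma tvecs_eta:
  assumes "c \<in> charts_at A x" "vs \<in> tvecs A k x"
  shows "map (coord_vec A c x) (map (\<lambda>v. v c) vs) = vs"
  using assms by (auto simp: tvecs_def coord_vec_eta subset_iff intro!: map_idI)

lemma tvecs_1: "[v] \<in> tvecs A (Suc 0) x \<longleftrightarrow> v \<in> tangent_space A x"
  and tvecs_2: "[v, w] \<in> tvecs A 2 x \<longleftrightarrow> v \<in> tangent_space A x \<and> w \<in> tangent_space A x"
  by (auto simp: tvecs_def)

lemma alternating_at_2:
  assumes "alternating_at A 2 x \<alpha>" "u \<in> tangent_space A x" "v \<in> tangent_space A x" "w \<in> tangent_space A x"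
  shows "\<alpha> [u + v, w] = \<alpha> [u, w] + \<alpha> [v, w]" "\<alpha> [w, u + v] = \<alpha> [w, u] + \<alpha> [w, v]"
    "\<alpha> [r *\<^sub>R u, w] = r * \<alpha> [u, w]" "\<alpha> [w, r *\<^sub>R u] = r * \<alpha> [w, u]" "\<alpha> [u, u] = 0"
    "\<alpha> [u, v] = - \<alpha> [v, u]"
proof -
  have *: "\<alpha> (vs[i := a + b]) = \<alpha> (vs[i := a]) + \<alpha> (vs[i := b])" "\<alpha> (vs[i := r *\<^sub>R a]) = r * \<alpha> (vs[i := a])"
    if "vs \<in> tvecs A 2 x" "i < 2" "a \<in> tangent_space A x" "b \<in> tangent_space A x" for vs i a b r
    using assms(1) that unfolding alternating_at_def by blast+
  have 1: "\<alpha> [u + v, w] = \<alpha> [u, w] + \<alpha> [v, w]" "\<alpha> [w, u + v] = \<alpha> [w, u] + \<alpha> [w, v]"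
    "\<alpha> [r *\<^sub>R u, w] = r * \<alpha> [u, w]" "\<alpha> [w, r *\<^sub>R u] = r * \<alpha> [w, u]"
    if "u \<in> tangent_space A x" "v \<in> tangent_space A x" "w \<in> tangent_space A x" for u v w r
    using *[of "[u, w]" 0 u v] *[of "[w, u]" 1 u v] that by (auto simp: tvecs_2)
  show "\<alpha> [u + v, w] = \<alpha> [u, w] + \<alpha> [v, w]" "\<alpha> [w, u + v] = \<alpha> [w, u] + \<alpha> [w, v]"
    "\<alpha> [r *\<^sub>R u, w] = r * \<alpha> [u, w]" "\<alpha> [w, r *\<^sub>R u] = r * \<alpha> [w, u]"
    using 1[OF assms(2-4)] by blast+
  have z: "\<alpha> [u, u] = 0" if "u \<in> tangent_space A x" for u
  proof -
    have "[u, u] \<in> tvecs A 2 x" using that by (simp add: tvecs_2)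
    then have "\<forall>i<2. \<forall>j<2. i \<noteq> j \<and> [u, u] ! i = [u, u] ! j \<longrightarrow> \<alpha> [u, u] = 0"
      using assms(1) unfolding alternating_at_def by blast
    from this[rule_format, of 0 1] show ?thesis by simp
  qed
  then show "\<alpha> [u, u] = 0" using assms by blast
  show "\<alpha> [u, v] = - \<alpha> [v, u]"
    using z[OF tangent_space_add[OF assms(2,3)]] z[OF assms(2)] z[OF assms(3)]
      1(1)[OF assms(2,3) tangent_space_add[OF assms(2,3)]] 1(2)[OF assms(2,3,2)] 1(2)[OF assms(2,3,3)]
    by simp
qed

section \<open>Forms on a manifold and their coordinate expressions\<close>

lemma local_rep_chart:
  "c \<in> charts_at A x \<Longrightarrow> local_rep A c \<omega> (snd c x) es = \<omega> x (map (coord_vec A c x) es)"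
  by (simp add: local_rep_def charts_at_iff)

lemma form_eq_local_rep:
  "c \<in> charts_at A x \<Longrightarrow> vs \<in> tvecs A k x \<Longrightarrow> \<omega> x vs = local_rep A c \<omega> (snd c x) (map (\<lambda>v. v c) vs)"
  by (metis local_rep_chart tvecs_eta)

lemma local_rep_change:
  assumes "c \<in> charts_at A x" "d \<in> charts_at A x"
  shows "local_rep A c \<omega> (snd c x) es = epull (transition c d) (local_rep A d \<omega>) (snd c x) es"
proof -
  have 1: "map (coord_vec A c x) es =
      map (coord_vec A d x) (map (frechet_derivative (transition c d) (at (snd c x))) es)"
    using coord_vec_change[OF assms] by simp
  have 2: "transition c d (snd c x) = snd d x"
    using assms by (simp add: charts_at_iff transition_chart)
  show ?thesis unfolding local_rep_chart[OF assms(1)] epull_def 1 2 local_rep_chart[OF assms(2)] ..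
qed

lemma local_rep_cong:
  assumes "forms_agree A k W \<omega> \<theta>" "c \<in> charts_at A x" "x \<in> W" "length es = k"
  shows "local_rep A c \<omega> (snd c x) es = local_rep A c \<theta> (snd c x) es"
  using assms tvecs_map_coord_vec[OF assms(2,4)] by (simp add: local_rep_chart forms_agree_def)

text \<open>A single chart around \<open>x\<close> suffices, because \<open>coord_vec A c x\<close>
  is a linear bijection from the model space onto the tangent space.\<close>

lemma alternating_at_iff:
  assumes "c \<in> charts_at A x"
  shows "alternating_at A k x (\<omega> x) \<longleftrightarrow>
    (\<forall>es. length es = k \<longrightarrow> (\<forall>i<k. \<forall>v w r. local_rep A c \<omega> (snd c x) (es[i := v + w]) =
        local_rep A c \<omega> (snd c x) (es[i := v]) + local_rep A c \<omega> (snd c x) (es[i := w]) \<and>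
      local_rep A c \<omega> (snd c x) (es[i := r *\<^sub>R v]) = r * local_rep A c \<omega> (snd c x) (es[i := v]))) \<and>
    (\<forall>es. length es = k \<longrightarrow> (\<forall>i<k. \<forall>j<k. i \<noteq> j \<and> es ! i = es ! j \<longrightarrow>
      local_rep A c \<omega> (snd c x) es = 0))" (is "?L \<longleftrightarrow> ?R")
proof
  assume L: ?L
  note t = coord_vec_in_tangent_space[OF assms]
  have L1: "\<omega> x (vs[i := v + w]) = \<omega> x (vs[i := v]) + \<omega> x (vs[i := w]) \<and>
      \<omega> x (vs[i := r *\<^sub>R v]) = r * \<omega> x (vs[i := v])"
    if "vs \<in> tvecs A k x" "i < k" "v \<in> tangent_space A x" "w \<in> tangent_space A x" for vs i v w r
    using L that unfolding alternating_at_def by blast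
  have L2: "\<omega> x vs = 0" if "vs \<in> tvecs A k x" "i < k" "j < k" "i \<noteq> j" "vs ! i = vs ! j" for vs i j
    using L that unfolding alternating_at_def by blast
  show ?R
    unfolding local_rep_chart[OF assms] map_update coord_vec_add[OF assms] coord_vec_scaleR[OF assms]
  proof (intro conjI allI impI)
    fix es :: "'e list" and i v w r
    assume "length es = k" "i < k"
    note * = L1[OF tvecs_map_coord_vec[OF assms this(1)] this(2) t t]
    show "\<omega> x ((map (coord_vec A c x) es)[i := coord_vec A c x v + coord_vec A c x w]) =
        \<omega> x ((map (coord_vec A c x) es)[i := coord_vec A c x v]) +
        \<omega> x ((map (coord_vec A c x) es)[i := coord_vec A c x w])" using * by blast
    show "\<omega> x ((map (coord_vec A c x) es)[i := r *\<^sub>R coord_vec A c x v]) =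
        r * \<omega> x ((map (coord_vec A c x) es)[i := coord_vec A c x v])" using * by blast
  next
    fix es :: "'e list" and i j
    assume "length es = k" "i < k" "j < k" "i \<noteq> j \<and> es ! i = es ! j"
    then show "\<omega> x (map (coord_vec A c x) es) = 0"
      by (intro L2[OF tvecs_map_coord_vec[OF assms], of es i j]) auto
  qed
next
  assume R: ?R
  have eq: "\<omega> x (vs[i := v]) = local_rep A c \<omega> (snd c x) ((map (\<lambda>v. v c) vs)[i := v c])"
    if "vs \<in> tvecs A k x" "v \<in> tangent_space A x" for vs i v
  proof -
    have "vs[i := v] \<in> tvecs A k x"
      using that set_update_subset_insert[of vs i v] by (auto simp: tvecs_def)
    from form_eq_local_rep[OF assms this] show ?thesis by (simp add: map_update)
  qed
  show ?L unfolding alternating_at_def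
  proof (intro conjI ballI allI impI)
    fix vs i v w r
    assume vs: "vs \<in> tvecs A k x" "i < k" "v \<in> tangent_space A x" "w \<in> tangent_space A x"
    have len: "length (map (\<lambda>v. v c) vs) = k" using vs by (simp add: tvecs_def)
    show "\<omega> x (vs[i := v + w]) = \<omega> x (vs[i := v]) + \<omega> x (vs[i := w])"
      using R[THEN conjunct1, rule_format, OF len vs(2)] vs
      by (simp add: eq tangent_space_add)
    show "\<omega> x (vs[i := r *\<^sub>R v]) = r * \<omega> x (vs[i := v])"
      using R[THEN conjunct1, rule_format, OF len vs(2)] vs
      by (simp add: eq tangent_space_scaleR scaleR_fun_apply)
  next
    fix vs i j
    assume vs: "vs \<in> tvecs A k x" "i < k" "j < k" "i \<noteq> j \<and> vs ! i = vs ! j"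
    have len: "length (map (\<lambda>v. v c) vs) = k" using vs by (simp add: tvecs_def)
    show "\<omega> x vs = 0"
      unfolding form_eq_local_rep[OF assms vs(1)]
      using R[THEN conjunct2, rule_format, OF len vs(2,3)] vs len by simp
  qed
qed

text \<open>The bridge by which facts about \<open>eform\<close> become facts about forms on the
  manifold.\<close>

lemma smooth_form_iff:
  "smooth_form A k W \<omega> \<longleftrightarrow> (\<forall>c\<in>A. eform k (snd c ` (fst c \<inter> W)) (local_rep A c \<omega>))" (is "?L \<longleftrightarrow> ?R")
proof
  assume ?L
  then show ?R unfolding smooth_form_def eform_def
    using alternating_at_iff by (auto simp: charts_at_iff)
next
  assume R: ?R
  have "alternating_at A k x (\<omega> x)" if "x \<in> W" for x
  proof -
    obtain c where c: "c \<in> charts_at A x" using charts_at_nonempty by blast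
    then have "eform k (snd c ` (fst c \<inter> W)) (local_rep A c \<omega>)" "snd c x \<in> snd c ` (fst c \<inter> W)"
      using R that by (auto simp: charts_at_iff)
    then show ?thesis unfolding alternating_at_iff[OF c] eform_def by blast
  qed
  then show ?L using R by (auto simp: smooth_form_def eform_def)
qed

lemma smooth_form_eform:
  "smooth_form A k W \<omega> \<Longrightarrow> c \<in> charts_at A x \<Longrightarrow> eform k (snd c ` (fst c \<inter> W)) (local_rep A c \<omega>)"
  by (simp add: smooth_form_iff charts_at_iff)

lemma smooth_form_subset: "smooth_form A k W \<omega> \<Longrightarrow> V \<subseteq> W \<Longrightarrow> smooth_form A k V \<omega>"
  unfolding smooth_form_iff by (meson eform_subset image_mono Int_mono subset_refl)

lemma smooth_form_local:
  assumes "\<And>x. x \<in> W \<Longrightarrow> \<exists>U. open U \<and> x \<in> U \<and> smooth_form A k U \<omega>"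
  shows "smooth_form A k W \<omega>"
  unfolding smooth_form_iff
proof (intro ballI eform_local)
  fix c u assume c: "c \<in> A" and "u \<in> snd c ` (fst c \<inter> W)"
  then obtain x where x: "x \<in> fst c" "x \<in> W" "u = snd c x" by auto
  then obtain U where "open U" "x \<in> U" "smooth_form A k U \<omega>" using assms by blast
  then show "\<exists>U. open U \<and> u \<in> U \<and> eform k U (local_rep A c \<omega>)"
    using c x open_chart_image unfolding smooth_form_iff by blast
qed

lemma smooth_form_cong:
  assumes "open W" "smooth_form A k W \<omega>" "forms_agree A k W \<omega> \<theta>"
  shows "smooth_form A k W \<theta>"
  unfolding smooth_form_iff
proof
  fix c assume c: "c \<in> A"
  show "eform k (snd c ` (fst c \<inter> W)) (local_rep A c \<theta>)"
  proof (rule eform_cong[OF open_chart_image[OF c assms(1)]])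
    show "eform k (snd c ` (fst c \<inter> W)) (local_rep A c \<omega>)"
      using c assms(2) by (simp add: smooth_form_iff)
    show "local_rep A c \<omega> u es = local_rep A c \<theta> u es"
      if u: "u \<in> snd c ` (fst c \<inter> W)" and len: "length es = k" for u es
    proof -
      obtain x where x: "x \<in> fst c" "x \<in> W" "u = snd c x" using u by blast
      show ?thesis
        unfolding x(3) by (rule local_rep_cong[OF assms(3) _ x(2) len]) (simp add: charts_at_iff c x)
    qed
  qed
qed

lemma smooth_form_add:
  "open W \<Longrightarrow> smooth_form A k W \<omega> \<Longrightarrow> smooth_form A k W \<theta> \<Longrightarrow>
    smooth_form A k W (\<lambda>x vs. \<omega> x vs + \<theta> x vs)"
  using eform_add[OF open_chart_image] unfolding smooth_form_iff local_rep_def by blast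

lemma smooth_form_mult:
  assumes "open W" "smooth_form A 0 W (\<lambda>x vs. g x)" "smooth_form A k W \<omega>"
  shows "smooth_form A k W (\<lambda>x vs. g x * \<omega> x vs)"
  unfolding smooth_form_iff
proof
  fix c assume c: "c \<in> A"
  have "smooth_on (snd c ` (fst c \<inter> W)) (\<lambda>u. g (chart_inv c u))"
    using assms(2) c by (simp add: smooth_form_iff eform_0 local_rep_def)
  then show "eform k (snd c ` (fst c \<inter> W)) (local_rep A c (\<lambda>x vs. g x * \<omega> x vs))"
    using eform_mult[OF open_chart_image[OF c assms(1)]] assms(3) c
    unfolding smooth_form_iff local_rep_def by blast
qed

lemma smooth_form_const: "smooth_form A 0 W (\<lambda>x vs. r)"
  by (simp add: smooth_form_iff eform_0 local_rep_def)

lemma smooth_form_zero: "smooth_form A k W (\<lambda>x vs. 0)"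
  by (simp add: smooth_form_iff eform_def local_rep_def)

lemma smooth_form_cmult:
  "open W \<Longrightarrow> smooth_form A k W \<omega> \<Longrightarrow> smooth_form A k W (\<lambda>x vs. r * \<omega> x vs)"
  by (rule smooth_form_mult[OF _ smooth_form_const])

lemma smooth_form_diff:
  assumes "open W" "smooth_form A k W \<omega>" "smooth_form A k W \<theta>"
  shows "smooth_form A k W (\<lambda>x vs. \<omega> x vs - \<theta> x vs)"
  using smooth_form_add[OF assms(1,2) smooth_form_cmult[OF assms(1,3), of "-1"]] by simp

subsection \<open>The exterior derivative\<close>

lemma ext_deriv_some:
  "ext_deriv A \<omega> x vs = euclidean_ext_deriv (local_rep A (SOME c. c \<in> charts_at A x) \<omega>)
     (snd (SOME c. c \<in> charts_at A x) x) (map (\<lambda>v. v (SOME c. c \<in> charts_at A x)) vs)"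
  by (simp add: ext_deriv_def Let_def)

text \<open>The chart picked by \<open>SOME\<close> is compared with \<open>c\<close> by naturality
  of \<open>d\<close> under the transition map between them.\<close>

lemma ext_deriv_chart:
  assumes k: "k \<le> 2" and W: "open W" "x \<in> W" and \<omega>: "smooth_form A k W \<omega>"
    and c: "c \<in> charts_at A x" and vs: "vs \<in> tvecs A (Suc k) x"
  shows "ext_deriv A \<omega> x vs = euclidean_ext_deriv (local_rep A c \<omega>) (snd c x) (map (\<lambda>v. v c) vs)"
proof -
  define b where "b = (SOME c. c \<in> charts_at A x)"
  have b: "b \<in> charts_at A x" unfolding b_def by (rule some_chart)
  define S where "S = snd b ` (fst b \<inter> (fst c \<inter> W))"
  define T where "T = snd c ` (fst c \<inter> W)"
  have cA: "c \<in> A" "x \<in> fst c" and bA: "b \<in> A" "x \<in> fst b"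
    using b c by (auto simp: charts_at_iff)
  have S: "open S" "snd b x \<in> S"
    using open_chart_image[OF bA(1)] open_chart_domain[OF cA(1)] W cA bA by (auto simp: S_def)
  have T: "open T" unfolding T_def by (intro open_chart_image cA W)
  have len: "length (map (\<lambda>v. v b) vs) = Suc k" using vs by (simp add: tvecs_def)
  have sm: "smooth_on S (transition b c)"
    using smooth_on_transition[OF bA(1) cA(1)] by (rule smooth_on_subset) (auto simp: S_def)
  have im: "transition b c ` S \<subseteq> T"
    using bA(1) by (auto simp: S_def T_def transition_chart)
  have "ext_deriv A \<omega> x vs = euclidean_ext_deriv (local_rep A b \<omega>) (snd b x) (map (\<lambda>v. v b) vs)"
    by (simp add: ext_deriv_some b_def)
  also have "\<dots> = euclidean_ext_deriv (epull (transition b c) (local_rep A c \<omega>)) (snd b x) (map (\<lambda>v. v b) vs)"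
    by (rule euclidean_ext_deriv_cong[OF S len])
      (use cA bA in \<open>auto simp: S_def charts_at_iff intro!: local_rep_change\<close>)
  also have "\<dots> = euclidean_ext_deriv (local_rep A c \<omega>) (transition b c (snd b x))
      (map (frechet_derivative (transition b c) (at (snd b x))) (map (\<lambda>v. v b) vs))"
    using smooth_form_eform[OF \<omega> c]
    by (intro euclidean_ext_deriv_epull[OF k _ S(1) T sm im S(2) len]) (simp add: T_def)
  also have "transition b c (snd b x) = snd c x" using bA by (simp add: transition_chart)
  also have "map (frechet_derivative (transition b c) (at (snd b x))) (map (\<lambda>v. v b) vs) = map (\<lambda>v. v c) vs"
    using vs b c unfolding tvecs_def tangent_space_def by fastforce
  finally show ?thesis .
qed

lemma local_rep_ext_deriv:
  assumes "k \<le> 2" "open W" "smooth_form A k W \<omega>" "c \<in> A" "u \<in> snd c ` (fst c \<inter> W)" "length es = Suc k"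
  shows "local_rep A c (ext_deriv A \<omega>) u es = euclidean_ext_deriv (local_rep A c \<omega>) u es"
proof -
  obtain x where x: "x \<in> fst c" "x \<in> W" "u = snd c x" using assms by auto
  then have c: "c \<in> charts_at A x" using assms by (simp add: charts_at_iff)
  have "map (\<lambda>v. v c) (map (coord_vec A c x) es) = es"
    by (simp add: map_idI coord_vec_self[OF c])
  then show ?thesis
    unfolding x(3) local_rep_chart[OF c]
    using ext_deriv_chart[OF assms(1,2) x(2) assms(3) c tvecs_map_coord_vec[OF c assms(6)]] by simp
qed

lemma smooth_form_ext_deriv:
  assumes "k \<le> 1" "open W" "smooth_form A k W \<omega>"
  shows "smooth_form A (Suc k) W (ext_deriv A \<omega>)"
  unfolding smooth_form_iff
proof
  fix c assume c: "c \<in> A"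
  show "eform (Suc k) (snd c ` (fst c \<inter> W)) (local_rep A c (ext_deriv A \<omega>))"
  proof (rule eform_cong[OF open_chart_image[OF c assms(2)]])
    show "eform (Suc k) (snd c ` (fst c \<inter> W)) (euclidean_ext_deriv (local_rep A c \<omega>))"
      using assms c by (intro eform_ext_deriv open_chart_image) (auto simp: smooth_form_iff)
    show "euclidean_ext_deriv (local_rep A c \<omega>) u es = local_rep A c (ext_deriv A \<omega>) u es"
      if "u \<in> snd c ` (fst c \<inter> W)" "length es = Suc k" for u es
      using local_rep_ext_deriv[OF _ assms(2,3) c that] assms(1) by simp
  qed
qed

text \<open>Locality of \<open>d\<close>: both sides use the same chosen chart and depend only on
  coefficients near \<open>x\<close>. Smoothness plays no part in the argument, so the lemma applies
  to glued forms before they are known to be smooth.\<close>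

lemma ext_deriv_cong:
  assumes "open W" "x \<in> W" "forms_agree A k W \<omega> \<theta>" "vs \<in> tvecs A (Suc k) x"
  shows "ext_deriv A \<omega> x vs = ext_deriv A \<theta> x vs"
  unfolding ext_deriv_some
proof (rule euclidean_ext_deriv_cong)
  let ?c = "SOME c. c \<in> charts_at A x"
  have c: "?c \<in> A" "x \<in> fst ?c" using some_chart[of x] by (auto simp: charts_at_iff)
  show "open (snd ?c ` (fst ?c \<inter> W))" "snd ?c x \<in> snd ?c ` (fst ?c \<inter> W)"
    using c assms open_chart_image by auto
  show "length (map (\<lambda>v. v ?c) vs) = Suc k" using assms by (simp add: tvecs_def)
  show "local_rep A ?c \<omega> u es = local_rep A ?c \<theta> u es"
    if u: "u \<in> snd ?c ` (fst ?c \<inter> W)" and len: "length es = k" for u es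
  proof -
    obtain y where y: "y \<in> fst ?c" "y \<in> W" "u = snd ?c y" using u by blast
    show ?thesis
      unfolding y(3) by (rule local_rep_cong[OF assms(3) _ y(2) len]) (use c y in \<open>simp add: charts_at_iff\<close>)
  qed
qed

lemma ext_deriv_ext_deriv:
  assumes "k \<le> 1" "open W" "x \<in> W" "smooth_form A k W \<omega>" "vs \<in> tvecs A (Suc (Suc k)) x"
  shows "ext_deriv A (ext_deriv A \<omega>) x vs = 0"
proof -
  define c where "c = (SOME c. c \<in> charts_at A x)"
  have c: "c \<in> A" "x \<in> fst c" using some_chart[of x] by (auto simp: charts_at_iff c_def)
  let ?S = "snd c ` (fst c \<inter> W)"
  have S: "open ?S" "snd c x \<in> ?S" using c assms open_chart_image by auto
  have len: "length (map (\<lambda>v. v c) vs) = Suc (Suc k)" using assms by (simp add: tvecs_def)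
  have "ext_deriv A (ext_deriv A \<omega>) x vs =
      euclidean_ext_deriv (local_rep A c (ext_deriv A \<omega>)) (snd c x) (map (\<lambda>v. v c) vs)"
    by (simp add: ext_deriv_some c_def)
  also have "\<dots> = euclidean_ext_deriv (euclidean_ext_deriv (local_rep A c \<omega>)) (snd c x) (map (\<lambda>v. v c) vs)"
    using assms(1) by (intro euclidean_ext_deriv_cong[OF S len] local_rep_ext_deriv[OF _ assms(2,4) c(1)]) auto
  also have "\<dots> = 0"
    using assms(4) c by (intro euclidean_ext_deriv_ext_deriv[OF assms(1) S(1) _ S(2) len])
      (auto simp: smooth_form_iff)
  finally show ?thesis .
qed

lemma ext_deriv_add:
  assumes "x \<in> W" "smooth_form A k W \<omega>" "smooth_form A k W \<theta>" "vs \<in> tvecs A (Suc k) x"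
  shows "ext_deriv A (\<lambda>x vs. \<omega> x vs + \<theta> x vs) x vs = ext_deriv A \<omega> x vs + ext_deriv A \<theta> x vs"
proof -
  define c where "c = (SOME c. c \<in> charts_at A x)"
  have c: "c \<in> A" "x \<in> fst c" using some_chart[of x] by (auto simp: charts_at_iff c_def)
  have "local_rep A c (\<lambda>x vs. \<omega> x vs + \<theta> x vs) = (\<lambda>u es. local_rep A c \<omega> u es + local_rep A c \<theta> u es)"
    by (simp add: local_rep_def fun_eq_iff)
  then show ?thesis
    unfolding ext_deriv_some c_def[symmetric]
    using euclidean_ext_deriv_add[of k "snd c ` (fst c \<inter> W)" "local_rep A c \<omega>" "local_rep A c \<theta>" "snd c x"
        "map (\<lambda>v. v c) vs"] assms c by (simp add: smooth_form_iff tvecs_def)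
qed

lemma ext_deriv_cmult:
  assumes "x \<in> W" "smooth_form A k W \<omega>" "vs \<in> tvecs A (Suc k) x"
  shows "ext_deriv A (\<lambda>x vs. r * \<omega> x vs) x vs = r * ext_deriv A \<omega> x vs"
proof -
  define c where "c = (SOME c. c \<in> charts_at A x)"
  have c: "c \<in> A" "x \<in> fst c" using some_chart[of x] by (auto simp: charts_at_iff c_def)
  have "local_rep A c (\<lambda>x vs. r * \<omega> x vs) = (\<lambda>u es. r * local_rep A c \<omega> u es)"
    by (simp add: local_rep_def fun_eq_iff)
  then show ?thesis
    unfolding ext_deriv_some c_def[symmetric]
    using euclidean_ext_deriv_cmult[of k "snd c ` (fst c \<inter> W)" "local_rep A c \<omega>" "snd c x"
        "map (\<lambda>v. v c) vs"] assms c by (simp add: smooth_form_iff tvecs_def)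
qed

lemma ext_deriv_diff:
  assumes "open W" "x \<in> W" "smooth_form A k W \<omega>" "smooth_form A k W \<theta>" "vs \<in> tvecs A (Suc k) x"
  shows "ext_deriv A (\<lambda>x vs. \<omega> x vs - \<theta> x vs) x vs = ext_deriv A \<omega> x vs - ext_deriv A \<theta> x vs"
  using ext_deriv_add[OF assms(2,3) smooth_form_cmult[OF assms(1,4), of "-1"] assms(5)]
    ext_deriv_cmult[OF assms(2,4,5), of "-1"] by simp

text \<open>The Leibniz rule \<open>d(g \<alpha>) = dg \<and> \<alpha> + g d\<alpha>\<close>, with
  the wedge product written out on two vectors.\<close>

lemma ext_deriv_mult:
  assumes "x \<in> W" "smooth_form A 0 W (\<lambda>x vs. g x)" "smooth_form A (Suc 0) W \<alpha>"
    "v \<in> tangent_space A x" "w \<in> tangent_space A x"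
  shows "ext_deriv A (\<lambda>x vs. g x * \<alpha> x vs) x [v, w] =
    ext_deriv A (\<lambda>x vs. g x) x [v] * \<alpha> x [w] - ext_deriv A (\<lambda>x vs. g x) x [w] * \<alpha> x [v]
    + g x * ext_deriv A \<alpha> x [v, w]"
proof -
  define c where "c = (SOME c. c \<in> charts_at A x)"
  have c: "c \<in> charts_at A x" using some_chart[of x] by (auto simp: c_def)
  then have cA: "c \<in> A" "x \<in> fst c" by (auto simp: charts_at_iff)
  have "local_rep A c (\<lambda>x vs. g x * \<alpha> x vs) = (\<lambda>u es. g (chart_inv c u) * local_rep A c \<alpha> u es)"
    "local_rep A c (\<lambda>x vs. g x) = (\<lambda>u es. g (chart_inv c u))"
    by (simp_all add: local_rep_def fun_eq_iff)
  moreover have "\<alpha> x [v] = local_rep A c \<alpha> (snd c x) [v c]" "\<alpha> x [w] = local_rep A c \<alpha> (snd c x) [w c]"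
    using form_eq_local_rep[OF c, of "[v]" "Suc 0"] form_eq_local_rep[OF c, of "[w]" "Suc 0"] assms
    by (simp_all add: tvecs_1)
  moreover have "smooth_on (snd c ` (fst c \<inter> W)) (\<lambda>u. g (chart_inv c u))"
    using assms(2) cA by (simp add: smooth_form_iff eform_0 local_rep_def)
  ultimately show ?thesis
    unfolding ext_deriv_some c_def[symmetric]
    using euclidean_ext_deriv_mult[of "snd c ` (fst c \<inter> W)" "local_rep A c \<alpha>" "\<lambda>u. g (chart_inv c u)" "snd c x" "v c" "w c"]
      assms(1,3) cA by (simp add: smooth_form_iff euclidean_ext_deriv_0)
qed

subsection \<open>Bump functions\<close>

text \<open>A radial bump in one chart, extended by 0. The extension is smooth because the manifold
  is covered by the chart domain and the open complement of \<open>F\<close>, where \<open>b\<close>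
  vanishes.\<close>

lemma bump_function_exists:
  assumes "open U" "p \<in> U"
  shows "\<exists>b V F. bump A b V F \<and> p \<in> V \<and> F \<subseteq> U"
proof -
  obtain c where c: "c \<in> charts_at A p" using charts_at_nonempty by blast
  then have cA: "c \<in> A" "p \<in> fst c" by (auto simp: charts_at_iff)
  define q where "q = snd c p"
  have "open (snd c ` (fst c \<inter> U))" "q \<in> snd c ` (fst c \<inter> U)"
    using open_chart_image[OF cA(1) assms(1)] assms cA by (auto simp: q_def)
  then obtain e where e: "e > 0" "cball q e \<subseteq> snd c ` (fst c \<inter> U)"
    using open_contains_cball by blast
  define r where "r = e / 2"
  have r: "r > 0" and rc: "cball q (2 * r) \<subseteq> snd c ` (fst c \<inter> U)" using e by (auto simp: r_def)
  \<comment> \<open>The cutoff falls from 1 at distance \<open>r\<close> to 0 at distance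
    \<open>r * sqrt 2\<close>, hence inside the ball of radius \<open>2 * r = e\<close>, which still
    lies in the chart image.\<close>
  define h where "h u = cutoff ((u - q) \<bullet> (u - q) * (1 / r\<^sup>2))" for u
  define b where "b x = (if x \<in> fst c then h (snd c x) else 0)" for x
  define V where "V = fst c \<inter> snd c -` ball q r"
  define F where "F = chart_inv c ` cball q (2 * r)"
  have hs: "smooth_on UNIV h"
  proof -
    have "smooth_on UNIV (\<lambda>u. (u - q) \<bullet> (u - q) * (1 / r\<^sup>2))"
    proof -
      have "smooth_on UNIV (\<lambda>u. u + (- q))"
        by (intro smooth_on_add smooth_on_const smooth_on_bounded_linear[OF bounded_linear_ident]) simp
      then have "smooth_on UNIV (\<lambda>u. u - q)" by simp
      then show ?thesis
        by (intro smooth_on_mult smooth_on_const smooth_on_bilinear[OF bounded_bilinear_inner]) auto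
    qed
    from smooth_on_compose[OF open_UNIV open_UNIV smooth_on_cutoff[OF open_UNIV] this]
    show ?thesis by (simp add: h_def[abs_def])
  qed
  have h1: "h u = 1" if "dist q u \<le> r" for u
  proof -
    have "(norm (u - q))\<^sup>2 \<le> r\<^sup>2" using that by (simp add: dist_norm norm_minus_commute power_mono)
    then show ?thesis using r by (simp add: h_def cutoff_eq_1 power2_norm_eq_inner[symmetric])
  qed
  have h0: "h u = 0" if "2 * r \<le> dist q u" for u
  proof -
    have "(2 * r)\<^sup>2 \<le> (norm (u - q))\<^sup>2" using power_mono[of "2 * r" "norm (u - q)" 2] that r by (simp add: dist_norm norm_minus_commute)
    then have "2 * r\<^sup>2 \<le> (norm (u - q))\<^sup>2" by (simp add: power_mult_distrib) (use zero_le_power2[of r] in linarith)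
    then have "2 \<le> (norm (u - q))\<^sup>2 * (1 / r\<^sup>2)" using r by (simp add: field_simps)
    then show ?thesis by (simp add: h_def cutoff_eq_0 power2_norm_eq_inner[symmetric])
  qed
  have contc: "continuous_on (fst c) (snd c)" and conti: "continuous_on (snd c ` fst c) (chart_inv c)"
    using chart_homeomorphism[OF cA(1)] by (auto simp: homeomorphism_def)
  have oV: "open V"
    using continuous_on_open_vimage[OF open_chart_domain[OF cA(1)]] contc by (auto simp: V_def Int_commute)
  \<comment> \<open>The Hausdorff property makes this compact set closed in the whole manifold and
    not merely in the chart domain.\<close>
  have "compact F"
    unfolding F_def using rc
    by (intro compact_continuous_image compact_cball continuous_on_subset[OF conti]) auto
  then have cF: "closed F" by (rule compact_imp_closed)
  have FU: "F \<subseteq> U" using rc chart_image_iff[OF cA(1)] by (auto simp: F_def)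
  have inF: "x \<in> F" if "x \<in> fst c" "dist q (snd c x) \<le> 2 * r" for x
    using that cA(1) by (auto simp: F_def image_iff intro!: bexI[of _ "snd c x"])
  have VF: "V \<subseteq> F" using r by (auto simp: V_def intro!: inF)
  have b0: "b x = 0" if "x \<notin> F" for x
    using that inF[of x] h0[of "snd c x"]
    by (cases "dist q (snd c x) \<le> 2 * r") (auto simp: b_def)
  have "smooth_form A 0 UNIV (\<lambda>x vs. b x)"
    unfolding smooth_form_iff eform_0 local_rep_def
  proof (intro ballI smooth_on_local)
    fix d u assume d: "d \<in> A" and "u \<in> snd d ` (fst d \<inter> UNIV)"
    then obtain x where x: "x \<in> fst d" "u = snd d x" by auto
    show "\<exists>Q. open Q \<and> u \<in> Q \<and> smooth_on Q (\<lambda>u. b (chart_inv d u))"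
    proof (cases "x \<in> fst c")
      case True
      let ?Q = "snd d ` (fst d \<inter> fst c)"
      have "smooth_on ?Q (\<lambda>u. h (transition d c u))"
        by (rule smooth_on_compose[OF open_overlap[OF d cA(1)] open_UNIV hs smooth_on_transition[OF d cA(1)]]) simp
      then have "smooth_on ?Q (\<lambda>u. b (chart_inv d u))"
        by (rule smooth_on_cong[OF open_overlap[OF d cA(1)]]) (auto simp: b_def transition_chart d)
      then show ?thesis using x True open_overlap[OF d cA(1)] by blast
    next
      case False
      then have xF: "x \<notin> F" using rc chart_image_iff[OF cA(1)]
        by (auto simp: F_def)
      let ?Q = "snd d ` (fst d \<inter> - F)"
      have o: "open ?Q" using d cF by (intro open_chart_image) auto
      have "smooth_on ?Q (\<lambda>u. b (chart_inv d u))"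
        by (rule smooth_on_cong[OF o smooth_on_const[of _ 0]]) (auto simp: b0 d)
      then show ?thesis using x xF o by blast
    qed
  qed
  moreover have "p \<in> V" using cA r by (simp add: V_def q_def)
  moreover have "b x = 1" if "x \<in> V" for x using that h1 by (auto simp: V_def b_def)
  moreover have "0 \<le> b x" "b x \<le> 1" for x by (auto simp: b_def h_def cutoff_bounds)
  ultimately have "bump A b V F" using oV cF VF b0 by (simp add: bump_def)
  then show ?thesis using \<open>p \<in> V\<close> FU by blast
qed

end

section \<open>Closed and exact forms\<close>

lemma forms_agree_sym: "forms_agree A k W \<omega> \<theta> \<Longrightarrow> forms_agree A k W \<theta> \<omega>"
  by (simp add: forms_agree_def)

context
  fixes A :: "('a::{t2_space, second_countable_topology}, 'e::{real_inner, heine_borel}) atlas"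
  assumes atlas: "smooth_atlas A"
begin

lemma closed_form_iff:
  "closed_form A k W \<omega> \<longleftrightarrow>
    smooth_form A k W \<omega> \<and> (\<forall>x\<in>W. \<forall>vs\<in>tvecs A (Suc k) x. ext_deriv A \<omega> x vs = 0)"
  by (simp add: closed_form_def forms_agree_def)

lemma exact_form_Suc:
  "exact_form A (Suc j) W \<omega> \<longleftrightarrow>
    (\<exists>\<alpha>. smooth_form A j W \<alpha> \<and> (\<forall>x\<in>W. \<forall>vs\<in>tvecs A (Suc j) x. \<omega> x vs = ext_deriv A \<alpha> x vs))"
  by (simp add: exact_form_def forms_agree_def)

lemma closed_form_add:
  assumes "open W" "closed_form A k W \<omega>" "closed_form A k W \<theta>"
  shows "closed_form A k W (\<lambda>x vs. \<omega> x vs + \<theta> x vs)"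
proof -
  have s: "smooth_form A k W \<omega>" "smooth_form A k W \<theta>" using assms by (auto simp: closed_form_iff)
  have "ext_deriv A (\<lambda>x vs. \<omega> x vs + \<theta> x vs) x vs = 0" if "x \<in> W" "vs \<in> tvecs A (Suc k) x" for x vs
    using ext_deriv_add[OF atlas that(1) s that(2)] assms that by (simp add: closed_form_iff)
  then show ?thesis using smooth_form_add[OF atlas assms(1) s] by (simp add: closed_form_iff)
qed

lemma closed_form_cmult:
  assumes "open W" "closed_form A k W \<omega>"
  shows "closed_form A k W (\<lambda>x vs. r * \<omega> x vs)"
proof -
  have s: "smooth_form A k W \<omega>" using assms by (auto simp: closed_form_iff)
  have "ext_deriv A (\<lambda>x vs. r * \<omega> x vs) x vs = 0" if "x \<in> W" "vs \<in> tvecs A (Suc k) x" for x vs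
    using ext_deriv_cmult[OF atlas that(1) s that(2)] assms that by (simp add: closed_form_iff)
  then show ?thesis using smooth_form_cmult[OF atlas assms(1) s] by (simp add: closed_form_iff)
qed

lemma closed_form_ext_deriv:
  assumes "k \<le> 1" "open W" "smooth_form A k W \<alpha>"
  shows "closed_form A (Suc k) W (ext_deriv A \<alpha>)"
  using smooth_form_ext_deriv[OF atlas assms] ext_deriv_ext_deriv[OF atlas assms(1,2) _ assms(3)]
  unfolding closed_form_iff by simp

section \<open>The cohomology relation and primitives\<close>

lemma cohomologous_refl:
  assumes "closed_form A (Suc k) W \<omega>"
  shows "(\<omega>, \<omega>) \<in> cohomologous A (Suc k) W"
proof -
  have "ext_deriv A (\<lambda>x vs. 0) x vs = 0" if "x \<in> W" "vs \<in> tvecs A (Suc k) x" for x vs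
    using ext_deriv_cmult[OF atlas that(1) smooth_form_zero[OF atlas] that(2), of 0] by simp
  then have "exact_form A (Suc k) W (\<lambda>x vs. \<omega> x vs - \<omega> x vs)"
    unfolding exact_form_Suc using smooth_form_zero[OF atlas] by (intro exI[of _ "\<lambda>x vs. 0"]) auto
  then show ?thesis using assms by (simp add: cohomologous_def)
qed

lemma cohomologous_sym:
  assumes "open W" "(\<omega>, \<theta>) \<in> cohomologous A (Suc k) W"
  shows "(\<theta>, \<omega>) \<in> cohomologous A (Suc k) W"
proof -
  obtain \<alpha> where \<alpha>: "smooth_form A k W \<alpha>"
    "\<And>x vs. x \<in> W \<Longrightarrow> vs \<in> tvecs A (Suc k) x \<Longrightarrow> \<omega> x vs - \<theta> x vs = ext_deriv A \<alpha> x vs"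
    using assms(2) by (auto simp: cohomologous_def exact_form_Suc)
  have "\<theta> x vs - \<omega> x vs = ext_deriv A (\<lambda>x vs. -1 * \<alpha> x vs) x vs"
    if "x \<in> W" "vs \<in> tvecs A (Suc k) x" for x vs
    unfolding ext_deriv_cmult[OF atlas that(1) \<alpha>(1) that(2)] using \<alpha>(2)[OF that] by simp
  then show ?thesis
    using assms smooth_form_cmult[OF atlas assms(1) \<alpha>(1)] unfolding cohomologous_def exact_form_Suc
    by blast
qed

lemma cohomologous_trans:
  assumes "open W" "(\<omega>, \<theta>) \<in> cohomologous A (Suc k) W" "(\<theta>, \<sigma>) \<in> cohomologous A (Suc k) W"
  shows "(\<omega>, \<sigma>) \<in> cohomologous A (Suc k) W"
proof -
  obtain \<alpha> where \<alpha>: "smooth_form A k W \<alpha>"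
    "\<And>x vs. x \<in> W \<Longrightarrow> vs \<in> tvecs A (Suc k) x \<Longrightarrow> \<omega> x vs - \<theta> x vs = ext_deriv A \<alpha> x vs"
    using assms(2) by (auto simp: cohomologous_def exact_form_Suc)
  obtain \<beta> where \<beta>: "smooth_form A k W \<beta>"
    "\<And>x vs. x \<in> W \<Longrightarrow> vs \<in> tvecs A (Suc k) x \<Longrightarrow> \<theta> x vs - \<sigma> x vs = ext_deriv A \<beta> x vs"
    using assms(3) by (auto simp: cohomologous_def exact_form_Suc)
  have "\<omega> x vs - \<sigma> x vs = ext_deriv A (\<lambda>x vs. \<alpha> x vs + \<beta> x vs) x vs"
    if "x \<in> W" "vs \<in> tvecs A (Suc k) x" for x vs
    unfolding ext_deriv_add[OF atlas that(1) \<alpha>(1) \<beta>(1) that(2)] using \<alpha>(2)[OF that] \<beta>(2)[OF that] by simp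
  then show ?thesis
    using assms smooth_form_add[OF atlas assms(1) \<alpha>(1) \<beta>(1)] unfolding cohomologous_def exact_form_Suc
    by blast
qed

lemma de_rham_class_eqI:
  assumes "open W" "(\<omega>, \<theta>) \<in> cohomologous A (Suc k) W"
  shows "de_rham_class A (Suc k) W \<omega> = de_rham_class A (Suc k) W \<theta>"
  using cohomologous_trans[OF assms(1)] cohomologous_sym[OF assms(1)] assms(2)
  unfolding de_rham_class_def by blast

lemma primitive_of_restricted_class:
  assumes W: "open W" and \<zeta>: "c = de_rham_class A 2 UNIV \<zeta>" and \<eta>: "closed_form A 2 W \<eta>"
    and eq: "de_rham_class A 2 W \<eta> = de_rham_restrict A 2 W c"
  obtains \<alpha> where "smooth_form A 1 W \<alpha>"
    "\<And>x vs. x \<in> W \<Longrightarrow> vs \<in> tvecs A 2 x \<Longrightarrow> \<eta> x vs = \<zeta> x vs + ext_deriv A \<alpha> x vs"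
proof -
  have "\<eta> \<in> de_rham_restrict A 2 W c"
    using cohomologous_refl[of 1 W \<eta>] \<eta> eq[symmetric] by (simp add: de_rham_class_def numeral_2_eq_2)
  \<comment> \<open>The restricted class is reached through arbitrary representatives of
    \<open>c\<close>. Thus an intermediate \<open>\<theta>\<close> appears, cohomologous to
    \<open>\<zeta>\<close> on all of X but to \<open>\<eta>\<close> only over
    \<open>W\<close>.\<close>
  then obtain \<theta> where \<theta>: "(\<zeta>, \<theta>) \<in> cohomologous A 2 UNIV" "(\<theta>, \<eta>) \<in> cohomologous A 2 W"
    unfolding de_rham_restrict_def \<zeta> de_rham_class_def by blast
  obtain \<mu> where \<mu>: "smooth_form A 1 UNIV \<mu>"
    "\<And>x vs. vs \<in> tvecs A 2 x \<Longrightarrow> \<zeta> x vs - \<theta> x vs = ext_deriv A \<mu> x vs"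
    using \<theta>(1) by (auto simp: cohomologous_def exact_form_Suc numeral_2_eq_2)
  obtain \<nu> where \<nu>: "smooth_form A 1 W \<nu>"
    "\<And>x vs. x \<in> W \<Longrightarrow> vs \<in> tvecs A 2 x \<Longrightarrow> \<theta> x vs - \<eta> x vs = ext_deriv A \<nu> x vs"
    using \<theta>(2) by (auto simp: cohomologous_def exact_form_Suc numeral_2_eq_2)
  have \<mu>W: "smooth_form A 1 W \<mu>" using smooth_form_subset[OF atlas \<mu>(1)] by simp
  have s: "smooth_form A 1 W (\<lambda>x vs. \<mu> x vs + \<nu> x vs)" by (rule smooth_form_add[OF atlas W \<mu>W \<nu>(1)])
  show ?thesis
  proof (rule that)
    \<comment> \<open>The sign arises because \<open>d\<mu> + d\<nu>\<close> telescopes to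
      \<open>\<zeta> - \<eta>\<close>.\<close>
    show "smooth_form A 1 W (\<lambda>x vs. -1 * (\<mu> x vs + \<nu> x vs))" by (rule smooth_form_cmult[OF atlas W s])
    show "\<eta> x vs = \<zeta> x vs + ext_deriv A (\<lambda>x vs. -1 * (\<mu> x vs + \<nu> x vs)) x vs"
      if "x \<in> W" and vs: "vs \<in> tvecs A 2 x" for x vs
    proof -
      have vs': "vs \<in> tvecs A (Suc 1) x" using vs by (simp add: numeral_2_eq_2)
      show ?thesis
        using \<mu>(2)[OF vs] \<nu>(2)[OF that]
        unfolding ext_deriv_cmult[OF atlas that(1) s vs'] ext_deriv_add[OF atlas that(1) \<mu>W \<nu>(1) vs'] by simp
    qed
  qed
qed

subsection \<open>Cutting off near a closed set\<close>

lemma smooth_form_prod: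
  "finite I \<Longrightarrow> (\<And>i. i \<in> I \<Longrightarrow> smooth_form A 0 UNIV (\<lambda>x vs. g i x)) \<Longrightarrow>
    smooth_form A 0 UNIV (\<lambda>x vs. \<Prod>i\<in>I. g i x)"
proof (induction I rule: finite_induct)
  case empty
  then show ?case by (simp add: smooth_form_const[OF atlas])
next
  case (insert i I)
  then show ?case
    using smooth_form_mult[OF atlas open_UNIV, of "g i" 0 "\<lambda>x vs. \<Prod>i\<in>I. g i x"] by simp
qed

text \<open>The complement of \<open>W\<close> is compact, being closed and contained in
  \<open>UNIV - interior C\<close>. Finitely many bumps supported away from \<open>C\<close>
  therefore cover it, and \<open>\<rho>\<close> is the product of the factors \<open>1 - b\<close>.
  The open set \<open>Z\<close> is provided so that a product of \<open>\<rho>\<close> with a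
  function on \<open>W\<close> extends smoothly by 0.\<close>

lemma cutoff_function_exists:
  assumes "closed C" "compact (UNIV - interior C)" "open W" "C \<subseteq> W"
  obtains \<rho> :: "'a \<Rightarrow> real" and N Z where
    "open N" "C \<subseteq> N" "N \<subseteq> W" "open Z" "Z \<union> W = UNIV" "smooth_form A 0 UNIV (\<lambda>x vs. \<rho> x)"
    "\<And>x. x \<in> N \<Longrightarrow> \<rho> x = 1" "\<And>x. x \<in> Z \<Longrightarrow> \<rho> x = 0"
proof -
  define K where "K = - W"
  have "K = (UNIV - interior C) \<inter> K" using assms(4) interior_subset[of C] by (auto simp: K_def)
  moreover have "closed K" using assms by (simp add: K_def closed_Compl)
  ultimately have K: "compact K" using compact_Int_closed[OF assms(2)] by metis
  have "\<exists>b V F. bump A b V F \<and> p \<in> V \<and> F \<subseteq> - C" if "p \<in> K" for p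
    using that assms by (intro bump_function_exists[OF atlas]) (auto simp: K_def)
  then obtain b V F where B: "\<And>p. p \<in> K \<Longrightarrow> bump A (b p) (V p) (F p) \<and> p \<in> V p \<and> F p \<subseteq> - C"
    by metis
  note bVF = B[unfolded bump_def]
  obtain P where P: "P \<subseteq> K" "finite P" "K \<subseteq> (\<Union>p\<in>P. V p)"
    using compactE_image[OF K, of K V] bVF by blast
  have VF: "V p \<subseteq> F p" "F p \<subseteq> - C" "open (V p)" "closed (F p)" "smooth_form A 0 UNIV (\<lambda>x vs. b p x)" if "p \<in> P" for p
    using bVF P(1) that by blast+
  have b: "x \<in> V p \<Longrightarrow> b p x = 1" "x \<notin> F p \<Longrightarrow> b p x = 0" if "p \<in> P" for p x
    using bVF P(1) that by blast+
  show ?thesis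
  proof (rule that)
    show "open (- (\<Union>p\<in>P. F p))" using P(2) VF(4) by (intro open_Compl closed_UN) auto
    show "C \<subseteq> - (\<Union>p\<in>P. F p)" using VF(2) by blast
    show "- (\<Union>p\<in>P. F p) \<subseteq> W" using P(3) VF(1) unfolding K_def by blast
    show "open (\<Union>p\<in>P. V p)" using VF(3) by auto
    show "(\<Union>p\<in>P. V p) \<union> W = UNIV" using P(3) by (auto simp: K_def)
    show "smooth_form A 0 UNIV (\<lambda>x vs. \<Prod>p\<in>P. 1 - b p x)"
      by (intro smooth_form_prod[OF P(2)] smooth_form_diff[OF atlas open_UNIV] smooth_form_const[OF atlas] VF(5))
    show "(\<Prod>p\<in>P. 1 - b p x) = 1" if "x \<in> - (\<Union>p\<in>P. F p)" for x
      using that b(2) by (intro prod.neutral) auto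
    show "(\<Prod>p\<in>P. 1 - b p x) = 0" if "x \<in> (\<Union>p\<in>P. V p)" for x
      using that b(1) P(2) by (auto simp: prod_zero_iff)
  qed
qed

text \<open>
  Surjectivity on \<open>H\<^sup>1\<close> makes two primitives over \<open>V\<close> differ there by an exact form, after a closed
  correction over \<open>W\<close>; the exact form is then cut off.
\<close>

lemma adjust_primitive:
  assumes W: "open W" and V: "open V" "V \<subseteq> W" and N: "open N" "N \<subseteq> V" and Z: "open Z" "Z \<union> V = UNIV"
    and \<rho>: "smooth_form A 0 UNIV (\<lambda>x vs. \<rho> x)" "\<And>x. x \<in> N \<Longrightarrow> \<rho> x = 1" "\<And>x. x \<in> Z \<Longrightarrow> \<rho> x = 0"
    and surj: "de_rham_restrict A 1 V ` de_rham A 1 W = de_rham A 1 V"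
    and \<alpha>: "smooth_form A 1 W \<alpha>" and \<alpha>0: "smooth_form A 1 V \<alpha>0"
    and eq: "\<And>x vs. x \<in> V \<Longrightarrow> vs \<in> tvecs A 2 x \<Longrightarrow> ext_deriv A \<alpha> x vs = ext_deriv A \<alpha>0 x vs"
  obtains \<beta> where "smooth_form A 1 W \<beta>"
    "\<And>x vs. x \<in> W \<Longrightarrow> vs \<in> tvecs A 2 x \<Longrightarrow> ext_deriv A \<beta> x vs = ext_deriv A \<alpha> x vs"
    "forms_agree A 1 N \<beta> \<alpha>0"
proof -
  have t2: "tvecs A 2 x = tvecs A (Suc 1) x" for x by (simp add: numeral_2_eq_2)
  have \<alpha>V: "smooth_form A 1 V \<alpha>" using smooth_form_subset[OF atlas \<alpha> V(2)] .
  define \<delta> where "\<delta> = (\<lambda>x vs. \<alpha> x vs - \<alpha>0 x vs)"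
  have \<delta>: "closed_form A 1 V \<delta>"
    unfolding closed_form_iff \<delta>_def
    using smooth_form_diff[OF atlas V(1) \<alpha>V \<alpha>0] ext_deriv_diff[OF atlas V(1) _ \<alpha>V \<alpha>0] eq
    by (simp add: t2)
  have "cohomologous A 1 V `` {\<delta>} \<in> de_rham A 1 V"
    using \<delta> unfolding de_rham_def by (simp add: quotientI)
  then obtain k where k: "k \<in> de_rham A 1 W" "de_rham_restrict A 1 V k = cohomologous A 1 V `` {\<delta>}"
    unfolding surj[symmetric] by blast
  have "\<delta> \<in> cohomologous A 1 V `` {\<delta>}" using cohomologous_refl[of 0 V \<delta>] \<delta> by simp
  then obtain \<theta> where \<theta>: "\<theta> \<in> k" "(\<theta>, \<delta>) \<in> cohomologous A 1 V"
    using k(2) unfolding de_rham_restrict_def by blast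
  have \<theta>W: "closed_form A 1 W \<theta>"
    using k(1) \<theta>(1) unfolding de_rham_def by (auto simp: quotient_def cohomologous_def)
  then have s\<theta>: "smooth_form A 1 W \<theta>" by (simp add: closed_form_iff)
  obtain g where g: "smooth_form A 0 V g"
    "\<And>x vs. x \<in> V \<Longrightarrow> vs \<in> tvecs A 1 x \<Longrightarrow> \<theta> x vs - \<delta> x vs = ext_deriv A g x vs"
    using \<theta>(2) by (auto simp: cohomologous_def exact_form_Suc)
  \<comment> \<open>Off \<open>V\<close> the values of \<open>g\<close> are arbitrary, but those
    points lie in the open set \<open>Z\<close>, where \<open>\<rho>\<close> is 0.\<close>
  define h where "h = (\<lambda>x (vs::('a, 'e) tvec list). \<rho> x * g x vs)"
  have h: "smooth_form A 0 UNIV h"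
  proof (rule smooth_form_local[OF atlas])
    fix x :: 'a
    consider "x \<in> V" | "x \<in> Z" using Z by blast
    then show "\<exists>U. open U \<and> x \<in> U \<and> smooth_form A 0 U h"
    proof cases
      case 1
      then show ?thesis
        using V smooth_form_mult[OF atlas V(1) smooth_form_subset[OF atlas \<rho>(1)] g(1)] unfolding h_def by blast
    next
      case 2
      have "smooth_form A 0 Z h"
        by (rule smooth_form_cong[OF atlas Z(1) smooth_form_zero[OF atlas]])
          (simp add: forms_agree_def h_def \<rho>(3))
      then show ?thesis using 2 Z by blast
    qed
  qed
  have dh: "smooth_form A 1 W (ext_deriv A h)"
    using smooth_form_ext_deriv[OF atlas _ W smooth_form_subset[OF atlas h]] by simp
  have ddh: "ext_deriv A (ext_deriv A h) x vs = 0" if "vs \<in> tvecs A 2 x" for x vs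
    using ext_deriv_ext_deriv[OF atlas _ open_UNIV UNIV_I h] that by (simp add: t2)
  have s1: "smooth_form A 1 W (\<lambda>x vs. \<alpha> x vs - \<theta> x vs)" by (rule smooth_form_diff[OF atlas W \<alpha> s\<theta>])
  show ?thesis
  proof (rule that)
    show "smooth_form A 1 W (\<lambda>x vs. (\<alpha> x vs - \<theta> x vs) + ext_deriv A h x vs)"
      by (rule smooth_form_add[OF atlas W s1 dh])
    show "ext_deriv A (\<lambda>x vs. (\<alpha> x vs - \<theta> x vs) + ext_deriv A h x vs) x vs = ext_deriv A \<alpha> x vs"
      if "x \<in> W" and vs: "vs \<in> tvecs A 2 x" for x vs
    proof -
      have vs': "vs \<in> tvecs A (Suc 1) x" using vs by (simp add: t2)
      show ?thesis
        unfolding ext_deriv_add[OF atlas that(1) s1 dh vs'] ext_deriv_diff[OF atlas W that(1) \<alpha> s\<theta> vs'] ddh[OF vs]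
        using \<theta>W that(1) vs' by (simp add: closed_form_iff)
    qed
    show "forms_agree A 1 N (\<lambda>x vs. (\<alpha> x vs - \<theta> x vs) + ext_deriv A h x vs) \<alpha>0"
      unfolding forms_agree_def
    proof (intro ballI)
      fix x vs assume x: "x \<in> N" and vs: "vs \<in> tvecs A 1 x"
      \<comment> \<open>On \<open>N\<close> the function \<open>h\<close> is \<open>g\<close>, and
        \<open>dg = \<theta> - \<delta>\<close> there, so the corrected primitive collapses to
        \<open>\<alpha> - \<delta> = \<alpha>0\<close>.\<close>
      have "ext_deriv A h x vs = ext_deriv A g x vs"
        by (rule ext_deriv_cong[OF atlas N(1) x, of 0])
          (use vs in \<open>auto simp: forms_agree_def h_def \<rho>(2)\<close>)
      then show "(\<alpha> x vs - \<theta> x vs) + ext_deriv A h x vs = \<alpha>0 x vs"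
        using g(2)[of x vs] x vs N by (auto simp: \<delta>_def)
    qed
  qed
qed

subsection \<open>Taming for small parameters\<close>

text \<open>Continuity of the form is given for fixed arguments only. Expanding both slots in
  \<open>basis_set\<close> makes it joint in \<open>u\<close> and \<open>e\<close>, using no more
  than continuity of \<open>j\<close>.\<close>

lemma continuous_on_form_2:
  assumes "eform 2 S \<alpha>" "continuous_on (S \<times> UNIV) (\<lambda>(u, e). j u e)"
  shows "continuous_on (S \<times> UNIV) (\<lambda>(u, e). \<alpha> u [e, j u e :: 'e])"
proof (rule continuous_on_eq)
  have a: "continuous_on (S \<times> UNIV) (\<lambda>p. \<alpha> (fst p) [b, b'])" for b b'
    using eform_smooth[OF assms(1), of "[b, b']"]
    by (intro continuous_on_compose2[OF smooth_on_continuous_on continuous_on_fst[OF continuous_on_id]]) auto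
  have e: "continuous_on (S \<times> UNIV) (\<lambda>p. coef b (snd p))" for b :: 'e
    by (intro bounded_linear.continuous_on[OF bounded_linear_coef] continuous_intros)
  have j: "continuous_on (S \<times> UNIV) (\<lambda>p. coef b (j (fst p) (snd p)))" for b
    using bounded_linear.continuous_on[OF bounded_linear_coef assms(2)] by (simp add: case_prod_beta')
  show "continuous_on (S \<times> UNIV) (\<lambda>p. \<Sum>b\<in>basis_set. \<Sum>b'\<in>basis_set.
      coef b (snd p) * (coef b' (j (fst p) (snd p)) * \<alpha> (fst p) [b, b']))"
    by (intro continuous_on_sum continuous_on_mult a e j)
  show "(\<Sum>b\<in>basis_set. \<Sum>b'\<in>basis_set.
      coef b (snd p) * (coef b' (j (fst p) (snd p)) * \<alpha> (fst p) [b, b'])) = (\<lambda>(u, e). \<alpha> u [e, j u e]) p"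
    if "p \<in> S \<times> UNIV" for p
  proof -
    obtain u e where p: "p = (u, e)" "u \<in> S" using \<open>p \<in> S \<times> UNIV\<close> by (cases p) auto
    have l: "linear (\<lambda>e. \<alpha> u [e, f])" "linear (\<lambda>f. \<alpha> u [e, f])" for e f
      using assms(1) p(2) by (auto simp: eform_2 numeral_2_eq_2)
    show ?thesis
      using linear_basis_expansion[OF l(1), of e "j u e"]
      by (simp add: p sum_distrib_left[symmetric] linear_basis_expansion[OF l(2), of _ "j u e"])
  qed
qed

text \<open>Applied with \<open>F\<close> and \<open>G\<close> the values of \<open>\<eta>\<close>
  and \<open>f\<^sup>*\<omega>\<^sub>Y\<close> on \<open>(v, Jv)\<close>. Where \<open>F\<close> is
  positive every \<open>t > 0\<close> works, so only the compact set \<open>R\<close> restricts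
  \<open>t\<close>.\<close>

lemma compact_positive_combination:
  fixes F G :: "'c::topological_space \<Rightarrow> real"
  assumes Q: "compact Q" and F: "continuous_on Q F" and G: "continuous_on Q G"
    and pos: "\<And>q. q \<in> Q \<Longrightarrow> G q \<ge> 0" "\<And>q. q \<in> Q \<Longrightarrow> G q = 0 \<Longrightarrow> F q > 0"
  obtains t0 where "t0 > 0" "\<And>t q. 0 < t \<Longrightarrow> t < t0 \<Longrightarrow> q \<in> Q \<Longrightarrow> t * F q + G q > 0"
proof -
  define R where "R = Q \<inter> F -` {..0}"
  have "compact R"
  proof -
    obtain T where "closed T" "T \<inter> Q = F -` {..0} \<inter> Q"
      using continuous_on_closed_invariant[of Q F] F by (metis closed_atMost)
    then show ?thesis using compact_Int_closed[OF Q, of T] by (simp add: R_def Int_commute)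
  qed
  show ?thesis
  proof (cases "R = {}")
    case True
    have "t * F q + G q > 0" if "0 < t" "q \<in> Q" for t q
      using that True pos(1)[OF that(2)] by (force simp: R_def intro: add_pos_nonneg)
    then show ?thesis using that[of 1] by simp
  next
    case False
    have c: "continuous_on R F" "continuous_on R G"
      using F G by (auto simp: R_def intro: continuous_on_subset)
    obtain m where m: "m \<in> R" "\<And>q. q \<in> R \<Longrightarrow> G m \<le> G q"
      using continuous_attains_inf[OF \<open>compact R\<close> False c(2)] by blast
    obtain n where n: "n \<in> R" "\<And>q. q \<in> R \<Longrightarrow> F n \<le> F q"
      using continuous_attains_inf[OF \<open>compact R\<close> False c(1)] by blast
    have Gm: "G m > 0" using m pos(1)[of m] pos(2)[of m] by (force simp: R_def)
    have Fn: "1 - F n > 0" using n by (simp add: R_def)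
    show ?thesis
    proof (rule that)
      \<comment> \<open>On \<open>R\<close> the combination is at least
        \<open>t * F n + G m\<close>, which exceeds \<open>t\<close> as soon as
        \<open>t * (1 - F n) < G m\<close>. The 1 keeps the denominator positive when
        \<open>F n = 0\<close>.\<close>
      show "G m / (1 - F n) > 0" using Gm Fn by simp
      fix t q assume t: "0 < t" "t < G m / (1 - F n)" and q: "q \<in> Q"
      show "t * F q + G q > 0"
      proof (cases "q \<in> R")
        case True
        have "t * (1 - F n) < G m" using t Fn by (simp add: pos_less_divide_eq)
        moreover have "t * F n \<le> t * F q" using t n(2)[OF True] by simp
        moreover have "t * (1 - F n) = t - t * F n" by (simp add: right_diff_distrib)
        ultimately show ?thesis using m(2)[OF True] t(1) by linarith
      next
        case False
        then show ?thesis using t q pos(1)[OF q] by (auto simp: R_def intro: add_pos_nonneg)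
      qed
    qed
  qed
qed

text \<open>Around each point the estimate is made in one chart, over a closed coordinate ball times
  the coordinate unit sphere; this takes the place of a metric on X. Finitely many of these
  neighborhoods cover \<open>K\<close>.\<close>

lemma tames_for_small_parameters:
  assumes \<eta>: "smooth_form A 2 UNIV \<eta>" and \<theta>: "smooth_form A 2 UNIV \<theta>" and J: "almost_complex A J"
    and K: "compact K"
    and nonneg: "\<And>x v. v \<in> tangent_space A x \<Longrightarrow> \<theta> x [v, J x v] \<ge> 0"
    and pos: "\<And>x v. v \<in> tangent_space A x \<Longrightarrow> v \<noteq> 0 \<Longrightarrow> \<theta> x [v, J x v] = 0 \<Longrightarrow> \<eta> x [v, J x v] > 0"
  obtains t0 where "t0 > 0"
    "\<And>t. 0 < t \<Longrightarrow> t < t0 \<Longrightarrow> tames_over A (\<lambda>x vs. t * \<eta> x vs + \<theta> x vs) J K"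
proof -
  define good where "good U t0 \<longleftrightarrow> open U \<and> t0 > 0 \<and>
      (\<forall>t. 0 < t \<and> t < t0 \<longrightarrow> tames_over A (\<lambda>x vs. t * \<eta> x vs + \<theta> x vs) J U)" for U t0
  have loc: "\<exists>U t0. p \<in> U \<and> good U t0" for p
  proof -
    obtain c where c: "c \<in> charts_at A p" using charts_at_nonempty[OF atlas] by blast
    then have cA: "c \<in> A" "p \<in> fst c" by (auto simp: charts_at_iff[OF atlas])
    define S where "S = snd c ` fst c"
    have S: "open S" "snd c p \<in> S" using open_chart_range[OF atlas cA(1)] cA by (auto simp: S_def)
    then obtain r where r: "r > 0" "cball (snd c p) r \<subseteq> S" using open_contains_cball by blast
    define j where "j u e = J (chart_inv c u) (coord_vec A c (chart_inv c u) e) c" for u e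
    define H where "H \<omega> = (\<lambda>(u, e). local_rep A c \<omega> u [e, j u e])" for \<omega>
    have cj: "continuous_on (S \<times> UNIV) (\<lambda>(u, e). j u e)"
      using J cA by (auto simp: almost_complex_def S_def j_def)
    have cH: "continuous_on (S \<times> UNIV) (H \<omega>)" if "smooth_form A 2 UNIV \<omega>" for \<omega>
      unfolding H_def using that cA by (intro continuous_on_form_2 cj) (auto simp: smooth_form_iff[OF atlas] S_def)
    define Q where "Q = cball (snd c p) r \<times> sphere (0::'e) 1"
    have QS: "Q \<subseteq> S \<times> UNIV" using r by (auto simp: Q_def)
    \<comment> \<open>The sphere is compact because it is closed and bounded, by the Heine-Borel
      property of the model space.\<close>
    have "closed {e::'e. norm e = 1}" by (intro closed_Collect_eq continuous_intros)
    moreover have "sphere 0 1 = {e::'e. norm e = 1}" by auto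
    ultimately have "compact (sphere (0::'e) 1)"
      using bounded_subset[OF bounded_cball sphere_cball, of "0::'e" 1]
      by (simp add: compact_eq_bounded_closed)
    then have "compact Q" unfolding Q_def by (intro compact_Times compact_cball)
    have JT: "J x v \<in> tangent_space A x" if "v \<in> tangent_space A x" for x v
      using J that by (simp add: almost_complex_def)
    have Hx: "H \<omega> (snd c x, v c) = \<omega> x [v, J x v]" if x: "x \<in> fst c" and v: "v \<in> tangent_space A x" for \<omega> x v
    proof -
      have cx: "c \<in> charts_at A x" using x cA by (simp add: charts_at_iff[OF atlas])
      have "j (snd c x) (v c) = J x v c"
        by (simp add: j_def chart_inv_chart[OF atlas cA(1) x] coord_vec_eta[OF atlas cx v])
      then show ?thesis
        by (simp add: H_def local_rep_chart[OF atlas cx] coord_vec_eta[OF atlas cx v]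
            coord_vec_eta[OF atlas cx JT[OF v]])
    qed
    have Hpt: "\<exists>x v. x \<in> fst c \<and> v \<in> tangent_space A x \<and> v \<noteq> 0 \<and> q = (snd c x, v c)" if "q \<in> Q" for q
    proof -
      obtain u e where u: "q = (u, e)" "u \<in> cball (snd c p) r" "norm e = 1"
        using \<open>q \<in> Q\<close> by (cases q) (auto simp: Q_def)
      then obtain x where x: "x \<in> fst c" "q = (snd c x, e)" "norm e = 1"
        using r(2) unfolding S_def by blast
      have cx: "c \<in> charts_at A x" using x cA by (simp add: charts_at_iff[OF atlas])
      have "coord_vec A c x e \<noteq> 0" using coord_vec_zero_iff[OF atlas cx, of e] x(3) by auto
      moreover have "q = (snd c x, coord_vec A c x e c)" using x(2) coord_vec_self[OF atlas cx, of e] by simp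
      ultimately show ?thesis
        using x(1) coord_vec_in_tangent_space[OF atlas cx, of e] by blast
    qed
    have HQ: "H \<theta> q \<ge> 0" "H \<theta> q = 0 \<Longrightarrow> H \<eta> q > 0" if "q \<in> Q" for q
      using Hpt[OF that] nonneg pos Hx by auto
    obtain t0 where t0: "t0 > 0" "\<And>t q. 0 < t \<Longrightarrow> t < t0 \<Longrightarrow> q \<in> Q \<Longrightarrow> t * H \<eta> q + H \<theta> q > 0"
      using compact_positive_combination[OF \<open>compact Q\<close> continuous_on_subset[OF cH[OF \<eta>] QS]
          continuous_on_subset[OF cH[OF \<theta>] QS] HQ] by blast
    define U where "U = fst c \<inter> snd c -` ball (snd c p) r"
    have "continuous_on (fst c) (snd c)"
      using chart_homeomorphism[OF atlas cA(1)] by (simp add: homeomorphism_def)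
    then have "open U"
      using continuous_on_open_vimage[OF open_chart_domain[OF atlas cA(1)], of "snd c"]
      by (auto simp: U_def Int_commute)
    moreover have "p \<in> U" using cA r by (simp add: U_def)
    moreover have "tames_over A (\<lambda>x vs. t * \<eta> x vs + \<theta> x vs) J U" if t: "0 < t" "t < t0" for t
      unfolding tames_over_def tames_at_def
    proof (intro ballI impI)
      fix x v assume x: "x \<in> U" and v: "v \<in> tangent_space A x" "v \<noteq> 0"
      have xc: "x \<in> fst c" using x by (simp add: U_def)
      have cx: "c \<in> charts_at A x" using xc cA by (simp add: charts_at_iff[OF atlas])
      have v0: "v c \<noteq> 0"
        using coord_vec_eta[OF atlas cx v(1)] coord_vec_zero_iff[OF atlas cx, of 0] v(2) by auto
      \<comment> \<open>Since \<open>J\<close> is linear, both forms are quadratic in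
        \<open>v\<close> on the pair \<open>(v, Jv)\<close>; positivity may therefore be tested
        after rescaling to coordinate norm 1.\<close>
      define s where "s = 1 / norm (v c)"
      define w where "w = s *\<^sub>R v"
      have s: "s > 0" using v0 by (simp add: s_def)
      have w: "w \<in> tangent_space A x" unfolding w_def by (rule tangent_space_scaleR[OF atlas v(1)])
      have "norm (w c) = 1" using v0 by (simp add: w_def s_def scaleR_fun_apply)
      then have "(snd c x, w c) \<in> Q" using x by (simp add: Q_def U_def)
      from t0(2)[OF t this] have p: "t * \<eta> x [w, J x w] + \<theta> x [w, J x w] > 0"
        by (simp add: Hx[OF xc w])
      have Jw: "J x (s *\<^sub>R v) = s *\<^sub>R J x v" using J v by (simp add: almost_complex_def)
      have sc: "\<omega> x [w, J x w] = s * (s * \<omega> x [v, J x v])" if "smooth_form A 2 UNIV \<omega>" for \<omega>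
      proof -
        have "alternating_at A 2 x (\<omega> x)" using that by (simp add: smooth_form_def)
        note alt = alternating_at_2[OF atlas this]
        show ?thesis
          unfolding w_def Jw
          using alt(3)[OF v(1) v(1) tangent_space_scaleR[OF atlas JT[OF v(1)]]] alt(4)[OF JT[OF v(1)] v(1) v(1)]
          by simp
      qed
      have "s * s * (t * \<eta> x [v, J x v] + \<theta> x [v, J x v]) > 0"
        using p by (simp add: sc[OF \<eta>] sc[OF \<theta>] algebra_simps)
      then show "t * \<eta> x [v, J x v] + \<theta> x [v, J x v] > 0"
        using s by (simp add: zero_less_mult_iff)
    qed
    ultimately have "p \<in> U \<and> good U t0" using t0(1) unfolding good_def by blast
    then show ?thesis by blast
  qed
  then obtain U t0 where "\<And>p. p \<in> U p \<and> good (U p) (t0 p)"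
    by metis
  note Ut = this[unfolded good_def]
  obtain P where P: "P \<subseteq> K" "finite P" "K \<subseteq> (\<Union>p\<in>P. U p)"
    using compactE_image[OF K, of K U] Ut by blast
  \<comment> \<open>The entry 1 keeps the set nonempty when no neighborhoods are needed.\<close>
  define T where "T = Min (insert 1 (t0 ` P))"
  have T: "T > 0" "\<And>p. p \<in> P \<Longrightarrow> T \<le> t0 p" using P Ut by (auto simp: T_def)
  show ?thesis
  proof (rule that[OF T(1)])
    fix t assume t: "0 < t" "t < T"
    have "tames_over A (\<lambda>x vs. t * \<eta> x vs + \<theta> x vs) J (U p)" if "p \<in> P" for p
      using Ut[of p] t T(2)[OF that] by simp
    then show "tames_over A (\<lambda>x vs. t * \<eta> x vs + \<theta> x vs) J K"
      using P(3) unfolding tames_over_def by blast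
  qed
qed

end

text \<open>Phrased for a primitive relative to the fixed \<open>\<zeta>\<close>, because the gluing
  acts on primitives and \<open>\<zeta>\<close> never changes.\<close>

definition tames_fibers ::
  "('a, 'e::real_normed_vector) atlas \<Rightarrow> ('b, 'h::real_normed_vector) atlas \<Rightarrow> ('a \<Rightarrow> 'b) \<Rightarrow>
   ('a \<Rightarrow> ('a, 'e) tvec \<Rightarrow> ('a, 'e) tvec) \<Rightarrow> ('a, 'e) dform \<Rightarrow> 'a set \<Rightarrow> ('a, 'e) dform \<Rightarrow> bool" where
  "tames_fibers A B f J \<zeta> D \<beta> \<longleftrightarrow>
     (\<forall>x\<in>D. tames_at (\<lambda>x vs. \<zeta> x vs + ext_deriv A \<beta> x vs) J x (ker_differential A B f x))"

section \<open>Pullback of forms\<close>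

context
  fixes A :: "('a::{t2_space, second_countable_topology}, 'e::{real_inner, heine_borel}) atlas"
    and B :: "('b::{t2_space, second_countable_topology}, 'h::{real_inner, heine_borel}) atlas"
    and f :: "'a \<Rightarrow> 'b"
  assumes atlas_A: "smooth_atlas A" and atlas_B: "smooth_atlas B" and smooth_f: "smooth_map A B f"
begin

lemma open_vimage_smooth_map: "open V \<Longrightarrow> open (f -` V)"
  using smooth_f by (simp add: smooth_map_def open_vimage)

lemma smooth_on_coordinate_map:
  "c \<in> A \<Longrightarrow> d \<in> B \<Longrightarrow> smooth_on (snd c ` (fst c \<inter> f -` fst d)) (snd d \<circ> f \<circ> chart_inv c)"
  using smooth_f by (auto simp: smooth_map_def)

lemma open_coordinate_domain: "c \<in> A \<Longrightarrow> d \<in> B \<Longrightarrow> open (snd c ` (fst c \<inter> f -` fst d))"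
  by (intro open_chart_image[OF atlas_A] open_vimage_smooth_map open_chart_domain[OF atlas_B])

lemma coordinate_map_has_derivative:
  assumes "c \<in> charts_at A x" "d \<in> charts_at B (f x)"
  shows "((snd d \<circ> f \<circ> chart_inv c) has_derivative
    frechet_derivative (snd d \<circ> f \<circ> chart_inv c) (at (snd c x))) (at (snd c x))"
  using assms by (intro smooth_on_has_derivative[OF smooth_on_coordinate_map])
    (auto simp: charts_at_iff[OF atlas_A] charts_at_iff[OF atlas_B])

text \<open>Both sides differentiate \<open>f\<close> read from \<open>c\<close> to
  \<open>d'\<close>, factored once through \<open>c'\<close> and once through \<open>d\<close>. This
  makes the differential independent of the charts.\<close>

lemma coordinate_map_derivative_change:
  assumes c: "c \<in> charts_at A x" "c' \<in> charts_at A x" and d: "d \<in> charts_at B (f x)" "d' \<in> charts_at B (f x)"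
  shows "frechet_derivative (snd d' \<circ> f \<circ> chart_inv c') (at (snd c' x))
      (frechet_derivative (transition c c') (at (snd c x)) e) =
    frechet_derivative (transition d d') (at (snd d (f x)))
      (frechet_derivative (snd d \<circ> f \<circ> chart_inv c) (at (snd c x)) e)"
proof -
  have cA: "c \<in> A" "c' \<in> A" "x \<in> fst c" "x \<in> fst c'" and dB: "d \<in> B" "d' \<in> B" "f x \<in> fst d" "f x \<in> fst d'"
    using c d by (auto simp: charts_at_iff[OF atlas_A] charts_at_iff[OF atlas_B])
  let ?S = "snd c ` (fst c \<inter> (fst c' \<inter> f -` (fst d \<inter> fst d')))"
  have S: "open ?S" "snd c x \<in> ?S"
    using cA dB by (auto intro!: open_chart_image[OF atlas_A] open_vimage_smooth_map
        open_chart_domain[OF atlas_A] open_chart_domain[OF atlas_B] open_Int simp del: vimage_Int)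
  have 1: "((\<lambda>u. (snd d' \<circ> f \<circ> chart_inv c') (transition c c' u)) has_derivative
      (\<lambda>e. frechet_derivative (snd d' \<circ> f \<circ> chart_inv c') (at (snd c' x))
        (frechet_derivative (transition c c') (at (snd c x)) e))) (at (snd c x))"
    by (rule has_derivative_compose[OF transition_has_derivative[OF atlas_A c]],
        unfold transition_chart[OF atlas_A cA(1,3)], rule coordinate_map_has_derivative[OF c(2) d(2)])
  have 2: "((\<lambda>u. transition d d' ((snd d \<circ> f \<circ> chart_inv c) u)) has_derivative
      (\<lambda>e. frechet_derivative (transition d d') (at (snd d (f x)))
        (frechet_derivative (snd d \<circ> f \<circ> chart_inv c) (at (snd c x)) e))) (at (snd c x))"
    by (rule has_derivative_compose[OF coordinate_map_has_derivative[OF c(1) d(1)]],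
        unfold o_apply chart_inv_chart[OF atlas_A cA(1,3)], rule transition_has_derivative[OF atlas_B d])
  have "((\<lambda>u. transition d d' ((snd d \<circ> f \<circ> chart_inv c) u)) has_derivative
      (\<lambda>e. frechet_derivative (snd d' \<circ> f \<circ> chart_inv c') (at (snd c' x))
        (frechet_derivative (transition c c') (at (snd c x)) e))) (at (snd c x))"
    by (rule has_derivative_transform_within_open[OF 1 S])
      (use cA dB in \<open>auto simp: transition_chart[OF atlas_A] transition_chart[OF atlas_B]
        chart_inv_chart[OF atlas_A]\<close>)
  from has_derivative_unique[OF this 2] show ?thesis by metis
qed

lemma differential_coord_vec:
  assumes c: "c \<in> charts_at A x" and d: "d \<in> charts_at B (f x)"
  shows "differential A B f x (coord_vec A c x e) =
    coord_vec B d (f x) (frechet_derivative (snd d \<circ> f \<circ> chart_inv c) (at (snd c x)) e)"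
proof
  fix d'
  have s: "(SOME c. c \<in> charts_at A x) \<in> charts_at A x" by (rule some_chart[OF atlas_A])
  show "differential A B f x (coord_vec A c x e) d' =
    coord_vec B d (f x) (frechet_derivative (snd d \<circ> f \<circ> chart_inv c) (at (snd c x)) e) d'"
    using coordinate_map_derivative_change[OF c s d, of d' e]
    by (simp add: differential_def Let_def coord_vec_def[of B] coord_vec_apply[OF atlas_A s])
qed

lemma differential_zero: "differential A B f x 0 = 0"
proof -
  obtain c where c: "c \<in> charts_at A x" using charts_at_nonempty[OF atlas_A] by blast
  obtain d where d: "d \<in> charts_at B (f x)" using charts_at_nonempty[OF atlas_B] by blast
  have "frechet_derivative (snd d \<circ> f \<circ> chart_inv c) (at (snd c x)) 0 = 0"
    using has_derivative_linear[OF coordinate_map_has_derivative[OF c d]] by (rule linear_0)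
  then show ?thesis
    using differential_coord_vec[OF c d, of 0] coord_vec_zero_iff[OF atlas_A c, of 0]
      coord_vec_zero_iff[OF atlas_B d, of 0] by simp
qed

lemma local_rep_pullback:
  assumes c: "c \<in> charts_at A x" and d: "d \<in> charts_at B (f x)"
  shows "local_rep A c (pullback A B f \<omega>) (snd c x) es =
    epull (snd d \<circ> f \<circ> chart_inv c) (local_rep B d \<omega>) (snd c x) es"
proof -
  have 1: "map (differential A B f x) (map (coord_vec A c x) es) = map (coord_vec B d (f x))
      (map (frechet_derivative (snd d \<circ> f \<circ> chart_inv c) (at (snd c x))) es)"
    by (simp add: differential_coord_vec[OF c d])
  have 2: "(snd d \<circ> f \<circ> chart_inv c) (snd c x) = snd d (f x)"
    using c by (simp add: charts_at_iff[OF atlas_A] chart_inv_chart[OF atlas_A])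
  show ?thesis
    unfolding local_rep_chart[OF atlas_A c] pullback_def 1 epull_def 2 local_rep_chart[OF atlas_B d] ..
qed

lemma smooth_form_pullback:
  assumes k: "k \<le> 2" and \<omega>: "smooth_form B k UNIV \<omega>"
  shows "smooth_form A k UNIV (pullback A B f \<omega>)"
  unfolding smooth_form_iff[OF atlas_A]
proof (intro ballI eform_local)
  fix c u assume c: "c \<in> A" and "u \<in> snd c ` (fst c \<inter> UNIV)"
  then obtain x where x: "x \<in> fst c" "u = snd c x" by auto
  obtain d where d: "d \<in> charts_at B (f x)" using charts_at_nonempty[OF atlas_B] by blast
  then have dB: "d \<in> B" "f x \<in> fst d" by (auto simp: charts_at_iff[OF atlas_B])
  let ?S = "snd c ` (fst c \<inter> f -` fst d)"
  note S = open_coordinate_domain[OF c dB(1)]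
  have "eform k ?S (epull (snd d \<circ> f \<circ> chart_inv c) (local_rep B d \<omega>))"
    using \<omega> dB c
    by (intro eform_epull[OF k _ S open_chart_range[OF atlas_B dB(1)] smooth_on_coordinate_map[OF c dB(1)]])
      (auto simp: smooth_form_iff[OF atlas_B] chart_inv_chart[OF atlas_A])
  then have "eform k ?S (local_rep A c (pullback A B f \<omega>))"
  proof (rule eform_cong[OF S])
    fix v es assume "v \<in> ?S"
    then obtain z where z: "z \<in> fst c" "f z \<in> fst d" "v = snd c z" by auto
    show "epull (snd d \<circ> f \<circ> chart_inv c) (local_rep B d \<omega>) v es = local_rep A c (pullback A B f \<omega>) v es"
      unfolding z(3) by (rule local_rep_pullback[symmetric])
        (use z c dB in \<open>auto simp: charts_at_iff[OF atlas_A] charts_at_iff[OF atlas_B]\<close>)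
  qed
  then show "\<exists>U. open U \<and> u \<in> U \<and> eform k U (local_rep A c (pullback A B f \<omega>))"
    using S x dB by blast
qed

text \<open>With the charts that \<open>ext_deriv\<close> and \<open>differential\<close> themselves
  choose, the claim is coordinate naturality of \<open>d\<close> for a single coordinate
  map.\<close>

lemma ext_deriv_pullback:
  assumes k: "k \<le> 2" and \<omega>: "smooth_form B k UNIV \<omega>" and vs: "vs \<in> tvecs A (Suc k) x"
  shows "ext_deriv A (pullback A B f \<omega>) x vs = ext_deriv B \<omega> (f x) (map (differential A B f x) vs)"
proof -
  define c where "c = (SOME c. c \<in> charts_at A x)"
  define d where "d = (SOME d. d \<in> charts_at B (f x))"
  have c: "c \<in> charts_at A x" unfolding c_def by (rule some_chart[OF atlas_A])
  have d: "d \<in> charts_at B (f x)" unfolding d_def by (rule some_chart[OF atlas_B])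
  have cA: "c \<in> A" "x \<in> fst c" and dB: "d \<in> B" "f x \<in> fst d"
    using c d by (auto simp: charts_at_iff[OF atlas_A] charts_at_iff[OF atlas_B])
  let ?S = "snd c ` (fst c \<inter> f -` fst d)" and ?\<phi> = "snd d \<circ> f \<circ> chart_inv c"
  have S: "open ?S" "snd c x \<in> ?S" using open_coordinate_domain[OF cA(1) dB(1)] cA dB by auto
  have len: "length (map (\<lambda>v. v c) vs) = Suc k" using vs by (simp add: tvecs_def)
  have "ext_deriv A (pullback A B f \<omega>) x vs =
      euclidean_ext_deriv (local_rep A c (pullback A B f \<omega>)) (snd c x) (map (\<lambda>v. v c) vs)"
    by (simp add: ext_deriv_some[OF atlas_A] c_def)
  also have "\<dots> = euclidean_ext_deriv (epull ?\<phi> (local_rep B d \<omega>)) (snd c x) (map (\<lambda>v. v c) vs)"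
  proof (rule euclidean_ext_deriv_cong[OF S len])
    fix v es assume "v \<in> ?S"
    then obtain z where z: "z \<in> fst c" "f z \<in> fst d" "v = snd c z" by auto
    show "local_rep A c (pullback A B f \<omega>) v es = epull ?\<phi> (local_rep B d \<omega>) v es"
      unfolding z(3) by (rule local_rep_pullback)
        (use z cA dB in \<open>auto simp: charts_at_iff[OF atlas_A] charts_at_iff[OF atlas_B]\<close>)
  qed
  also have "\<dots> = euclidean_ext_deriv (local_rep B d \<omega>) (?\<phi> (snd c x))
      (map (frechet_derivative ?\<phi> (at (snd c x))) (map (\<lambda>v. v c) vs))"
    using \<omega> dB cA
    by (intro euclidean_ext_deriv_epull[OF k _ S(1) open_chart_range[OF atlas_B dB(1)]
          smooth_on_coordinate_map[OF cA(1) dB(1)] _ S(2) len])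
      (auto simp: smooth_form_iff[OF atlas_B] chart_inv_chart[OF atlas_A])
  also have "?\<phi> (snd c x) = snd d (f x)" using cA by (simp add: chart_inv_chart[OF atlas_A])
  also have "map (frechet_derivative ?\<phi> (at (snd c x))) (map (\<lambda>v. v c) vs) =
      map (\<lambda>w. w d) (map (differential A B f x) vs)"
    using d by (simp add: differential_def Let_def c_def[symmetric])
  also have "euclidean_ext_deriv (local_rep B d \<omega>) (snd d (f x)) (map (\<lambda>w. w d) (map (differential A B f x) vs)) =
      ext_deriv B \<omega> (f x) (map (differential A B f x) vs)"
    by (simp add: ext_deriv_some[OF atlas_B] d_def)
  finally show ?thesis .
qed

lemma differential_in_tangent_space:
  assumes v: "v \<in> tangent_space A x"
  shows "differential A B f x v \<in> tangent_space B (f x)"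
proof -
  obtain c where c: "c \<in> charts_at A x" using charts_at_nonempty[OF atlas_A] by blast
  obtain d where d: "d \<in> charts_at B (f x)" using charts_at_nonempty[OF atlas_B] by blast
  show ?thesis
    using differential_coord_vec[OF c d, of "v c"] coord_vec_in_tangent_space[OF atlas_B d]
      coord_vec_eta[OF atlas_A c v] by simp
qed

lemma closed_form_pullback:
  assumes k: "k \<le> 2" and \<omega>: "closed_form B k UNIV \<omega>"
  shows "closed_form A k UNIV (pullback A B f \<omega>)"
proof -
  have s: "smooth_form B k UNIV \<omega>" using \<omega> by (simp add: closed_form_iff[OF atlas_B])
  have "map (differential A B f x) vs \<in> tvecs B (Suc k) (f x)" if "vs \<in> tvecs A (Suc k) x" for x vs
    using that differential_in_tangent_space by (auto simp: tvecs_def)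
  then show ?thesis
    using \<omega> smooth_form_pullback[OF k s] ext_deriv_pullback[OF k s]
    by (simp add: closed_form_iff[OF atlas_A] closed_form_iff[OF atlas_B])
qed

lemma smooth_form_compose:
  assumes "smooth_form B 0 UNIV (\<lambda>y vs. b y)"
  shows "smooth_form A 0 UNIV (\<lambda>x vs. b (f x))"
  using smooth_form_pullback[of 0, OF _ assms] by (simp add: pullback_def)

text \<open>By naturality this is the linear form \<open>db\<close> evaluated at the vector
  \<open>df(v) = 0\<close>.\<close>

lemma ext_deriv_compose_kernel:
  assumes b: "smooth_form B 0 UNIV (\<lambda>y vs. b y)" and v: "v \<in> ker_differential A B f x"
  shows "ext_deriv A (\<lambda>x vs. b (f x)) x [v] = 0"
proof -
  define d where "d = (SOME d. d \<in> charts_at B (f x))"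
  have d: "d \<in> B" "f x \<in> fst d"
    using some_chart[OF atlas_B, of "f x"] by (auto simp: d_def charts_at_iff[OF atlas_B])
  have v': "[v] \<in> tvecs A (Suc 0) x" "differential A B f x v = 0"
    using v by (auto simp: ker_differential_def tvecs_1[OF atlas_A])
  have "smooth_on (snd d ` fst d) (\<lambda>u. local_rep B d (\<lambda>y vs. b y) u [])"
    using b d by (simp add: smooth_form_iff[OF atlas_B] eform_0)
  then have "linear (frechet_derivative (\<lambda>u. local_rep B d (\<lambda>y vs. b y) u []) (at (snd d (f x))))"
    using d by (intro smooth_on_linear_derivative) auto
  then have "ext_deriv B (\<lambda>y vs. b y) (f x) [0] = 0"
    by (simp add: ext_deriv_some[OF atlas_B] d_def[symmetric] euclidean_ext_deriv_0 linear_0)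
  then show ?thesis
    using ext_deriv_pullback[of 0, OF _ b v'(1)] v'(2) by (simp add: pullback_def)
qed

section \<open>Gluing along the target\<close>

context
  fixes J :: "'a \<Rightarrow> ('a, 'e) tvec \<Rightarrow> ('a, 'e) tvec" and \<zeta> :: "('a, 'e) dform"
  assumes ker_J: "\<And>x v. v \<in> ker_differential A B f x \<Longrightarrow> J x v \<in> ker_differential A B f x"
begin

text \<open>The differentials are compared on tangent vectors only; \<open>ker_J\<close> guarantees
  that \<open>J x v\<close> is one when \<open>v\<close> is in the kernel.\<close>

lemma tames_fibers_cong:
  assumes "tames_fibers A B f J \<zeta> D \<beta>" "E \<subseteq> D"
    "\<And>x vs. x \<in> E \<Longrightarrow> vs \<in> tvecs A 2 x \<Longrightarrow> ext_deriv A \<gamma> x vs = ext_deriv A \<beta> x vs"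
  shows "tames_fibers A B f J \<zeta> E \<gamma>"
proof -
  have "[v, J x v] \<in> tvecs A 2 x" if "v \<in> ker_differential A B f x" for v x
    using that ker_J[OF that] by (simp add: tvecs_2[OF atlas_A] ker_differential_def)
  then show ?thesis using assms(1,2) assms(3) unfolding tames_fibers_def tames_at_def
    by (simp add: subset_iff)
qed

text \<open>
  The glued primitive is \<open>\<beta> + (b \<circ> f) (\<alpha> - \<beta>)\<close>. The junk values of \<open>\<alpha>\<close> off \<open>W\<close> and of \<open>\<beta>\<close> off \<open>D\<close> are
  harmless, because the coefficients of \<open>\<alpha>\<close> and \<open>\<beta>\<close> vanish near the points where they matter.
\<close>

lemma glue_primitives:
  assumes D: "open D" and W: "open W" and N: "N \<subseteq> D"
    and \<beta>: "smooth_form A 1 D \<beta>" "tames_fibers A B f J \<zeta> D \<beta>"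
    and \<alpha>: "smooth_form A 1 W \<alpha>" "tames_fibers A B f J \<zeta> W \<alpha>" "forms_agree A 1 N \<alpha> \<beta>"
    and bump: "bump B b V F" and F: "f -` F \<subseteq> W"
  obtains \<gamma> where "smooth_form A 1 (D \<union> f -` V) \<gamma>" "tames_fibers A B f J \<zeta> (D \<union> f -` V) \<gamma>" "forms_agree A 1 N \<gamma> \<beta>"
proof -
  note b = bump[unfolded bump_def]
  define \<gamma> where "\<gamma> = (\<lambda>x vs. \<beta> x vs + b (f x) * (\<alpha> x vs - \<beta> x vs))"
  have cases: "\<exists>U. open U \<and> x \<in> U \<and> smooth_form A 1 U \<gamma> \<and> tames_fibers A B f J \<zeta> U \<gamma>" if x: "x \<in> D \<union> f -` V" for x
  proof -
    \<comment> \<open>Near \<open>x\<close> the function \<open>b \<circ> f\<close> is 1 in the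
      first case, so \<open>\<gamma>\<close> is \<open>\<alpha>\<close>; it is 0 in the second, so
      \<open>\<gamma>\<close> is \<open>\<beta>\<close>. Only in the third are both used, and there
      both are smooth. The cases are exhaustive because \<open>f x \<in> F\<close> forces
      \<open>x \<in> W\<close>.\<close>
    consider (v) "f x \<in> V" | (d) "x \<in> D" "f x \<notin> F" | (w) "x \<in> D" "x \<in> W" using x F by blast
    then show ?thesis
    proof cases
      case v
      have o: "open (f -` V)" using b by (intro open_vimage_smooth_map) simp
      have sub: "f -` V \<subseteq> W" using b F by blast
      have ag: "forms_agree A 1 (f -` V) \<alpha> \<gamma>" using b by (simp add: forms_agree_def \<gamma>_def)
      have "smooth_form A 1 (f -` V) \<gamma>"
        by (rule smooth_form_cong[OF atlas_A o smooth_form_subset[OF atlas_A \<alpha>(1) sub] ag])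
      moreover have "tames_fibers A B f J \<zeta> (f -` V) \<gamma>"
        by (rule tames_fibers_cong[OF \<alpha>(2) sub], rule ext_deriv_cong[OF atlas_A o _ forms_agree_sym[OF ag]])
          (simp_all add: numeral_2_eq_2)
      ultimately show ?thesis using o v by blast
    next
      case d
      let ?U = "D \<inter> f -` (- F)"
      have o: "open ?U" using b by (intro open_Int D open_vimage_smooth_map open_Compl) simp
      have ag: "forms_agree A 1 ?U \<beta> \<gamma>" using b by (simp add: forms_agree_def \<gamma>_def)
      have "smooth_form A 1 ?U \<gamma>"
        by (rule smooth_form_cong[OF atlas_A o smooth_form_subset[OF atlas_A \<beta>(1)] ag]) simp
      moreover have "tames_fibers A B f J \<zeta> ?U \<gamma>"
        by (rule tames_fibers_cong[OF \<beta>(2)], simp, rule ext_deriv_cong[OF atlas_A o _ forms_agree_sym[OF ag]])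
          (simp_all add: numeral_2_eq_2)
      ultimately show ?thesis using o d by blast
    next
      case w
      let ?U = "D \<inter> W"
      have o: "open ?U" using D W by blast
      have s: "smooth_form A 1 ?U \<alpha>" "smooth_form A 1 ?U \<beta>"
        using smooth_form_subset[OF atlas_A] \<alpha>(1) \<beta>(1) by blast+
      have bs: "smooth_form B 0 UNIV (\<lambda>y vs. b y)" using b by simp
      have bf: "smooth_form A 0 ?U (\<lambda>x vs. b (f x))"
        using smooth_form_subset[OF atlas_A smooth_form_compose[OF bs]] by simp
      have sd: "smooth_form A 1 ?U (\<lambda>x vs. \<alpha> x vs - \<beta> x vs)"
        by (rule smooth_form_diff[OF atlas_A o s])
      have sm: "smooth_form A 1 ?U (\<lambda>x vs. b (f x) * (\<alpha> x vs - \<beta> x vs))"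
        by (rule smooth_form_mult[OF atlas_A o bf sd])
      have "smooth_form A 1 ?U \<gamma>"
        unfolding \<gamma>_def by (rule smooth_form_add[OF atlas_A o s(2) sm])
      moreover have "tames_fibers A B f J \<zeta> ?U \<gamma>"
        unfolding tames_fibers_def tames_at_def
      proof (intro ballI impI)
        fix z v assume z: "z \<in> ?U" and v: "v \<in> ker_differential A B f z" "v \<noteq> 0"
        note Jv = ker_J[OF v(1)]
        have t: "v \<in> tangent_space A z" "J z v \<in> tangent_space A z"
          using v Jv by (auto simp: ker_differential_def)
        have tv: "[v, J z v] \<in> tvecs A (Suc 1) z" using t tvecs_2[OF atlas_A] by (simp add: numeral_2_eq_2)
        \<comment> \<open>The Leibniz terms evaluate \<open>d(b \<circ> f)\<close> at
          \<open>v\<close> and at \<open>J z v\<close>. Both lie in the kernel, the second one by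
          \<open>ker_J\<close>, so only the multiple of \<open>d(\<alpha> - \<beta>)\<close>
          remains.\<close>
        have "ext_deriv A (\<lambda>x vs. b (f x) * (\<alpha> x vs - \<beta> x vs)) z [v, J z v] =
            b (f z) * (ext_deriv A \<alpha> z [v, J z v] - ext_deriv A \<beta> z [v, J z v])"
          using ext_deriv_mult[OF atlas_A z bf _ t, of "\<lambda>x vs. \<alpha> x vs - \<beta> x vs"] sd
            ext_deriv_compose_kernel[OF bs v(1)] ext_deriv_compose_kernel[OF bs Jv]
            ext_deriv_diff[OF atlas_A o z s tv] by simp
        then have e: "ext_deriv A \<gamma> z [v, J z v] = ext_deriv A \<beta> z [v, J z v] +
            b (f z) * (ext_deriv A \<alpha> z [v, J z v] - ext_deriv A \<beta> z [v, J z v])"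
          unfolding \<gamma>_def using ext_deriv_add[OF atlas_A z s(2) sm tv] by simp
        have p: "\<zeta> z [v, J z v] + ext_deriv A \<alpha> z [v, J z v] > 0" (is "?p > 0")
          "\<zeta> z [v, J z v] + ext_deriv A \<beta> z [v, J z v] > 0" (is "?q > 0")
          using \<alpha>(2) \<beta>(2) z v unfolding tames_fibers_def tames_at_def by blast+
        have b01: "0 \<le> b (f z)" "b (f z) \<le> 1" using b by auto
        have "b (f z) * ?p + (1 - b (f z)) * ?q > 0"
        proof (cases "b (f z) = 0")
          case False
          then have "b (f z) > 0" using b01 by simp
          then show ?thesis
            using b01 by (intro add_pos_nonneg mult_pos_pos mult_nonneg_nonneg p less_imp_le[OF p(2)]) auto
        qed (use p in simp)
        then show "\<zeta> z [v, J z v] + ext_deriv A \<gamma> z [v, J z v] > 0"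
          unfolding e by (simp add: algebra_simps)
      qed
      ultimately show ?thesis using o w by blast
    qed
  qed
  show ?thesis
  proof (rule that)
    show "smooth_form A 1 (D \<union> f -` V) \<gamma>"
    proof (rule smooth_form_local[OF atlas_A])
      fix x assume "x \<in> D \<union> f -` V"
      from cases[OF this] show "\<exists>U. open U \<and> x \<in> U \<and> smooth_form A 1 U \<gamma>" by meson
    qed
    show "tames_fibers A B f J \<zeta> (D \<union> f -` V) \<gamma>"
      unfolding tames_fibers_def
    proof
      fix x assume "x \<in> D \<union> f -` V"
      from cases[OF this] obtain U where U: "x \<in> U" "tames_fibers A B f J \<zeta> U \<gamma>" by meson
      show "tames_at (\<lambda>x vs. \<zeta> x vs + ext_deriv A \<gamma> x vs) J x (ker_differential A B f x)"
        by (rule bspec[OF U(2)[unfolded tames_fibers_def] U(1)])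
    qed
    show "forms_agree A 1 N \<gamma> \<beta>" using \<alpha>(3) by (simp add: forms_agree_def \<gamma>_def)
  qed
qed

lemma glue_primitives_finite:
  assumes "finite P" and N: "open N" and \<beta>: "smooth_form A 1 N \<beta>" "tames_fibers A B f J \<zeta> N \<beta>"
    and W: "\<And>p. p \<in> P \<Longrightarrow> open (W p)"
    and \<alpha>: "\<And>p. p \<in> P \<Longrightarrow> smooth_form A 1 (W p) (\<alpha> p)" "\<And>p. p \<in> P \<Longrightarrow> tames_fibers A B f J \<zeta> (W p) (\<alpha> p)"
      "\<And>p. p \<in> P \<Longrightarrow> forms_agree A 1 N (\<alpha> p) \<beta>"
    and bump: "\<And>p. p \<in> P \<Longrightarrow> bump B (b p) (V p) (F p)" and F: "\<And>p. p \<in> P \<Longrightarrow> f -` F p \<subseteq> W p"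
  shows "\<exists>\<gamma>. smooth_form A 1 (N \<union> (\<Union>p\<in>P. f -` V p)) \<gamma> \<and> tames_fibers A B f J \<zeta> (N \<union> (\<Union>p\<in>P. f -` V p)) \<gamma> \<and>
    forms_agree A 1 N \<gamma> \<beta>"
  using assms
proof (induction P rule: finite_induct)
  case empty
  then show ?case by (auto simp: forms_agree_def)
next
  case (insert p P)
  let ?D = "N \<union> (\<Union>p\<in>P. f -` V p)"
  obtain \<gamma> where \<gamma>: "smooth_form A 1 ?D \<gamma>" "tames_fibers A B f J \<zeta> ?D \<gamma>" "forms_agree A 1 N \<gamma> \<beta>"
    using insert.IH insert.prems by auto
  have D: "open ?D"
    using insert.prems(1,8) by (auto simp: bump_def intro!: open_vimage_smooth_map)
  have ag: "forms_agree A 1 N (\<alpha> p) \<gamma>"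
    using insert.prems(7)[of p] \<gamma>(3) by (simp add: forms_agree_def)
  obtain \<delta> where "smooth_form A 1 (?D \<union> f -` V p) \<delta>" "tames_fibers A B f J \<zeta> (?D \<union> f -` V p) \<delta>" "forms_agree A 1 N \<delta> \<gamma>"
    by (rule glue_primitives[OF D insert.prems(4)[of p] _ \<gamma>(1,2) insert.prems(5,6)[of p] ag
          insert.prems(8)[of p] insert.prems(9)[of p]]) auto
  moreover have "?D \<union> f -` V p = N \<union> (\<Union>p\<in>insert p P. f -` V p)" by auto
  ultimately show ?case using \<gamma>(3) by (auto simp: forms_agree_def)
qed

end

end

section \<open>The main theorem\<close>

text \<open>The pullback sees \<open>v\<close> only through \<open>df(v) = df(0)\<close>, so
  \<open>v\<close> may be replaced by 0, where bilinearity applies.\<close>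

lemma pullback_kernel:
  fixes A :: "('a::{t2_space, second_countable_topology}, 'e::{real_inner, heine_borel}) atlas"
    and B :: "('b::{t2_space, second_countable_topology}, 'h::{real_inner, heine_borel}) atlas"
  assumes A: "smooth_atlas A" and B: "smooth_atlas B" and f: "smooth_map A B f"
    and \<omega>: "smooth_form B 2 UNIV \<omega>"
    and v: "v \<in> ker_differential A B f x" and w: "w \<in> tangent_space A x"
  shows "pullback A B f \<omega> x [v, w] = 0" "pullback A B f \<omega> x [w, v] = 0"
proof -
  have "alternating_at A 2 x (pullback A B f \<omega> x)"
    using smooth_form_pullback[OF A B f _ \<omega>] by (simp add: smooth_form_def)
  note alt = alternating_at_2[OF A this]
  have 0: "pullback A B f \<omega> x [0, w] = 0" "pullback A B f \<omega> x [w, 0] = 0"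
    using alt(3)[OF w w w, of 0] alt(4)[OF w w w, of 0] by simp_all
  have "differential A B f x v = differential A B f x 0"
    using v differential_zero[OF A B f] by (simp add: ker_differential_def)
  then show "pullback A B f \<omega> x [v, w] = 0" "pullback A B f \<omega> x [w, v] = 0"
    using 0 by (simp_all add: pullback_def)
qed

text \<open>If \<open>J x v\<close> were outside the kernel, tameness would make the pullback
  positive on \<open>J x v\<close> and \<open>J x (J x v) = - v\<close>; but \<open>- v\<close> is
  annihilated by \<open>df\<close>.\<close>

lemma ker_differential_complex:
  fixes A :: "('a::{t2_space, second_countable_topology}, 'e::{real_inner, heine_borel}) atlas"
    and B :: "('b::{t2_space, second_countable_topology}, 'h::{real_inner, heine_borel}) atlas"
  assumes A: "smooth_atlas A" and B: "smooth_atlas B" and f: "smooth_map A B f"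
    and \<omega>: "smooth_form B 2 UNIV \<omega>" and J: "almost_complex A J" and tame: "tame_along A B f \<omega> J"
    and v: "v \<in> ker_differential A B f x"
  shows "J x v \<in> ker_differential A B f x"
proof (rule ccontr)
  assume n: "J x v \<notin> ker_differential A B f x"
  have vT: "v \<in> tangent_space A x" using v by (simp add: ker_differential_def)
  then have JT: "J x v \<in> tangent_space A x" and JJ: "J x (J x v) = - v"
    using J by (auto simp: almost_complex_def)
  have "pullback A B f \<omega> x [J x v, - v] > 0"
    using tame n JT JJ unfolding tame_along_def by force
  moreover have "alternating_at A 2 x (pullback A B f \<omega> x)"
    using smooth_form_pullback[OF A B f _ \<omega>] by (simp add: smooth_form_def)
  then have "pullback A B f \<omega> x [J x v, - v] = - pullback A B f \<omega> x [J x v, v]"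
    using alternating_at_2(4)[OF A _ vT vT JT, of _ "-1"] by simp
  ultimately show False using pullback_kernel[OF A B f \<omega> v JT] by simp
qed

theorem theorem3p1:
  fixes A :: "('a::{t2_space, second_countable_topology}, 'e::{real_inner, heine_borel}) atlas"
    and B :: "('b::{t2_space, second_countable_topology}, 'h::{real_inner, heine_borel}) atlas"
    and f :: "'a \<Rightarrow> 'b"
    and C W\<^sub>C :: "'a set"
    and \<omega>\<^sub>Y :: "('b, 'h) dform"
    and J :: "'a \<Rightarrow> ('a, 'e) tvec \<Rightarrow> ('a, 'e) tvec"
    and c :: "('a, 'e) dform set"
    and W :: "'b \<Rightarrow> 'a set"
    and \<eta>\<^sub>y :: "'b \<Rightarrow> ('a, 'e) dform"
    and \<eta>\<^sub>C :: "('a, 'e) dform"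
  assumes "smooth_atlas A" and "smooth_atlas B" and "smooth_map A B f"
    and "closed C" and "compact (UNIV - interior C)"
    and "open W\<^sub>C" and "C \<subseteq> W\<^sub>C"
    and "symplectic_form B \<omega>\<^sub>Y"
    and "almost_complex A J" and "tame_along A B f \<omega>\<^sub>Y J"
    and "c \<in> de_rham A 2 UNIV"
    and "\<And>y. open (W y)" and "\<And>y. f -` {y} \<subseteq> W y" and "\<And>y. W\<^sub>C \<subseteq> W y"
    and "\<And>y. de_rham_restrict A 1 W\<^sub>C ` de_rham A 1 (W y) = de_rham A 1 W\<^sub>C"
    and "\<And>y. closed_form A 2 (W y) (\<eta>\<^sub>y y)"
    and "\<And>y. de_rham_class A 2 (W y) (\<eta>\<^sub>y y) = de_rham_restrict A 2 (W y) c"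
    and "\<And>y x. x \<in> W y \<Longrightarrow> tames_at (\<eta>\<^sub>y y) J x (ker_differential A B f x)"
    and "\<And>y. forms_agree A 2 W\<^sub>C (\<eta>\<^sub>y y) \<eta>\<^sub>C"
    and "tames_over A \<eta>\<^sub>C J C"
  shows "\<exists>\<eta>. closed_form A 2 UNIV \<eta> \<and>
      (\<exists>N. open N \<and> C \<subseteq> N \<and> N \<subseteq> W\<^sub>C \<and> forms_agree A 2 N \<eta> \<eta>\<^sub>C) \<and>
      de_rham_class A 2 UNIV \<eta> = c \<and>
      (\<exists>t\<^sub>0>0. \<forall>t. 0 < t \<and> t < t\<^sub>0 \<longrightarrow>
         (let \<omega>\<^sub>t = (\<lambda>x vs. t * \<eta> x vs + pullback A B f \<omega>\<^sub>Y x vs)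
          in tames_over A \<omega>\<^sub>t J UNIV \<and> symplectic_form A \<omega>\<^sub>t))"
proof -
  note A = assms(1) and B = assms(2) and f = assms(3) and W = assms(12) and WC = assms(14)
  have t2: "tvecs A 2 x = tvecs A (Suc 1) x" for x by (simp add: numeral_2_eq_2)
  have \<omega>: "closed_form B 2 UNIV \<omega>\<^sub>Y" using assms(8) by (simp add: symplectic_form_def)
  then have s\<omega>: "smooth_form B 2 UNIV \<omega>\<^sub>Y" by (simp add: closed_form_iff[OF B])
  define \<theta> where "\<theta> = pullback A B f \<omega>\<^sub>Y"
  have \<theta>: "closed_form A 2 UNIV \<theta>"
    unfolding \<theta>_def by (rule closed_form_pullback[OF A B f _ \<omega>]) simp
  have ker_J: "J x v \<in> ker_differential A B f x" if "v \<in> ker_differential A B f x" for x v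
    by (rule ker_differential_complex[OF A B f s\<omega> assms(9,10) that])
  have JT: "J x v \<in> tangent_space A x" if "v \<in> tangent_space A x" for x v
    using assms(9) that by (simp add: almost_complex_def)
  have \<theta>pos: "\<theta> x [v, J x v] > 0" if "v \<in> tangent_space A x" "v \<notin> ker_differential A B f x" for x v
    using assms(10) that by (simp add: tame_along_def \<theta>_def)
  have \<theta>ker: "\<theta> x [v, J x v] = 0" if "v \<in> ker_differential A B f x" for x v
    unfolding \<theta>_def
    by (rule pullback_kernel[OF A B f s\<omega> that]) (use that JT in \<open>simp add: ker_differential_def\<close>)
  have \<theta>nonneg: "\<theta> x [v, J x v] \<ge> 0" if "v \<in> tangent_space A x" for x v
    using \<theta>pos[OF that] \<theta>ker[of v x] by (cases "v \<in> ker_differential A B f x") auto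

  obtain \<zeta> where \<zeta>: "closed_form A 2 UNIV \<zeta>" "c = de_rham_class A 2 UNIV \<zeta>"
    using assms(11) by (auto simp: de_rham_def de_rham_class_def elim: quotientE)
  have "\<exists>\<alpha>. smooth_form A 1 (W y) \<alpha> \<and>
      (\<forall>x\<in>W y. \<forall>vs\<in>tvecs A 2 x. \<eta>\<^sub>y y x vs = \<zeta> x vs + ext_deriv A \<alpha> x vs)" for y
    using primitive_of_restricted_class[OF A W \<zeta>(2) assms(16,17)] by (metis (no_types, lifting))
  then obtain \<alpha> where s\<alpha>: "\<And>y. smooth_form A 1 (W y) (\<alpha> y)"
    and \<alpha>: "\<And>y x vs. x \<in> W y \<Longrightarrow> vs \<in> tvecs A 2 x \<Longrightarrow> \<eta>\<^sub>y y x vs = \<zeta> x vs + ext_deriv A (\<alpha> y) x vs"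
    by metis
  \<comment> \<open>Any index would do: over \<open>W\<^sub>C\<close> every
    \<open>\<alpha> y\<close> has the same differential, namely
    \<open>\<eta>\<^sub>C - \<zeta>\<close>.\<close>
  define \<alpha>0 where "\<alpha>0 = \<alpha> undefined"
  have s\<alpha>0: "smooth_form A 1 W\<^sub>C \<alpha>0"
    unfolding \<alpha>0_def by (rule smooth_form_subset[OF A s\<alpha> WC])
  have d\<alpha>0: "\<eta>\<^sub>C x vs = \<zeta> x vs + ext_deriv A \<alpha>0 x vs" if "x \<in> W\<^sub>C" "vs \<in> tvecs A 2 x" for x vs
    using \<alpha>[of x undefined vs] assms(19)[of undefined] that WC[of undefined]
    by (auto simp: \<alpha>0_def forms_agree_def)
  have dagree: "ext_deriv A (\<alpha> y) x vs = ext_deriv A \<alpha>0 x vs"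
    if "x \<in> W\<^sub>C" "vs \<in> tvecs A 2 x" for x vs y
    using \<alpha>[of x y vs] d\<alpha>0[OF that] assms(19)[of y] that WC[of y] by (auto simp: forms_agree_def)

  obtain \<rho> :: "'a \<Rightarrow> real" and N Z where N: "open N" "C \<subseteq> N" "N \<subseteq> W\<^sub>C"
    and Z: "open Z" "Z \<union> W\<^sub>C = UNIV"
    and \<rho>: "smooth_form A 0 UNIV (\<lambda>x vs. \<rho> x)" "\<And>x. x \<in> N \<Longrightarrow> \<rho> x = 1" "\<And>x. x \<in> Z \<Longrightarrow> \<rho> x = 0"
    by (rule cutoff_function_exists[OF A assms(4-7)]) blast
  \<comment> \<open>The target \<open>\<alpha>0\<close> does not depend on \<open>y\<close>, so all
    corrected primitives agree with one another on \<open>N\<close>.\<close>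
  have "\<exists>\<beta>. smooth_form A 1 (W y) \<beta> \<and>
      (\<forall>x\<in>W y. \<forall>vs\<in>tvecs A 2 x. ext_deriv A \<beta> x vs = ext_deriv A (\<alpha> y) x vs) \<and>
      forms_agree A 1 N \<beta> \<alpha>0" for y
    by (rule adjust_primitive[OF A W assms(6) WC N(1,3) Z \<rho> assms(15) s\<alpha> s\<alpha>0 dagree, of y]) blast+
  then obtain \<beta> where \<beta>: "\<And>y. smooth_form A 1 (W y) (\<beta> y)" "\<And>y. forms_agree A 1 N (\<beta> y) \<alpha>0"
    and d\<beta>: "\<And>y x vs. x \<in> W y \<Longrightarrow> vs \<in> tvecs A 2 x \<Longrightarrow> ext_deriv A (\<beta> y) x vs = ext_deriv A (\<alpha> y) x vs"
    by metis
  have kervecs: "[v, J x v] \<in> tvecs A 2 x" if "v \<in> ker_differential A B f x" for x v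
    using that JT by (simp add: tvecs_2[OF A] ker_differential_def)
  have fib_\<alpha>: "tames_fibers A B f J \<zeta> (W y) (\<alpha> y)" for y
    unfolding tames_fibers_def tames_at_def
  proof (intro ballI impI)
    fix x v assume x: "x \<in> W y" and v: "v \<in> ker_differential A B f x" "v \<noteq> 0"
    have "\<eta>\<^sub>y y x [v, J x v] > 0" using assms(18)[OF x] v unfolding tames_at_def by blast
    then show "\<zeta> x [v, J x v] + ext_deriv A (\<alpha> y) x [v, J x v] > 0"
      unfolding \<alpha>[OF x kervecs[OF v(1)]] .
  qed
  have fib_\<beta>: "tames_fibers A B f J \<zeta> (W y) (\<beta> y)" for y
    by (rule tames_fibers_cong[OF A B f ker_J fib_\<alpha> subset_refl d\<beta>])
  have fib_0: "tames_fibers A B f J \<zeta> N \<alpha>0"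
    using fib_\<alpha>[of undefined] N(3) WC[of undefined] unfolding tames_fibers_def \<alpha>0_def by blast

  \<comment> \<open>The largest set whose preimage lies in \<open>W y\<close>. It is open because
    the complement of \<open>W y\<close> avoids \<open>C\<close>, hence is compact and has a
    compact, therefore closed, image.\<close>
  define U where "U y = - f ` (- W y)" for y
  have U: "open (U y)" "y \<in> U y" "f -` U y \<subseteq> W y" for y
  proof -
    have "- W y = (UNIV - interior C) \<inter> - W y"
      using assms(7) WC[of y] interior_subset[of C] by auto
    moreover have "closed (- W y)" using W by (simp add: closed_Compl)
    ultimately have "compact (- W y)" using compact_Int_closed[OF assms(5)] by metis
    then have "compact (f ` (- W y))"
      using f by (intro compact_continuous_image) (auto simp: smooth_map_def intro: continuous_on_subset)
    then show "open (U y)" by (simp add: U_def compact_imp_closed open_Compl)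
    show "y \<in> U y" using assms(13)[of y] by (auto simp: U_def)
    show "f -` U y \<subseteq> W y" by (auto simp: U_def)
  qed
  have "\<exists>b V F. bump B b V F \<and> y \<in> V \<and> F \<subseteq> U y" for y
    by (rule bump_function_exists[OF B U(1,2)])
  then obtain b V F where bump: "\<And>y. bump B (b y) (V y) (F y)" "\<And>y. y \<in> V y" "\<And>y. F y \<subseteq> U y"
    by metis
  have F: "f -` F y \<subseteq> W y" for y using bump(3)[of y] U(3)[of y] by blast
  have oV: "open (V y)" for y using bump(1)[of y] by (simp add: bump_def)
  have "compact (f ` (UNIV - interior C))"
    using f by (intro compact_continuous_image assms(5)) (auto simp: smooth_map_def intro: continuous_on_subset)
  then obtain P where P: "finite P" "f ` (UNIV - interior C) \<subseteq> (\<Union>p\<in>P. V p)"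
    using compactE_image[of "f ` (UNIV - interior C)" UNIV V] oV bump(2) by (metis UN_I UNIV_I subsetI)
  have s\<alpha>N: "smooth_form A 1 N \<alpha>0" using smooth_form_subset[OF A s\<alpha>0 N(3)] .
  have "\<exists>\<gamma>. smooth_form A 1 (N \<union> (\<Union>p\<in>P. f -` V p)) \<gamma> \<and>
      tames_fibers A B f J \<zeta> (N \<union> (\<Union>p\<in>P. f -` V p)) \<gamma> \<and> forms_agree A 1 N \<gamma> \<alpha>0"
    by (rule glue_primitives_finite[OF A B f _ P(1) N(1) s\<alpha>N fib_0,
          where W = W and \<alpha> = \<beta> and b = b and F = F])
      (assumption | rule ker_J W \<beta>(1) fib_\<beta> \<beta>(2) bump(1) F)+
  then obtain \<gamma> where \<gamma>: "smooth_form A 1 (N \<union> (\<Union>p\<in>P. f -` V p)) \<gamma>"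
    "tames_fibers A B f J \<zeta> (N \<union> (\<Union>p\<in>P. f -` V p)) \<gamma>" "forms_agree A 1 N \<gamma> \<alpha>0" 
    by (elim exE conjE) (rule that)
  \<comment> \<open>The sets \<open>V p\<close> cover only the image of
    \<open>UNIV - interior C\<close>; the points of \<open>interior C\<close> lie in
    \<open>N\<close>, where the gluing started from \<open>\<alpha>0\<close>.\<close>
  have univ: "N \<union> (\<Union>p\<in>P. f -` V p) = UNIV"
    using P(2) N(2) interior_subset[of C] by blast

  define \<eta> where "\<eta> = (\<lambda>x vs. \<zeta> x vs + ext_deriv A \<gamma> x vs)"
  have s\<gamma>: "smooth_form A 1 UNIV \<gamma>" using \<gamma>(1) by (simp only: univ)
  have "closed_form A 2 UNIV (ext_deriv A \<gamma>)"
    using closed_form_ext_deriv[OF A _ open_UNIV s\<gamma>] by (simp add: numeral_2_eq_2)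
  then have \<eta>: "closed_form A 2 UNIV \<eta>"
    unfolding \<eta>_def by (rule closed_form_add[OF A open_UNIV \<zeta>(1)])
  have \<eta>ker: "\<eta> x [v, J x v] > 0" if "v \<in> ker_differential A B f x" "v \<noteq> 0" for x v
    using \<gamma>(2) that unfolding tames_fibers_def univ tames_at_def \<eta>_def by blast
  have \<eta>C: "forms_agree A 2 N \<eta> \<eta>\<^sub>C"
    unfolding forms_agree_def
  proof (intro ballI)
    fix x vs assume x: "x \<in> N" and vs: "vs \<in> tvecs A 2 x"
    have "ext_deriv A \<gamma> x vs = ext_deriv A \<alpha>0 x vs"
      by (rule ext_deriv_cong[OF A N(1) x \<gamma>(3)]) (use vs t2 in simp)
    then show "\<eta> x vs = \<eta>\<^sub>C x vs" using d\<alpha>0[of x vs] x vs N(3) by (auto simp: \<eta>_def)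
  qed
  have "(\<eta>, \<zeta>) \<in> cohomologous A (Suc 1) UNIV"
    using \<eta> \<zeta>(1) s\<gamma> by (auto simp: cohomologous_def exact_form_Suc[OF A] \<eta>_def numeral_2_eq_2)
  then have cls: "de_rham_class A 2 UNIV \<eta> = c"
    using de_rham_class_eqI[OF A open_UNIV] by (metis \<zeta>(2) Suc_1)

  have s\<eta>: "smooth_form A 2 UNIV \<eta>" and s\<theta>: "smooth_form A 2 UNIV \<theta>"
    using \<eta> \<theta> by (auto simp: closed_form_iff[OF A])
  \<comment> \<open>By tameness of \<open>\<omega>\<^sub>Y\<close> along \<open>f\<close>, the
    vanishing of \<open>\<theta>\<close> on \<open>(v, Jv)\<close> forces \<open>v\<close> into the
    kernel, where the glued form is positive.\<close>
  have pos: "\<eta> x [v, J x v] > 0"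
    if "v \<in> tangent_space A x" "v \<noteq> 0" "\<theta> x [v, J x v] = 0" for x v
    using \<eta>ker[of v x] \<theta>pos[of v x] that by (cases "v \<in> ker_differential A B f x") auto
  obtain t0 where t0: "t0 > 0" "\<And>t. 0 < t \<Longrightarrow> t < t0 \<Longrightarrow>
      tames_over A (\<lambda>x vs. t * \<eta> x vs + \<theta> x vs) J (UNIV - interior C)"
    by (rule tames_for_small_parameters[OF A s\<eta> s\<theta> assms(9,5) \<theta>nonneg pos]) blast+
  have tame: "tames_over A (\<lambda>x vs. t * \<eta> x vs + \<theta> x vs) J UNIV" if t: "0 < t" "t < t0" for t
    unfolding tames_over_def tames_at_def
  proof (intro ballI impI)
    fix x v assume v: "v \<in> tangent_space A x" "v \<noteq> 0"
    show "t * \<eta> x [v, J x v] + \<theta> x [v, J x v] > 0"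
    \<comment> \<open>On \<open>C\<close> every \<open>t > 0\<close> works, since
      \<open>\<eta>\<close> equals the taming form \<open>\<eta>\<^sub>C\<close> there and
      \<open>\<theta>\<close> is nonnegative. Outside \<open>C\<close> the bound \<open>t0\<close>
      from the compact set applies.\<close>
    proof (cases "x \<in> C")
      case True
      then have "\<eta>\<^sub>C x [v, J x v] > 0" using assms(20) v by (simp add: tames_over_def tames_at_def)
      moreover have "[v, J x v] \<in> tvecs A 2 x" using v JT by (simp add: tvecs_2[OF A])
      ultimately have "\<eta> x [v, J x v] > 0" using \<eta>C True N(2) by (auto simp: forms_agree_def)
      then show ?thesis using t \<theta>nonneg[OF v(1)] by (simp add: add_pos_nonneg)
    next
      case False
      then have "x \<in> UNIV - interior C" using interior_subset[of C] by blast
      then show ?thesis using t0(2)[OF t] v unfolding tames_over_def tames_at_def by blast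
    qed
  qed
  have symp: "symplectic_form A (\<lambda>x vs. t * \<eta> x vs + \<theta> x vs)" if t: "0 < t" "t < t0" for t
    unfolding symplectic_form_def
  proof (intro conjI allI ballI impI)
    show "closed_form A 2 UNIV (\<lambda>x vs. t * \<eta> x vs + \<theta> x vs)"
      by (rule closed_form_add[OF A open_UNIV closed_form_cmult[OF A open_UNIV \<eta>] \<theta>])
    fix x v assume v: "v \<in> tangent_space A x" "v \<noteq> 0"
    have "t * \<eta> x [v, J x v] + \<theta> x [v, J x v] > 0"
      using tame[OF t] v by (simp add: tames_over_def tames_at_def)
    \<comment> \<open>Taming implies nondegeneracy, with \<open>J x v\<close> as the vector that
      pairs nontrivially with \<open>v\<close>.\<close>
    then show "\<exists>w\<in>tangent_space A x. t * \<eta> x [v, w] + \<theta> x [v, w] \<noteq> 0"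
      using JT[OF v(1)] by (intro bexI[of _ "J x v"]) auto
  qed
  show ?thesis
    using \<eta> N \<eta>C cls t0(1) tame symp
    unfolding Let_def \<theta>_def[symmetric] by blast
qed

end
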